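(* Let $p$ be a prime, $s \ge 1$, and $q=p^s$. Let $m$ and $\ell$ be positive integers. For each integer $r$ with $0 \le r \le m$, there exists a $(v,k_r,\lambda_r,\mu_r)$ partial difference set $D_r$ in the elementary abelian $p$-group $G=\mathbb{Z}_p^{sm(2\ell+1)}$, where \begin{align*} v &= q^{m(2\ell+1)},\\ k_r &= \frac{(q^r-1)(q^{m\ell}-1)(q^{m(\ell+1)}-1)}{q^m-1} + q^{m\ell}-1,\\ \lambda_r &= \frac{(q^r-1)(q^{m(\ell+1)}-1)}{q^m-1}\Big(\frac{(q^r-1)(q^{m\ell}-1)}{q^m-1}-1\Big) + q^{m\ell}-2,\\ \mu_r &= \frac{(q^r-1)(q^{m\ell}-1)}{q^m-1}\Big(\frac{(q^r-1)(q^{m(\ell+1)}-1)}{q^m-1}+1\Big). \end{align*} Consequently, the Cayley graph $\mathrm{Cay}(G,D_r)$ is a $(v,k_r,\lambda_r,\mu_r)$ strongly regular graph.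
   Context: Let $G$ be an additively written finite group of order $v$. A subset $D\subseteq G$ with $|D|=k$ and $0_G\notin D$ is a $(v,k,\lambda,\mu)$ partial difference set (PDS) if the differences $g-h$ with $g,h\in D$, $g\neq h$, represent each element of $D$ exactly $\lambda$ times and each nonidentity element of $G\setminus D$ exactly $\mu$ times. For $D\subseteq G$ with $0_G\notin D$ and $D=-D$, the Cayley graph $\mathrm{Cay}(G,D)$ has vertex set $G$, with $g,h$ adjacent iff $g-h\in D$. A $(v,k,\lambda,\mu)$ strongly regular graph is a $k$-regular simple graph on $v$ vertices in which any two adjacent vertices have exactly $\lambda$ common neighbours and any two distinct non-adjacent vertices have exactly $\mu$ common neighbours. *)

theory Defs
  imports
    Complex_Main
    "HOL-Computational_Algebra.Primes"
    "HOL-Algebra.Elementary_Groups"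
    "HOL-Algebra.Product_Groups"
    "Graph_Theory.Pair_Digraph"
begin

text \<open>Groups are multiplicative in HOL-Algebra: the difference $g - h$ is \<open>g \<otimes> inv h\<close>,
  and $-D$ is \<open>set_inv D\<close>.\<close>

definition difference_reps :: "('a, 'b) monoid_scheme \<Rightarrow> 'a set \<Rightarrow> 'a \<Rightarrow> ('a \<times> 'a) set"
  where "difference_reps G D x =
    {(g, h). g \<in> D \<and> h \<in> D \<and> g \<noteq> h \<and> g \<otimes>\<^bsub>G\<^esub> inv\<^bsub>G\<^esub> h = x}"

definition partial_difference_set ::
    "('a, 'b) monoid_scheme \<Rightarrow> nat \<Rightarrow> nat \<Rightarrow> nat \<Rightarrow> nat \<Rightarrow> 'a set \<Rightarrow> bool"
  where "partial_difference_set G v k lam mu D \<longleftrightarrow>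
    group G \<and> finite (carrier G) \<and> order G = v \<and>
    D \<subseteq> carrier G \<and> card D = k \<and> \<one>\<^bsub>G\<^esub> \<notin> D \<and>
    (\<forall>x\<in>D. card (difference_reps G D x) = lam) \<and>
    (\<forall>x\<in>carrier G - D. x \<noteq> \<one>\<^bsub>G\<^esub> \<longrightarrow> card (difference_reps G D x) = mu)"

definition cayley_graph :: "('a, 'b) monoid_scheme \<Rightarrow> 'a set \<Rightarrow> 'a pair_pre_digraph"
  where "cayley_graph G D =
    \<lparr>pverts = carrier G,
     parcs = {(g, h). g \<in> carrier G \<and> h \<in> carrier G \<and> g \<otimes>\<^bsub>G\<^esub> inv\<^bsub>G\<^esub> h \<in> D}\<rparr>"

definition neighbours :: "'a pair_pre_digraph \<Rightarrow> 'a \<Rightarrow> 'a set"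
  where "neighbours \<Gamma> x = {y \<in> pverts \<Gamma>. (x, y) \<in> parcs \<Gamma>}"

text \<open>\<open>pair_graph\<close> makes \<open>\<Gamma>\<close> a finite simple graph: its arc relation is symmetric and loopless,
  an undirected edge being a pair of opposite arcs.\<close>

definition strongly_regular_graph ::
    "nat \<Rightarrow> nat \<Rightarrow> nat \<Rightarrow> nat \<Rightarrow> 'a pair_pre_digraph \<Rightarrow> bool"
  where "strongly_regular_graph v k lam mu \<Gamma> \<longleftrightarrow>
    pair_graph \<Gamma> \<and> card (pverts \<Gamma>) = v \<and>
    (\<forall>x\<in>pverts \<Gamma>. card (neighbours \<Gamma> x) = k) \<and>
    (\<forall>x\<in>pverts \<Gamma>. \<forall>y\<in>pverts \<Gamma>. (x, y) \<in> parcs \<Gamma> \<longrightarrow>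
       card (neighbours \<Gamma> x \<inter> neighbours \<Gamma> y) = lam) \<and>
    (\<forall>x\<in>pverts \<Gamma>. \<forall>y\<in>pverts \<Gamma>. x \<noteq> y \<and> (x, y) \<notin> parcs \<Gamma> \<longrightarrow>
       card (neighbours \<Gamma> x \<inter> neighbours \<Gamma> y) = mu)"

definition elementary_abelian_group :: "nat \<Rightarrow> nat \<Rightarrow> (nat \<Rightarrow> int) monoid"
  where "elementary_abelian_group p n = product_group {..<n} (\<lambda>_. integer_mod_group p)"

end

theory Submission
  imports
    "HOL-Algebra.Sylow"
    "HOL-Algebra.Algebraic_Closure"
    "HOL-Number_Theory.Residues"
    Defs
begin

hide_const (open) Divisibility.prime

text \<open>
  Put \<open>Q = q\<^sup>m\<close> and let \<open>F\<close>, \<open>K\<close>, \<open>L\<close> be the fields with \<open>Q\<close>, \<open>Q\<^sup>l\<close>, \<open>Q\<^sup>l\<^sup>+\<^sup>1\<close> elements inside an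
  algebraic closure of the prime field. For an additive subgroup \<open>U\<close> of \<open>F\<close> of order \<open>q\<^sup>r\<close>, the set
  \<open>D\<close> of all \<open>(x, y)\<close> in \<open>K \<times> L\<close> with \<open>x \<noteq> 0\<close> and \<open>N(y) / N(x)\<close> in \<open>U\<close> works: every nontrivial
  additive character of \<open>K \<times> L\<close> takes one of two values on it.

  The key point is that the Gauss sum of \<open>L\<close> times the inverted Gauss sum of \<open>K\<close>, read in the group
  ring of the multiplicative group of \<open>F\<close>, is by the Davenport--Hasse relation \<open>Q\<^sup>l\<close> times a Gauss
  sum of \<open>F\<close>, up to sign and a multiple of the sum of all group elements. Hence the sum of a character
  over \<open>N(y) = c N(x)\<close> is affine in an additive character of \<open>F\<close> evaluated at \<open>c\<close>, and summing over
  \<open>c\<close> in \<open>U\<close> leaves two values.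

  The Davenport--Hasse relation is proved by Weil's argument, with monic polynomials over \<open>F\<close>
  replaced by Frobenius-invariant multisets of roots.
\<close>

section \<open>Partial difference sets and their Cayley graphs\<close>

text \<open>Why the degrees \<open>l\<close> and \<open>l + 1\<close>: iterating the
  Davenport--Hasse relation makes the Gauss sum of degree \<open>d\<close>, up to sign, the
  \<open>d\<close>-th convolution power of the Gauss sum of \<open>F\<close>. Pairing degree
  \<open>l + 1\<close> with the inverse of degree \<open>l\<close> cancels all but one factor, each
  cancelled pair contributing \<open>Q\<close>. What survives is \<open>\<psi>\<close> itself, and
  an additive character summed over an additive subgroup gives 0 or the order of the subgroup. A
  larger gap would leave a Kloosterman-type sum. The multiplicative side is kept as convolution on
  the nonzero elements of \<open>F\<close>, so no multiplicative character is introduced; the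
  exceptional behaviour of the trivial one shows up only as the additive constant
  \<open>geo l\<close>. With \<open>u = card U\<close>, \<open>A = (u - 1) * geo l\<close> and
  \<open>B = (u - 1) * geo (Suc l)\<close>, the two eigenvalues are \<open>- 1 - B\<close> and
  \<open>Q ^ l - 1 - A\<close>. They differ by \<open>u * Q ^ l\<close>, and together with the
  valency they determine lambda and mu.\<close>

lemma neighbours_cayley_graph:
  "neighbours (cayley_graph G D) x =
    {y \<in> carrier G. x \<in> carrier G \<and> x \<otimes>\<^bsub>G\<^esub> inv\<^bsub>G\<^esub> y \<in> D}"
  by (auto simp: neighbours_def cayley_graph_def)

lemma (in group) card_neighbours_cayley_graph:
  assumes D: "D \<subseteq> carrier G" and x: "x \<in> carrier G"
  shows "card (neighbours (cayley_graph G D) x) = card D"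
proof -
  have "bij_betw (\<lambda>y. x \<otimes> inv y) (neighbours (cayley_graph G D) x) D"
  proof (rule bij_betw_byWitness[where f' = "\<lambda>d. inv d \<otimes> x"])
    show "(\<lambda>y. x \<otimes> inv y) ` neighbours (cayley_graph G D) x \<subseteq> D"
      by (auto simp: neighbours_cayley_graph)
    show "(\<lambda>d. inv d \<otimes> x) ` D \<subseteq> neighbours (cayley_graph G D) x"
      using D x by (auto simp: neighbours_cayley_graph inv_mult_group m_assoc[symmetric] subset_iff)
  qed (use D x in \<open>auto simp: neighbours_cayley_graph inv_mult_group m_assoc m_assoc[symmetric] subset_iff\<close>)
  then show ?thesis by (rule bij_betw_same_card)
qed

text \<open>For a common neighbour \<open>z\<close>, the quotient of
  \<open>x \<otimes> inv z\<close> by \<open>y \<otimes> inv z\<close> no longer involves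
  \<open>z\<close>. Conversely, a representation \<open>(g, h)\<close> of
  \<open>x \<otimes> inv y\<close> determines \<open>z\<close> as
  \<open>inv g \<otimes> x = inv h \<otimes> y\<close>. The argument is valid in non-abelian
  groups.\<close>

lemma (in group) card_common_neighbours_cayley_graph:
  assumes D: "D \<subseteq> carrier G" and x: "x \<in> carrier G" and y: "y \<in> carrier G" and "x \<noteq> y"
  shows "card (neighbours (cayley_graph G D) x \<inter> neighbours (cayley_graph G D) y)
       = card (difference_reps G D (x \<otimes> inv y))"
proof -
  let ?N = "neighbours (cayley_graph G D) x \<inter> neighbours (cayley_graph G D) y"
  have *: "x \<otimes> inv z \<otimes> inv (y \<otimes> inv z) = x \<otimes> inv y" if "z \<in> carrier G" for z
  proof -
    have "inv z \<otimes> (z \<otimes> inv y) = inv y" using that y by (simp add: m_assoc[symmetric])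
    then show ?thesis using that x y by (simp add: inv_mult_group m_assoc)
  qed
  have eq: "inv h \<otimes> y = inv g \<otimes> x"
    if "g \<in> D" "h \<in> D" "g \<otimes> inv h = x \<otimes> inv y" for g h
  proof -
    have g: "g \<in> carrier G" and h: "h \<in> carrier G" using that D by auto
    have "inv h = inv g \<otimes> (g \<otimes> inv h)"
      using g h by (simp add: m_assoc[symmetric])
    also have "\<dots> = inv g \<otimes> x \<otimes> inv y" using that(3) g x y by (simp add: m_assoc)
    finally show ?thesis using g h x y by (simp add: m_assoc)
  qed
  have "bij_betw (\<lambda>z. (x \<otimes> inv z, y \<otimes> inv z)) ?N (difference_reps G D (x \<otimes> inv y))"
  proof (rule bij_betw_byWitness[where f' = "\<lambda>(g, h). inv g \<otimes> x"])
    show "(\<lambda>z. (x \<otimes> inv z, y \<otimes> inv z)) ` ?N \<subseteq> difference_reps G D (x \<otimes> inv y)"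
      using \<open>x \<noteq> y\<close> x y *
      by (auto simp: neighbours_cayley_graph difference_reps_def)
    show "(\<lambda>(g, h). inv g \<otimes> x) ` difference_reps G D (x \<otimes> inv y) \<subseteq> ?N"
    proof clarify
      fix g h assume gh: "(g, h) \<in> difference_reps G D (x \<otimes> inv y)"
      then have g: "g \<in> carrier G" "g \<in> D" and h: "h \<in> carrier G" "h \<in> D"
        using D by (auto simp: difference_reps_def)
      have e: "inv h \<otimes> y = inv g \<otimes> x" using gh eq by (auto simp: difference_reps_def)
      have "x \<otimes> inv (inv g \<otimes> x) = g" using g x by (simp add: inv_mult_group m_assoc[symmetric])
      moreover have "y \<otimes> inv (inv g \<otimes> x) = h"
        using h y by (simp add: e[symmetric] inv_mult_group m_assoc[symmetric])
      ultimately show "inv g \<otimes> x \<in> ?N"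
        using g h x y by (simp add: neighbours_cayley_graph)
    qed
    show "\<forall>z\<in>?N. (\<lambda>(g, h). inv g \<otimes> x) (x \<otimes> inv z, y \<otimes> inv z) = z"
      using x y by (auto simp: neighbours_cayley_graph inv_mult_group m_assoc)
    show "\<forall>gh\<in>difference_reps G D (x \<otimes> inv y).
       (\<lambda>z. (x \<otimes> inv z, y \<otimes> inv z)) ((\<lambda>(g, h). inv g \<otimes> x) gh) = gh"
    proof clarify
      fix g h assume gh: "(g, h) \<in> difference_reps G D (x \<otimes> inv y)"
      then have g: "g \<in> carrier G" "g \<in> D" and h: "h \<in> carrier G" "h \<in> D"
        using D by (auto simp: difference_reps_def)
      have e: "inv h \<otimes> y = inv g \<otimes> x" using gh eq by (auto simp: difference_reps_def)
      have "x \<otimes> inv (inv g \<otimes> x) = g" using g x by (simp add: inv_mult_group m_assoc[symmetric])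
      moreover have "y \<otimes> inv (inv g \<otimes> x) = h"
        using h y by (simp add: e[symmetric] inv_mult_group m_assoc[symmetric])
      ultimately show "x \<otimes> inv (inv g \<otimes> x) = g \<and> y \<otimes> inv (inv g \<otimes> x) = h" by simp
    qed
  qed
  then show ?thesis by (rule bij_betw_same_card)
qed

lemma cayley_graph_strongly_regular:
  fixes G (structure)
  assumes pds: "partial_difference_set G v k lam mu D" and sym: "D = set_inv\<^bsub>G\<^esub> D"
  shows "strongly_regular_graph v k lam mu (cayley_graph G D)"
proof -
  interpret group G using pds by (simp add: partial_difference_set_def)
  have fin: "finite (carrier G)" and D: "D \<subseteq> carrier G" and one: "\<one> \<notin> D"
    using pds by (auto simp: partial_difference_set_def)
  have inv_D: "inv d \<in> D" if "d \<in> D" for d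
    using that by (subst sym) (auto simp: SET_INV_def)
  have swap: "y \<otimes> inv x \<in> D" if "x \<otimes> inv y \<in> D" "x \<in> carrier G" "y \<in> carrier G" for x y
    using inv_D[OF that(1)] that by (simp add: inv_mult_group)
  have "pair_graph (cayley_graph G D)"
    by unfold_locales
      (use fin one swap in \<open>auto simp: cayley_graph_def symmetric_def sym_def arcs_ends_def arc_to_ends_def
          intro: finite_subset[of _ "carrier G \<times> carrier G"]\<close>)
  moreover have "x \<otimes> inv y \<in> carrier G - D \<and> x \<otimes> inv y \<noteq> \<one>"
    if "x \<in> carrier G" "y \<in> carrier G" "x \<noteq> y" "(x, y) \<notin> parcs (cayley_graph G D)" for x y
    using that inv_equality[of x "inv y"] by (auto simp: cayley_graph_def)
  moreover have "x \<otimes> inv y \<in> D \<and> x \<noteq> y"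
    if "x \<in> carrier G" "y \<in> carrier G" "(x, y) \<in> parcs (cayley_graph G D)" for x y
    using that one by (auto simp: cayley_graph_def)
  moreover have "pverts (cayley_graph G D) = carrier G" by (simp add: cayley_graph_def)
  ultimately show ?thesis
    using pds card_neighbours_cayley_graph[OF D] card_common_neighbours_cayley_graph[OF D]
    unfolding strongly_regular_graph_def partial_difference_set_def order_def by simp
qed

text \<open>The set is built inside a product of two finite fields, whereas the final statement
  wants coordinates modulo \<open>p\<close>; this is the bridge.\<close>

lemma partial_difference_set_iso:
  assumes pds: "partial_difference_set G v k lam mu D" and H: "group H" and f: "f \<in> iso G H"
  shows "partial_difference_set H v k lam mu (f ` D)"
proof -
  interpret G: group G using pds by (simp add: partial_difference_set_def)
  interpret H: group H by (rule H)
  interpret group_hom G H f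
    using f by unfold_locales (auto simp: iso_def)
  have bij: "bij_betw f (carrier G) (carrier H)" using f by (simp add: iso_def)
  have fin: "finite (carrier G)" and D: "D \<subseteq> carrier G" and one: "\<one>\<^bsub>G\<^esub> \<notin> D"
    using pds by (auto simp: partial_difference_set_def)
  have inj: "inj_on f (carrier G)" using bij by (rule bij_betw_imp_inj_on)
  have f_D: "f x \<in> f ` D \<longleftrightarrow> x \<in> D" if "x \<in> carrier G" for x
    using that D by (intro inj_on_image_mem_iff[OF inj])
  have f_one: "f x = \<one>\<^bsub>H\<^esub> \<longleftrightarrow> x = \<one>\<^bsub>G\<^esub>" if "x \<in> carrier G" for x
    using inj_onD[OF inj, of x "\<one>\<^bsub>G\<^esub>"] that by auto
  have reps: "card (difference_reps H (f ` D) (f x)) = card (difference_reps G D x)"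
    if x: "x \<in> carrier G" for x
  proof -
    have "difference_reps H (f ` D) (f x) = map_prod f f ` difference_reps G D x"
    proof -
      have "f g \<otimes>\<^bsub>H\<^esub> inv\<^bsub>H\<^esub> f h = f x \<longleftrightarrow> g \<otimes>\<^bsub>G\<^esub> inv\<^bsub>G\<^esub> h = x" if "g \<in> D" "h \<in> D" for g h
      proof -
        have "f g \<otimes>\<^bsub>H\<^esub> inv\<^bsub>H\<^esub> f h = f (g \<otimes>\<^bsub>G\<^esub> inv\<^bsub>G\<^esub> h)"
          using that D by (simp add: subset_iff)
        then show ?thesis
          using inj_onD[OF inj, of "g \<otimes>\<^bsub>G\<^esub> inv\<^bsub>G\<^esub> h" x] that D x by auto
      qed
      moreover have "f g = f h \<longleftrightarrow> g = h" if "g \<in> D" "h \<in> D" for g h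
        using that D inj_onD[OF inj, of g h] by auto
      ultimately show ?thesis
        by (auto simp: difference_reps_def image_iff Bex_def)
    qed
    moreover have "inj_on (map_prod f f) (difference_reps G D x)"
      by (rule inj_on_subset[OF map_prod_inj_on[OF inj inj]])
        (use D in \<open>auto simp: difference_reps_def\<close>)
    ultimately show ?thesis by (simp add: card_image)
  qed
  have "order H = v" "finite (carrier H)"
    using bij_betw_same_card[OF bij] bij_betw_finite[OF bij] pds
    by (simp_all add: partial_difference_set_def order_def)
  moreover have "card (f ` D) = k"
    using card_image[OF inj_on_subset[OF inj D]] pds by (simp add: partial_difference_set_def)
  moreover have "card (difference_reps H (f ` D) y) = mu"
    if "y \<in> carrier H - f ` D" "y \<noteq> \<one>\<^bsub>H\<^esub>" for y
  proof -
    have "y \<in> f ` carrier G" using that bij_betw_imp_surj_on[OF bij] by simp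
    then obtain x where "x \<in> carrier G" "y = f x" by (elim imageE)
    then show ?thesis
      using that f_D[of x] f_one[of x] reps[of x] pds by (simp add: partial_difference_set_def)
  qed
  moreover have "card (difference_reps H (f ` D) y) = lam" if y: "y \<in> f ` D" for y
  proof -
    obtain x where "x \<in> D" "y = f x" using y by (elim imageE)
    moreover from this D have "x \<in> carrier G" by blast
    ultimately show ?thesis using reps[of x] pds by (simp add: partial_difference_set_def)
  qed
  moreover have "f ` D \<subseteq> carrier H" using D by auto
  moreover have "\<one>\<^bsub>H\<^esub> \<notin> f ` D" using f_D[of "\<one>\<^bsub>G\<^esub>"] one by simp
  ultimately show ?thesis
    using H unfolding partial_difference_set_def by blast
qed

lemma set_inv_iso:
  fixes D :: "'a set"
  assumes "group G" "group H" "f \<in> iso G H" "D \<subseteq> carrier G" "D = set_inv\<^bsub>G\<^esub> D"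
  shows "f ` D = set_inv\<^bsub>H\<^esub> (f ` D)"
proof -
  interpret group_hom G H f
    using assms by (auto simp: group_hom_def group_hom_axioms_def iso_def)
  have "set_inv\<^bsub>H\<^esub> (f ` D) = f ` (set_inv\<^bsub>G\<^esub> D)"
    using assms(4) by (auto simp: SET_INV_def subset_iff image_UN)
  then show ?thesis using assms(5) by simp
qed

text \<open>Expand the number of representations of \<open>x\<close> over the characters; the two eigenvalues
  satisfy a common quadratic equation, which linearises the squared character sums.\<close>

lemma (in group) card_difference_reps_two_eigenvalues:
  fixes ch :: "'i \<Rightarrow> 'a \<Rightarrow> complex"
  assumes fin: "finite (carrier G)" and D: "D \<subseteq> carrier G" and sym: "\<And>d. d \<in> D \<Longrightarrow> inv d \<in> D"
    and I: "finite I" "i0 \<in> I"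
    and ch_mult: "\<And>i x y. i \<in> I \<Longrightarrow> x \<in> carrier G \<Longrightarrow> y \<in> carrier G \<Longrightarrow> ch i (x \<otimes> y) = ch i x * ch i y"
    and ortho: "\<And>x. x \<in> carrier G \<Longrightarrow> (\<Sum>i\<in>I. ch i x) = (if x = \<one> then of_nat (order G) else 0)"
    and triv: "\<And>x. x \<in> carrier G \<Longrightarrow> ch i0 x = 1"
    and eigen: "\<And>i. i \<in> I \<Longrightarrow> i \<noteq> i0 \<Longrightarrow> (\<Sum>d\<in>D. ch i d) \<in> {\<theta>1, \<theta>2}"
    and x: "x \<in> carrier G" "x \<noteq> \<one>"
  shows "of_nat (card (difference_reps G D x)) * of_nat (order G) =
    (if x \<in> D then (\<theta>1 + \<theta>2) * of_nat (order G) else 0)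
      + (of_nat (card D) - \<theta>1) * (of_nat (card D) - \<theta>2)"
proof -
  define E where "E i = (\<Sum>d\<in>D. ch i d)" for i
  have finD: "finite D" using D fin by (rule finite_subset)
  have inj: "inj_on (m_inv G) D" using D by (meson inj_onI inv_inj subset_iff inj_on_subset)
  have invD: "m_inv G ` D = D"
    using sym D by (force simp: image_iff)
  have E_inv: "(\<Sum>h\<in>D. ch i (inv h)) = E i" for i
    using sum.reindex[OF inj, of "ch i"] by (simp add: invD E_def)
  have delta: "(\<Sum>i\<in>I. ch i (y \<otimes> inv x)) = (if y = x then of_nat (order G) else 0)"
    if "y \<in> carrier G" for y
    using ortho[of "y \<otimes> inv x"] that x by (auto simp: inv_solve_right')
  have reps: "difference_reps G D x = {(g, h) \<in> D \<times> D. g \<otimes> inv h = x}"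
    using x D by (auto simp: difference_reps_def)
  have "of_nat (card (difference_reps G D x)) * of_nat (order G) =
      (\<Sum>gh\<in>difference_reps G D x. of_nat (order G) :: complex)" by simp
  also have "\<dots> = (\<Sum>(g, h)\<in>D \<times> D. if g \<otimes> inv h = x then of_nat (order G) else 0)"
    unfolding reps using finD by (intro sum.mono_neutral_cong_left) (auto split: if_splits)
  also have "\<dots> = (\<Sum>(g, h)\<in>D \<times> D. \<Sum>i\<in>I. ch i g * ch i (inv h) * ch i (inv x))"
  proof (intro sum.cong refl, clarify)
    fix g h assume "g \<in> D" "h \<in> D"
    then have "g \<in> carrier G" "h \<in> carrier G" using D by auto
    then show "(if g \<otimes> inv h = x then of_nat (order G) else 0)
        = (\<Sum>i\<in>I. ch i g * ch i (inv h) * ch i (inv x))"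
      using delta[of "g \<otimes> inv h"] x ch_mult by simp
  qed
  also have "\<dots> = (\<Sum>i\<in>I. \<Sum>(g, h)\<in>D \<times> D. ch i g * ch i (inv h) * ch i (inv x))"
    by (subst sum.swap) (simp add: case_prod_unfold)
  also have "\<dots> = (\<Sum>i\<in>I. E i * E i * ch i (inv x))"
  proof (intro sum.cong refl)
    fix i
    have "(\<Sum>(g, h)\<in>D \<times> D. ch i g * ch i (inv h) * ch i (inv x))
        = (\<Sum>g\<in>D. ch i g) * (\<Sum>h\<in>D. ch i (inv h)) * ch i (inv x)"
      unfolding sum_product by (simp add: sum.cartesian_product[symmetric] sum_distrib_right)
    then show "(\<Sum>(g, h)\<in>D \<times> D. ch i g * ch i (inv h) * ch i (inv x)) = E i * E i * ch i (inv x)"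
      by (simp add: E_inv) (simp add: E_def)
  qed
  \<comment> \<open>Only the trivial character \<open>i0\<close>, with value \<open>card D\<close>,
    may violate the quadratic equation of the eigenvalues; the conditional term is its
    defect.\<close>
  also have "\<dots> = (\<Sum>i\<in>I. (\<theta>1 + \<theta>2) * (E i * ch i (inv x)) - \<theta>1 * \<theta>2 * ch i (inv x)
      + (if i = i0 then (of_nat (card D) - \<theta>1) * (of_nat (card D) - \<theta>2) else 0))"
  proof (intro sum.cong refl)
    fix i assume i: "i \<in> I"
    show "E i * E i * ch i (inv x) = (\<theta>1 + \<theta>2) * (E i * ch i (inv x)) - \<theta>1 * \<theta>2 * ch i (inv x)
      + (if i = i0 then (of_nat (card D) - \<theta>1) * (of_nat (card D) - \<theta>2) else 0)"
    proof (cases "i = i0")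
      case True
      have "E i0 = of_nat (card D)" using triv D by (simp add: E_def subset_iff)
      moreover have "ch i0 (inv x) = 1" using triv x by simp
      ultimately show ?thesis using True by (simp add: algebra_simps)
    next
      case False
      then have "E i = \<theta>1 \<or> E i = \<theta>2" using eigen[OF i] by (simp add: E_def)
      then show ?thesis using False by (auto simp: algebra_simps)
    qed
  qed
  also have "\<dots> = (\<theta>1 + \<theta>2) * (\<Sum>i\<in>I. E i * ch i (inv x)) - \<theta>1 * \<theta>2 * (\<Sum>i\<in>I. ch i (inv x))
      + (of_nat (card D) - \<theta>1) * (of_nat (card D) - \<theta>2)"
    using I by (simp add: sum.distrib sum_subtractf sum_distrib_left)
  also have "(\<Sum>i\<in>I. ch i (inv x)) = 0"
    using ortho[of "inv x"] x by (metis inv_closed inv_eq_1_iff)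
  \<comment> \<open>Fourier inversion: the part linear in \<open>E\<close> returns the indicator of
    \<open>D\<close> at \<open>x\<close>.\<close>
  also have "(\<Sum>i\<in>I. E i * ch i (inv x)) = (\<Sum>d\<in>D. \<Sum>i\<in>I. ch i (d \<otimes> inv x))"
    unfolding E_def sum_distrib_right using D x ch_mult
    by (subst sum.swap) (intro sum.cong refl, auto simp: subset_iff)
  also have "\<dots> = (\<Sum>d\<in>D. if d = x then of_nat (order G) else 0)"
    by (intro sum.cong refl delta) (use D in auto)
  also have "\<dots> = (if x \<in> D then of_nat (order G) else 0)"
    using finD by (simp add: sum.delta')
  finally show ?thesis by simp
qed

section \<open>Elementary abelian groups\<close>

lemma group_elementary_abelian_group: "group (elementary_abelian_group p n)"
  by (simp add: elementary_abelian_group_def)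

lemma carrier_elementary_abelian_group:
  "p > 0 \<Longrightarrow> carrier (elementary_abelian_group p n) = ({..<n} \<rightarrow>\<^sub>E {0..<int p})"
  by (simp add: elementary_abelian_group_def carrier_integer_mod_group)

lemma card_carrier_elementary_abelian_group:
  "p > 0 \<Longrightarrow> card (carrier (elementary_abelian_group p n)) = p ^ n"
  by (simp add: carrier_elementary_abelian_group card_PiE)

text \<open>A basis is chosen one vector at a time. While \<open>k < n\<close> the image of the
  first \<open>k\<close> coordinates is too small to be everything, so some \<open>g\<close> lies
  outside it, and the next coordinate becomes the exponent of \<open>g\<close>.\<close>

lemma (in comm_group) inj_hom_from_elementary_abelian_group:
  assumes fin: "finite (carrier G)" and p: "prime p" and ord: "order G = p ^ n"
    and exp: "\<And>x. x \<in> carrier G \<Longrightarrow> x [^] p = \<one>" and "k \<le> n"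
  shows "\<exists>f \<in> hom (elementary_abelian_group p k) G. inj_on f (carrier (elementary_abelian_group p k))"
  using \<open>k \<le> n\<close>
proof (induction k)
  case 0
  have "(\<lambda>_. \<one>) \<in> hom (elementary_abelian_group p 0) G"
    by (auto simp: hom_def)
  then show ?case
    using p by (intro bexI[of _ "\<lambda>_. \<one>"])
      (auto simp: elementary_abelian_group_def)
next
  case (Suc k)
  let ?E = "elementary_abelian_group p"
  have p0: "p > 0" and p1: "p > 1" using p prime_gt_0_nat prime_gt_1_nat by blast+
  obtain f where f: "f \<in> hom (?E k) G" and inj: "inj_on f (carrier (?E k))"
    using Suc by auto
  interpret f: group_hom "?E k" G f
    using f by (simp add: group_hom_def group_hom_axioms_def group_elementary_abelian_group is_group)
  have "card (f ` carrier (?E k)) < card (carrier G)"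
    using Suc.prems p1 ord
    by (simp add: card_image[OF inj] card_carrier_elementary_abelian_group p0 order_def)
  then have "\<not> carrier G \<subseteq> f ` carrier (?E k)"
    using card_mono[OF finite_imageI, of "carrier (?E k)" "carrier G" f]
    by (metis carrier_elementary_abelian_group[OF p0] finite_PiE finite_atLeastLessThan_int
        finite_lessThan leD)
  then obtain g where g: "g \<in> carrier G" "g \<notin> f ` carrier (?E k)" by (meson subsetI)
  define \<pi> where "\<pi> x = restrict x {..<k}" for x :: "nat \<Rightarrow> int"
  define h where "h x = f (\<pi> x) \<otimes> g [^] (x k)" for x :: "nat \<Rightarrow> int"
  have \<pi>: "\<pi> x \<in> carrier (?E k)" if "x \<in> carrier (?E (Suc k))" for x
    using that by (simp add: \<pi>_def carrier_elementary_abelian_group p0 PiE_iff)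
  have \<pi>_mult: "\<pi> (x \<otimes>\<^bsub>?E (Suc k)\<^esub> y) = \<pi> x \<otimes>\<^bsub>?E k\<^esub> \<pi> y" for x y
    by (auto simp: \<pi>_def elementary_abelian_group_def fun_eq_iff)
  have pow_mod: "g [^] (a mod int p) = g [^] a" for a :: int
  proof -
    have "g [^] (int p * (a div int p)) = \<one>"
      using exp[of g] g by (simp add: int_pow_pow[symmetric] int_pow_int)
    moreover have "g [^] a = g [^] (int p * (a div int p)) \<otimes> g [^] (a mod int p)"
      using g by (simp add: int_pow_mult[symmetric])
    ultimately show ?thesis using g by simp
  qed
  have hom: "h \<in> hom (?E (Suc k)) G"
  proof (rule homI)
    fix x y assume x: "x \<in> carrier (?E (Suc k))" and y: "y \<in> carrier (?E (Suc k))"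
    have "g [^] ((x \<otimes>\<^bsub>?E (Suc k)\<^esub> y) k) = g [^] (x k) \<otimes> g [^] (y k)"
      using g by (simp add: elementary_abelian_group_def pow_mod int_pow_mult)
    then show "h (x \<otimes>\<^bsub>?E (Suc k)\<^esub> y) = h x \<otimes> h y"
      using \<pi>[OF x] \<pi>[OF y] g by (simp add: h_def \<pi>_mult m_ac)
  qed (use \<pi> g in \<open>auto simp: h_def\<close>)
  interpret h: group_hom "?E (Suc k)" G h
    using hom by (simp add: group_hom_def group_hom_axioms_def group_elementary_abelian_group is_group)
  have one: "x = \<one>\<^bsub>?E (Suc k)\<^esub>" if x: "x \<in> carrier (?E (Suc k))" and hx: "h x = \<one>" for x
  proof -
    have xk: "0 \<le> x k" "x k < int p" using x by (auto simp: carrier_elementary_abelian_group p0 PiE_iff)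
    have sub: "subgroup (f ` carrier (?E k)) G" using f.img_is_subgroup by simp
    have "g [^] (x k) = inv f (\<pi> x)"
      using hx \<pi>[OF x] g by (simp add: h_def inv_unique' m_comm inv_equality)
    then have mem: "g [^] (x k) \<in> f ` carrier (?E k)"
      using sub \<pi>[OF x] by (simp add: subgroup.m_inv_closed)
    have "x k = 0"
    proof (rule ccontr)
      \<comment> \<open>The exponent is then invertible modulo \<open>p\<close>, so some power of
        \<open>g [^] (x k)\<close> is \<open>g\<close> itself, which was chosen outside the
        image.\<close>
      assume "x k \<noteq> 0"
      then have "coprime (x k) (int p)"
        using xk p by (metis coprime_commute prime_imp_coprime prime_nat_int_transfer zdvd_not_zless order_le_less)
      then obtain u where u: "[x k * u = 1] (mod int p)"
        by (metis cong_solve_coprime_int)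
      have "(g [^] (x k)) [^] u \<in> f ` carrier (?E k)"
        using subgroup_int_pow_closed[OF sub mem] .
      moreover have "(g [^] (x k)) [^] u = g"
        using g u p1 pow_mod[of "x k * u"] pow_mod[of 1]
        by (simp add: int_pow_pow cong_def)
      ultimately show False using g by simp
    qed
    then have "f (\<pi> x) = \<one>" using hx \<pi>[OF x] by (simp add: h_def)
    then have \<pi>_one: "\<pi> x = \<one>\<^bsub>?E k\<^esub>"
      using inj_onD[OF inj, of "\<pi> x" "\<one>\<^bsub>?E k\<^esub>"] \<pi>[OF x] by simp
    have "x i = 0" if "i < k" for i
      using that fun_cong[OF \<pi>_one, of i] by (simp add: \<pi>_def elementary_abelian_group_def)
    with \<open>x k = 0\<close> show ?thesis
      using x by (auto simp: elementary_abelian_group_def carrier_elementary_abelian_group p0 less_Suc_eq PiE_iff extensional_def)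
  qed
  then have "inj_on h (carrier (?E (Suc k)))"
    by (simp add: h.inj_on_one_iff)
  then show ?case using hom by blast
qed

lemma (in comm_group) iso_elementary_abelian_group:
  assumes fin: "finite (carrier G)" and p: "prime p" and ord: "order G = p ^ n"
    and exp: "\<And>x. x \<in> carrier G \<Longrightarrow> x [^] p = \<one>"
  shows "\<exists>f. f \<in> iso G (elementary_abelian_group p n)"
proof -
  let ?E = "elementary_abelian_group p n"
  obtain f where f: "f \<in> hom ?E G" and inj: "inj_on f (carrier ?E)"
    using inj_hom_from_elementary_abelian_group[OF assms order_refl] by blast
  have "f ` carrier ?E = carrier G"
  proof (rule card_subset_eq[OF fin])
    show "f ` carrier ?E \<subseteq> carrier G" using f by (auto simp: hom_def)
    show "card (f ` carrier ?E) = card (carrier G)"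
      using ord p by (simp add: card_image[OF inj] card_carrier_elementary_abelian_group prime_gt_0_nat order_def)
  qed
  then have "f \<in> iso ?E G" using f inj by (simp add: iso_def bij_betw_def)
  then show ?thesis
    using group.iso_set_sym[OF group_elementary_abelian_group] by blast
qed

section \<open>Frobenius maps in an algebraically closed field\<close>

lemma (in cring) binomial_expansion:
  assumes x: "x \<in> carrier R" and y: "y \<in> carrier R"
  shows "(x \<oplus> y) [^] (n::nat) = (\<Oplus>k\<in>{..n}. [(n choose k)] \<cdot> (x [^] k \<otimes> y [^] (n - k)))"
proof (induction n)
  case 0
  show ?case using x y by (simp add: finsum_Un_disjoint)
next
  case (Suc n)
  define t where "t k = x [^] k \<otimes> y [^] (Suc n - k)" for k
  let ?S = "\<Oplus>k\<in>{..n}. [(n choose k)] \<cdot> (x [^] k \<otimes> y [^] (n - k))"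
  have t: "t k \<in> carrier R" for k using x y by (simp add: t_def)
  \<comment> \<open>Pascal's rule. The guard at \<open>k = 0\<close> matters: truncated subtraction
    would turn \<open>n choose (k - 1)\<close> into 1 there.\<close>
  have "(\<Oplus>k\<in>{..Suc n}. [(Suc n choose k)] \<cdot> t k)
      = (\<Oplus>k\<in>{..Suc n}. [(n choose k)] \<cdot> t k \<oplus> [(if k = 0 then 0 else n choose (k - 1))] \<cdot> t k)"
  proof (rule finsum_cong')
    fix k
    have "Suc n choose k = (n choose k) + (if k = 0 then 0 else n choose (k - 1))"
      by (cases k) simp_all
    then show "[(Suc n choose k)] \<cdot> t k = [(n choose k)] \<cdot> t k \<oplus> [(if k = 0 then 0 else n choose (k - 1))] \<cdot> t k"
      using t by (simp only: add.nat_pow_mult)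
  qed (use t in auto)
  also have "\<dots> = (\<Oplus>k\<in>{..Suc n}. [(n choose k)] \<cdot> t k)
      \<oplus> (\<Oplus>k\<in>{..Suc n}. [(if k = 0 then 0 else n choose (k - 1))] \<cdot> t k)"
    using t by (intro finsum_addf) auto
  also have "(\<Oplus>k\<in>{..Suc n}. [(n choose k)] \<cdot> t k) = (\<Oplus>k\<in>{..n}. [(n choose k)] \<cdot> t k)"
    using t by (subst finsum_Suc) (auto simp: binomial_eq_0)
  also have "\<dots> = (\<Oplus>k\<in>{..n}. [(n choose k)] \<cdot> (x [^] k \<otimes> y [^] (n - k)) \<otimes> y)"
  proof (rule finsum_cong')
    fix k assume k: "k \<in> {..n}"
    then have "t k = x [^] k \<otimes> y [^] (n - k) \<otimes> y"
      using x y by (simp add: t_def Suc_diff_le m_assoc)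
    then show "[(n choose k)] \<cdot> t k = [(n choose k)] \<cdot> (x [^] k \<otimes> y [^] (n - k)) \<otimes> y"
      using x y by (simp add: add_pow_ldistr)
  qed (use x y in auto)
  also have "\<dots> = ?S \<otimes> y"
    using x y by (subst finsum_ldistr) auto
  also have "(\<Oplus>k\<in>{..Suc n}. [(if k = 0 then 0 else n choose (k - 1))] \<cdot> t k)
      = (\<Oplus>k\<in>{..n}. [(n choose k)] \<cdot> t (Suc k))"
    using t by (subst finsum_Suc2) auto
  also have "\<dots> = (\<Oplus>k\<in>{..n}. [(n choose k)] \<cdot> (x [^] k \<otimes> y [^] (n - k)) \<otimes> x)"
  proof (rule finsum_cong')
    fix k
    have "t (Suc k) = x [^] k \<otimes> y [^] (n - k) \<otimes> x"
      using x y by (simp add: t_def m_ac)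
    then show "[(n choose k)] \<cdot> t (Suc k) = [(n choose k)] \<cdot> (x [^] k \<otimes> y [^] (n - k)) \<otimes> x"
      using x y by (simp add: add_pow_ldistr)
  qed (use x y in auto)
  also have "\<dots> = ?S \<otimes> x"
    using x y by (subst finsum_ldistr) auto
  finally show ?case
    using Suc x y by (simp add: r_distr a_comm t_def)
qed

lemma (in cring) add_pow_eq_zero:
  assumes "[p] \<cdot> \<one> = \<zero>" and "p dvd (n::nat)" and x: "x \<in> carrier R"
  shows "[n] \<cdot> x = \<zero>"
proof -
  obtain k where n: "n = p * k" using assms(2) by (rule dvdE)
  have "[p] \<cdot> x = \<zero>"
    using add_pow_ldistr[of \<one> x p] assms by simp
  then show ?thesis
    using add.nat_pow_pow[OF x, of k p] by (simp add: n)
qed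

lemma (in cring) frobenius_add:
  fixes p :: nat
  assumes p: "prime p" and char: "[p] \<cdot> \<one> = \<zero>"
    and x: "x \<in> carrier R" and y: "y \<in> carrier R"
  shows "(x \<oplus> y) [^] (p ^ e) = x [^] (p ^ e) \<oplus> y [^] (p ^ e)"
proof (induction e)
  case 0
  show ?case using x y by simp
next
  case (Suc e)
  have step: "(a \<oplus> b) [^] p = a [^] p \<oplus> b [^] p" if a: "a \<in> carrier R" and b: "b \<in> carrier R" for a b
  proof -
    let ?f = "\<lambda>k. [(p choose k)] \<cdot> (a [^] k \<otimes> b [^] (p - k))"
    have "p > 0" using p by (rule prime_gt_0_nat)
    then have set: "{..p} = insert 0 (insert p {1..<p})" by auto
    have "(a \<oplus> b) [^] p = finsum R ?f (insert 0 (insert p {1..<p}))"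
      unfolding set[symmetric] using a b by (rule binomial_expansion)
    also have "\<dots> = ?f 0 \<oplus> (?f p \<oplus> finsum R ?f {1..<p})"
      using a b \<open>p > 0\<close> by (subst finsum_insert; (subst finsum_insert)?) auto
    also have "finsum R ?f {1..<p} = finsum R (\<lambda>_. \<zero>) {1..<p}"
      using p a b by (intro finsum_cong' add_pow_eq_zero[OF char]) (auto intro!: dvd_choose_prime)
    also have "\<dots> = \<zero>" by simp
    finally show ?thesis using a b by (simp add: a_comm)
  qed
  have "(x \<oplus> y) [^] (p ^ Suc e) = ((x \<oplus> y) [^] (p ^ e)) [^] p"
    using x y by (simp add: nat_pow_pow mult.commute)
  also have "\<dots> = (x [^] (p ^ e)) [^] p \<oplus> (y [^] (p ^ e)) [^] p"
    using x y by (simp add: Suc.IH step)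
  finally show ?case
    using x y by (simp add: nat_pow_pow mult.commute)
qed

lemma (in abelian_group) add_minus_add_cancel:
  assumes "a \<in> carrier G" "b \<in> carrier G" "c \<in> carrier G"
  shows "(a \<oplus> c) \<ominus> (b \<oplus> c) = a \<ominus> b"
proof -
  have "(a \<oplus> c) \<ominus> (b \<oplus> c) = (a \<ominus> b) \<oplus> (c \<oplus> \<ominus> c)"
    using assms by (simp add: a_minus_def minus_add a_ac)
  then show ?thesis using assms by (simp add: r_neg)
qed

lemma (in abelian_group) minus_add_minus_cancel:
  assumes "a \<in> carrier G" "b \<in> carrier G" "c \<in> carrier G"
  shows "(a \<ominus> b) \<oplus> (c \<ominus> a) = c \<ominus> b"
proof -
  have "(a \<ominus> b) \<oplus> (c \<ominus> a) = (c \<ominus> b) \<oplus> (a \<oplus> \<ominus> a)"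
    using assms by (simp add: a_minus_def a_ac)
  then show ?thesis using assms by (simp add: r_neg)
qed

text \<open>One ambient field contains all finite fields of the construction as fixed points of
  Frobenius powers, so no extensions or embeddings have to be chosen. In the application
  \<open>e = s * m\<close>, hence \<open>Q = q ^ m\<close>.\<close>

locale frobenius_field = algebraically_closed R for R (structure) +
  fixes p e :: nat
  assumes prime_p: "prime p" and e_pos: "e > 0" and char_p: "[p] \<cdot> \<one> = \<zero>"
begin

definition Q :: nat where "Q = p ^ e"

text \<open>The subfield with \<open>Q ^ d\<close> elements when \<open>d > 0\<close>. For
  \<open>d = 0\<close> the condition is void and \<open>Fix 0\<close> is the whole carrier, which
  explains the hypotheses \<open>d > 0\<close> below.\<close>

definition Fix :: "nat \<Rightarrow> 'a set" where "Fix d = {x \<in> carrier R. x [^] (Q ^ d) = x}"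

definition F :: "'a set" where "F = {x \<in> carrier R. x [^] Q = x}"

lemma Q_gt_1: "Q > 1"
  unfolding Q_def using prime_gt_1_nat[OF prime_p] e_pos by (rule one_less_power)

lemma Q_pos: "Q > 0"
  using Q_gt_1 by simp

lemma two_le_pow_Q: "d > 0 \<Longrightarrow> 2 \<le> Q ^ d"
  using one_less_power[OF Q_gt_1, of d] by simp

lemma F_eq_Fix: "F = Fix 1"
  by (simp add: F_def Fix_def)

lemma pow_Q_add:
  assumes "x \<in> carrier R" "y \<in> carrier R"
  shows "(x \<oplus> y) [^] (Q ^ d) = x [^] (Q ^ d) \<oplus> y [^] (Q ^ d)"
  unfolding Q_def power_mult[symmetric] by (rule frobenius_add[OF prime_p char_p assms])

lemma zero_pow_Q: "\<zero> [^] (Q ^ d) = \<zero>"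
  using Q_pos by (simp add: nat_pow_zero)

lemma pow_Q_minus:
  assumes "x \<in> carrier R"
  shows "(\<ominus> x) [^] (Q ^ d) = \<ominus> (x [^] (Q ^ d))"
  using pow_Q_add[of "\<ominus> x" x d] assms zero_pow_Q by (simp add: minus_equality l_neg)

lemma pow_Q_diff:
  assumes "x \<in> carrier R" "y \<in> carrier R"
  shows "(x \<ominus> y) [^] (Q ^ d) = x [^] (Q ^ d) \<ominus> y [^] (Q ^ d)"
  using assms by (simp add: a_minus_def pow_Q_add pow_Q_minus)

lemma pow_eq_zero_iff':
  assumes "x \<in> carrier R"
  shows "x [^] (n::nat) = \<zero> \<longleftrightarrow> x = \<zero> \<and> n > 0"
  using assms by (induction n) (auto simp: integral_iff)

lemma pow_Q_inj:
  assumes "x \<in> carrier R" "y \<in> carrier R" "x [^] (Q ^ d) = y [^] (Q ^ d)"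
  shows "x = y"
proof -
  have "(x \<ominus> y) [^] (Q ^ d) = \<zero>" using assms by (simp add: pow_Q_diff)
  then show ?thesis using assms by (simp add: pow_eq_zero_iff')
qed

lemma Fix_carrier: "x \<in> Fix d \<Longrightarrow> x \<in> carrier R"
  by (simp add: Fix_def)

lemma Fix_zero: "\<zero> \<in> Fix d" by (simp add: Fix_def zero_pow_Q)
lemma Fix_one: "\<one> \<in> Fix d" by (simp add: Fix_def)
lemma Fix_add: "x \<in> Fix d \<Longrightarrow> y \<in> Fix d \<Longrightarrow> x \<oplus> y \<in> Fix d" by (simp add: Fix_def pow_Q_add)
lemma Fix_minus: "x \<in> Fix d \<Longrightarrow> \<ominus> x \<in> Fix d" by (simp add: Fix_def pow_Q_minus)
lemma Fix_mult: "x \<in> Fix d \<Longrightarrow> y \<in> Fix d \<Longrightarrow> x \<otimes> y \<in> Fix d" by (simp add: Fix_def nat_pow_distrib)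
lemma Fix_inv:
  assumes "x \<in> Fix d" "x \<noteq> \<zero>"
  shows "inv x \<in> Fix d"
proof -
  have u: "x \<in> Units R" using assms by (simp add: Fix_def field_Units)
  have "(inv x) [^] (Q ^ d) \<otimes> x [^] (Q ^ d) = \<one>"
    using u nat_pow_distrib[of "inv x" x "Q ^ d"] by (simp add: Units_closed)
  then have "x \<otimes> (inv x) [^] (Q ^ d) = \<one>"
    using assms u by (simp add: Fix_def m_comm)
  then have "(inv x) [^] (Q ^ d) = inv x"
    using u comm_inv_char[of x "(inv x) [^] (Q ^ d)"] by (simp add: Units_closed)
  then show ?thesis using u by (simp add: Fix_def)
qed

lemmas Fix_closed = Fix_carrier Fix_zero Fix_one Fix_add Fix_minus Fix_mult Fix_inv
lemmas F_closed = Fix_closed[where d = 1, folded F_eq_Fix]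

text \<open>The list \<open>monom \<one> k @ cs\<close> is a monic polynomial with lower part
  \<open>cs\<close>; \<open>cs \<noteq> []\<close> makes its degree positive even for
  \<open>k = 0\<close>. This form suits sparse polynomials of large symbolic degree.\<close>

lemma exists_root_of_monic:
  assumes cs: "set cs \<subseteq> carrier R" "cs \<noteq> []"
  shows "\<exists>x\<in>carrier R. x [^] (k + length cs) \<oplus> eval cs x = \<zero>"
proof -
  let ?f = "monom \<one> k @ cs"
  have f: "?f \<in> carrier (poly_ring R)"
    using cs by (auto simp: univ_poly_carrier[symmetric] polynomial_def monom_def)
  have "degree ?f > 0" using cs by (simp add: monom_def)
  then have "size (roots ?f) > 0"
    using roots_over_carrier[OF f] by (simp add: splitted_def)
  then obtain x where "x \<in># roots ?f" by (metis multiset_nonemptyE size_empty less_irrefl)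
  then have x: "x \<in> carrier R" "eval ?f x = \<zero>"
    using roots_mem_iff_is_root[OF f] by (auto simp: is_root_def)
  then have "eval (monom \<one> k) x \<otimes> x [^] length cs \<oplus> eval cs x = \<zero>"
    using eval_append[OF monom_in_carrier[of \<one> k] cs(1) x(1)] by simp
  then show ?thesis using x by (auto simp: eval_monom nat_pow_mult)
qed

lemma exists_nth_root:
  assumes "z \<in> carrier R" "n > 0"
  shows "\<exists>x\<in>carrier R. x [^] (n::nat) = z"
proof -
  obtain x where x: "x \<in> carrier R" "x [^] n \<oplus> \<ominus> z = \<zero>"
    using exists_root_of_monic[of "[\<ominus> z]" "n - 1"] assms by auto
  then show ?thesis using assms by (intro bexI[of _ x]) (auto simp: a_minus_def[symmetric])
qed

text \<open>Such a root lies just outside \<open>Fix d\<close>; the differences along its Frobenius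
  orbit will supply an element of trace one.\<close>

lemma exists_artin_schreier_root:
  assumes "d > 0"
  shows "\<exists>x\<in>carrier R. x [^] (Q ^ d) = x \<oplus> \<one>"
proof -
  have "Q ^ d \<ge> 2" using assms by (rule two_le_pow_Q)
  then have len: "Q ^ d - 2 + length [\<ominus> \<one>, \<ominus> \<one>] = Q ^ d" by simp
  have "\<exists>x\<in>carrier R. x [^] (Q ^ d - 2 + length [\<ominus> \<one>, \<ominus> \<one>]) \<oplus> eval [\<ominus> \<one>, \<ominus> \<one>] x = \<zero>"
    by (rule exists_root_of_monic) auto
  then obtain x where x: "x \<in> carrier R" "x [^] (Q ^ d) \<oplus> eval [\<ominus> \<one>, \<ominus> \<one>] x = \<zero>"
    unfolding len by blast
  have "x [^] (Q ^ d) \<ominus> (x \<oplus> \<one>) = \<zero>"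
    using x by (simp add: a_minus_def minus_add l_minus)
  then show ?thesis using x by (intro bexI[of _ x]) auto
qed

text \<open>\<open>Fix d\<close> is the root set of \<open>f = X^N - X\<close>, which has
  \<open>N\<close> roots with multiplicity. The roots are simple without any derivative: in terms of
  \<open>Y = X - a\<close>, Frobenius additivity gives \<open>f = Y^N - Y = Y (Y^(N-1) - 1)\<close>,
  and the cofactor takes the value \<open>\<ominus> \<one>\<close> at \<open>a\<close>.\<close>

lemma card_Fix:
  assumes "d > 0"
  shows "card (Fix d) = Q ^ d" and "finite (Fix d)"
proof -
  define N where "N = Q ^ d"
  have N: "N \<ge> 2" unfolding N_def using assms by (rule two_le_pow_Q)
  let ?P = "poly_ring R"
  interpret UP: "domain" ?P by (rule univ_poly_is_domain[OF carrier_is_subring])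
  interpret C: ring_hom_ring R ?P poly_of_const
    by (rule canonical_embedding_ring_hom[OF carrier_is_subring, simplified])
  have char_UP: "[p] \<cdot>\<^bsub>?P\<^esub> \<one>\<^bsub>?P\<^esub> = \<zero>\<^bsub>?P\<^esub>"
  proof -
    have "[n] \<cdot>\<^bsub>?P\<^esub> \<one>\<^bsub>?P\<^esub> = poly_of_const ([n] \<cdot> \<one>)" for n :: nat
      by (induction n) simp_all
    then show ?thesis using char_p by simp
  qed
  have X: "X \<in> carrier ?P" by (rule var_closed[OF carrier_is_subring])
  define f where "f = X [^]\<^bsub>?P\<^esub> N \<ominus>\<^bsub>?P\<^esub> X"
  have f: "f \<in> carrier ?P" using X by (simp add: f_def)
  have eval_f: "eval f a = a [^] N \<ominus> a" if a: "a \<in> carrier R" for a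
  proof -
    interpret ev: ring_hom_ring ?P R "\<lambda>f. eval f a"
      using eval_cring_hom[OF carrier_is_subring a] by (simp add: ring_hom_cring_def ring_hom_ring_def ring_hom_cring.axioms cring_def ring_hom_ring_axioms_def ring_hom_cring_axioms_def)
    show ?thesis using a X by (simp add: f_def a_minus_def eval_var ev.hom_nat_pow)
  qed
  have deg: "degree f = N"
  proof -
    have "X [^]\<^bsub>?P\<^esub> N = monom \<one> N" by (simp add: unitary_monom_eq_var_pow[OF carrier_is_subring])
    moreover have "degree (monom \<one> N) = N" by (simp add: monom_def)
    moreover have "degree (\<ominus>\<^bsub>?P\<^esub> X) = 1"
      using univ_poly_a_inv_degree[OF carrier_is_subring X] by (simp add: var_def)
    ultimately show ?thesis
      unfolding f_def a_minus_def univ_poly_add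
      using poly_add_degree_eq[OF carrier_is_subring, of "X [^]\<^bsub>?P\<^esub> N" "\<ominus>\<^bsub>?P\<^esub> X"] X N
        UP.nat_pow_closed[OF X, of N]
      by (simp add: univ_poly_carrier del: poly_add.simps)
  qed
  then have f_nz: "f \<noteq> []" using N by auto
  have count: "count (roots f) a = 1" if "a \<in># roots f" for a
  proof -
    have a: "a \<in> carrier R" and aN: "a [^] N = a"
      using that roots_mem_iff_is_root[OF f] eval_f by (auto simp: is_root_def)
    define Y where "Y = [\<one>, \<ominus> a]"
    have Y: "Y \<in> carrier ?P"
      using a by (auto simp: Y_def univ_poly_carrier[symmetric] polynomial_def)
    have XY: "X = Y \<oplus>\<^bsub>?P\<^esub> poly_of_const a"
      unfolding Y_def univ_poly_add var_def poly_of_const_def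
      using a by (subst poly_add.simps) (simp add: l_neg del: poly_add.simps)
    have C: "poly_of_const a \<in> carrier ?P" using a by simp
    have "X [^]\<^bsub>?P\<^esub> N = Y [^]\<^bsub>?P\<^esub> N \<oplus>\<^bsub>?P\<^esub> poly_of_const a [^]\<^bsub>?P\<^esub> N"
      unfolding XY N_def Q_def power_mult[symmetric]
      by (rule UP.frobenius_add[OF prime_p char_UP Y C])
    also have "poly_of_const a [^]\<^bsub>?P\<^esub> N = poly_of_const a"
      using a aN by (simp add: C.hom_nat_pow[symmetric])
    finally have "f = Y [^]\<^bsub>?P\<^esub> N \<oplus>\<^bsub>?P\<^esub> poly_of_const a \<ominus>\<^bsub>?P\<^esub> (Y \<oplus>\<^bsub>?P\<^esub> poly_of_const a)"
      unfolding f_def XY[symmetric] by simp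
    also have "\<dots> = Y [^]\<^bsub>?P\<^esub> N \<ominus>\<^bsub>?P\<^esub> Y"
      using Y C by (intro UP.add_minus_add_cancel) auto
    also have "Y [^]\<^bsub>?P\<^esub> N = Y \<otimes>\<^bsub>?P\<^esub> Y [^]\<^bsub>?P\<^esub> (N - 1)"
      using N Y UP.nat_pow_Suc2[of Y "N - 1"] by simp
    also have "\<dots> \<ominus>\<^bsub>?P\<^esub> Y = Y \<otimes>\<^bsub>?P\<^esub> (Y [^]\<^bsub>?P\<^esub> (N - 1) \<ominus>\<^bsub>?P\<^esub> \<one>\<^bsub>?P\<^esub>)"
      using Y by (simp add: a_minus_def UP.r_distr UP.r_minus)
    finally have fY: "f = Y \<otimes>\<^bsub>?P\<^esub> (Y [^]\<^bsub>?P\<^esub> (N - 1) \<ominus>\<^bsub>?P\<^esub> \<one>\<^bsub>?P\<^esub>)" (is "_ = _ \<otimes>\<^bsub>?P\<^esub> ?g") .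
    have g: "?g \<in> carrier ?P" using Y by simp
    interpret ev: ring_hom_ring ?P R "\<lambda>f. eval f a"
      using eval_cring_hom[OF carrier_is_subring a] by (simp add: ring_hom_cring_def ring_hom_ring_def ring_hom_cring.axioms cring_def ring_hom_ring_axioms_def ring_hom_cring_axioms_def)
    have "eval ?g a = (eval Y a) [^] (N - 1) \<ominus> \<one>"
      using Y by (simp add: a_minus_def ev.hom_nat_pow)
    also have "eval Y a = \<zero>" using a by (simp add: Y_def r_neg)
    finally have "eval ?g a = \<ominus> \<one>" using N by (simp add: a_minus_def nat_pow_zero)
    then have eval_g: "eval ?g a \<noteq> \<zero>" using zero_not_one by (metis add.inv_eq_1_iff one_closed)
    then have "?g \<noteq> []" by auto
    then have "roots f = add_mset a (roots ?g)"
      unfolding fY Y_def[symmetric]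
      using poly_mult_degree_one_monic_imp_same_roots[OF a g] by (simp add: Y_def)
    moreover have "a \<notin># roots ?g"
      using roots_mem_iff_is_root[OF g] eval_g by (simp add: is_root_def)
    ultimately show ?thesis by (simp add: not_in_iff)
  qed
  have set: "set_mset (roots f) = Fix d"
    using roots_mem_iff_is_root[OF f] eval_f f_nz by (auto simp: is_root_def Fix_def N_def)
  show "finite (Fix d)" unfolding set[symmetric] by simp
  have "N = size (roots f)" using roots_over_carrier[OF f] deg by (simp add: splitted_def)
  also have "\<dots> = (\<Sum>a\<in>set_mset (roots f). 1)"
    unfolding size_multiset_overloaded_eq using count by (intro sum.cong) auto
  finally show "card (Fix d) = Q ^ d" by (simp add: set N_def)
qed

lemma card_F: "card F = Q" and finite_F: "finite F"
  using card_Fix[of 1] by (simp_all add: F_eq_Fix)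

subsection \<open>Trace and norm\<close>

text \<open>The sum of the first \<open>d\<close> Frobenius iterates of \<open>x\<close>. It is the
  trace from \<open>Fix d\<close> to \<open>F\<close> only for \<open>x\<close> in
  \<open>Fix d\<close>, but telescoping and orbit sums use it for every argument.\<close>

primrec Tr :: "nat \<Rightarrow> 'a \<Rightarrow> 'a" where
  "Tr 0 x = \<zero>"
| "Tr (Suc d) x = Tr d x \<oplus> x [^] (Q ^ d)"

text \<open>This is \<open>(Q ^ d - 1) / (Q - 1)\<close>, at once the exponent of the norm map and
  the size of its fibres over nonzero elements.\<close>

definition geo :: "nat \<Rightarrow> nat" where "geo d = (\<Sum>i<d. Q ^ i)"

definition Nm :: "nat \<Rightarrow> 'a \<Rightarrow> 'a" where "Nm d x = x [^] geo d"

lemma Tr_closed: "x \<in> carrier R \<Longrightarrow> Tr d x \<in> carrier R"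
  by (induction d) simp_all

lemma Tr_add: "x \<in> carrier R \<Longrightarrow> y \<in> carrier R \<Longrightarrow> Tr d (x \<oplus> y) = Tr d x \<oplus> Tr d y"
  by (induction d) (simp_all add: pow_Q_add Tr_closed a_ac)

lemma Tr_Suc_shift: "x \<in> carrier R \<Longrightarrow> Tr (Suc d) x = x \<oplus> Tr d x [^] Q"
proof (induction d)
  case 0
  then show ?case using zero_pow_Q[of 1] by simp
next
  case (Suc d)
  have "Tr (Suc (Suc d)) x = x \<oplus> (Tr d x [^] Q \<oplus> x [^] (Q ^ Suc d))"
    using Suc Tr_closed[of x d] by (simp add: a_assoc)
  also have "x [^] (Q ^ Suc d) = (x [^] (Q ^ d)) [^] Q"
    using Suc.prems by (simp add: nat_pow_pow mult.commute)
  also have "Tr d x [^] Q \<oplus> (x [^] (Q ^ d)) [^] Q = (Tr d x \<oplus> x [^] (Q ^ d)) [^] Q"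
    using pow_Q_add[of "Tr d x" "x [^] (Q ^ d)" 1] Suc.prems Tr_closed by simp
  finally show ?case by simp
qed

text \<open>Splitting \<open>Tr (Suc d) x\<close> at either end gives
  \<open>Tr d x \<oplus> x [^] (Q ^ d) = x \<oplus> Tr d x [^] Q\<close>, and for \<open>x\<close>
  in \<open>Fix d\<close> the outer terms cancel.\<close>

lemma Tr_in_F:
  assumes "x \<in> Fix d"
  shows "Tr d x \<in> F"
proof -
  have x: "x \<in> carrier R" "x [^] (Q ^ d) = x" using assms by (auto simp: Fix_def)
  have "x \<oplus> Tr d x = x \<oplus> Tr d x [^] Q"
    using Tr_Suc_shift[OF x(1), of d] x Tr_closed[OF x(1)] by (simp add: a_comm)
  then show ?thesis using x Tr_closed by (simp add: F_def)
qed

lemma F_pow_Q: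
  assumes "c \<in> F"
  shows "c [^] (Q ^ d) = c"
proof (induction d)
  case (Suc d)
  have "c [^] (Q ^ Suc d) = (c [^] (Q ^ d)) [^] Q"
    using assms by (simp add: F_def nat_pow_pow mult.commute)
  then show ?case using Suc assms by (simp add: F_def)
qed (use assms in \<open>simp add: F_def\<close>)

lemma F_subset_Fix: "F \<subseteq> Fix d"
  using F_pow_Q by (auto simp: Fix_def F_def)

lemma Tr_smult: "c \<in> F \<Longrightarrow> x \<in> carrier R \<Longrightarrow> Tr d (c \<otimes> x) = c \<otimes> Tr d x"
  by (induction d) (simp_all add: nat_pow_distrib F_pow_Q F_closed(1) Tr_closed r_distr)

text \<open>If \<open>x [^] (Q ^ d) = x \<oplus> \<one>\<close> and
  \<open>y = x [^] Q \<ominus> x\<close>, then \<open>Tr n y\<close> telescopes to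
  \<open>x [^] (Q ^ n) \<ominus> x\<close>, which is \<open>\<one>\<close> at \<open>n = d\<close>.
  The shift by \<open>\<one>\<close> disappears in the difference, so \<open>y\<close> lies in
  \<open>Fix d\<close>.\<close>

lemma Tr_eq_one:
  assumes "d > 0"
  shows "\<exists>y\<in>Fix d. Tr d y = \<one>"
proof -
  obtain x where x: "x \<in> carrier R" "x [^] (Q ^ d) = x \<oplus> \<one>"
    using exists_artin_schreier_root[OF assms] by auto
  define y where "y = x [^] Q \<ominus> x"
  have y: "y \<in> carrier R" using x by (simp add: y_def)
  have "Tr n y = x [^] (Q ^ n) \<ominus> x" for n
  proof (induction n)
    case 0
    then show ?case using x by (simp add: a_minus_def r_neg)
  next
    case (Suc n)
    have "y [^] (Q ^ n) = x [^] (Q ^ Suc n) \<ominus> x [^] (Q ^ n)"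
      using x by (simp add: y_def pow_Q_diff nat_pow_pow)
    then have "Tr (Suc n) y = (x [^] (Q ^ n) \<ominus> x) \<oplus> (x [^] (Q ^ Suc n) \<ominus> x [^] (Q ^ n))"
      using Suc by simp
    also have "\<dots> = x [^] (Q ^ Suc n) \<ominus> x"
      using x by (intro minus_add_minus_cancel) auto
    finally show ?case .
  qed
  then have "Tr d y = \<one>" using x by (simp add: a_minus_def a_comm[of x] a_assoc r_neg)
  moreover have "y [^] (Q ^ d) = y"
  proof -
    have "y [^] (Q ^ d) = (x [^] Q) [^] (Q ^ d) \<ominus> x [^] (Q ^ d)"
      using x by (simp add: y_def pow_Q_diff)
    also have "(x [^] Q) [^] (Q ^ d) = (x [^] (Q ^ d)) [^] Q"
      using x(1) by (simp add: nat_pow_pow mult.commute)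
    also have "\<dots> \<ominus> x [^] (Q ^ d) = (x \<oplus> \<one>) [^] Q \<ominus> (x \<oplus> \<one>)" using x by simp
    also have "\<dots> = x [^] Q \<oplus> \<one> \<ominus> (x \<oplus> \<one>)"
      using x pow_Q_add[of x \<one> 1] by simp
    also have "\<dots> = y" unfolding y_def using x by (intro add_minus_add_cancel) auto
    finally show ?thesis .
  qed
  ultimately show ?thesis using y by (auto simp: Fix_def)
qed

lemma geo_Suc: "geo (Suc d) = Suc (Q * geo d)" and geo_Suc': "geo (Suc d) = geo d + Q ^ d"
proof -
  show "geo (Suc d) = Suc (Q * geo d)"
    unfolding geo_def sum.lessThan_Suc_shift by (simp add: sum_distrib_left)
  show "geo (Suc d) = geo d + Q ^ d"
    by (simp add: geo_def)
qed

lemma geo_eq: "geo d * (Q - 1) + 1 = Q ^ d"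
proof (induction d)
  case (Suc d)
  have "geo (Suc d) * (Q - 1) + 1 = (geo d * (Q - 1) + 1) + Q ^ d * (Q - 1)"
    by (simp add: geo_Suc' algebra_simps)
  also have "\<dots> = Q ^ d * Suc (Q - 1)" by (simp only: Suc.IH) simp
  finally show ?case using Q_pos by simp
qed (simp add: geo_def)

lemma geo_pos: "d > 0 \<Longrightarrow> geo d > 0"
  by (cases d) (simp_all add: geo_Suc)

lemma Nm_closed: "x \<in> carrier R \<Longrightarrow> Nm d x \<in> carrier R"
  by (simp add: Nm_def)

lemma Nm_mult: "x \<in> carrier R \<Longrightarrow> y \<in> carrier R \<Longrightarrow> Nm d (x \<otimes> y) = Nm d x \<otimes> Nm d y"
  by (simp add: Nm_def nat_pow_distrib)

lemma Nm_eq_zero_iff: "x \<in> carrier R \<Longrightarrow> d > 0 \<Longrightarrow> Nm d x = \<zero> \<longleftrightarrow> x = \<zero>"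
  by (simp add: Nm_def pow_eq_zero_iff' geo_pos)

lemma Nm_in_F:
  assumes "x \<in> Fix d"
  shows "Nm d x \<in> F"
proof (cases "x = \<zero>")
  case True
  then show ?thesis
    using Nm_eq_zero_iff[of \<zero> d] F_closed(2,3) by (cases "d = 0") (simp_all add: Nm_def geo_def)
next
  case False
  have x: "x \<in> carrier R" "x [^] (Q ^ d) = x" using assms by (auto simp: Fix_def)
  have "x [^] (geo d * Q) \<otimes> x = x [^] geo (Suc d)"
    using x by (simp add: geo_Suc mult.commute)
  also have "\<dots> = x [^] geo d \<otimes> x"
    using x by (simp add: geo_Suc' nat_pow_mult[symmetric])
  finally have "x [^] (geo d * Q) = x [^] geo d"
    using x False by (simp add: m_rcancel)
  then show ?thesis using x by (simp add: F_def Nm_def nat_pow_pow)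
qed

text \<open>Any root of order \<open>geo d\<close> of \<open>z\<close> in the closed field works:
  \<open>z [^] (Q - 1) = \<one>\<close> and \<open>geo d * (Q - 1) = Q ^ d - 1\<close> force it into
  \<open>Fix d\<close>.\<close>

lemma Nm_surj:
  assumes "z \<in> F" "z \<noteq> \<zero>" "d > 0"
  shows "\<exists>x\<in>Fix d. x \<noteq> \<zero> \<and> Nm d x = z"
proof -
  obtain x where x: "x \<in> carrier R" "x [^] geo d = z"
    using exists_nth_root[of z "geo d"] assms geo_pos F_closed(1) by auto
  have z: "z [^] (Q - 1) = \<one>"
  proof -
    have "z [^] (Q - 1) \<otimes> z = \<one> \<otimes> z"
      using assms(1) Q_pos nat_pow_Suc[of z "Q - 1"] by (simp add: F_def)
    then show ?thesis using assms F_closed(1)[OF assms(1)] m_rcancel[of z "z [^] (Q - 1)" \<one>] by simp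
  qed
  have "x [^] (Q ^ d) = x [^] (geo d * (Q - 1)) \<otimes> x"
    unfolding geo_eq[of d, symmetric] using x by simp
  also have "x [^] (geo d * (Q - 1)) = \<one>" using x z by (simp add: nat_pow_pow[symmetric])
  finally have "x \<in> Fix d" using x by (simp add: Fix_def)
  moreover have "x \<noteq> \<zero>" using x assms geo_pos nat_pow_zero by auto
  ultimately show ?thesis using x by (auto simp: Nm_def)
qed

text \<open>Multiplication by a preimage of \<open>w\<close> carries the fibre over
  \<open>\<one>\<close> to the fibre over \<open>w\<close>. So the \<open>Q - 1\<close> fibres are
  equally large, and together they exhaust \<open>geo d * (Q - 1)\<close> elements.\<close>

lemma card_norm_fibre:
  assumes z: "z \<in> F" "z \<noteq> \<zero>" and d: "d > 0"
  shows "card {x \<in> Fix d - {\<zero>}. Nm d x = z} = geo d"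
proof -
  let ?fib = "\<lambda>z. {x \<in> Fix d - {\<zero>}. Nm d x = z}"
  have eq: "card (?fib w) = card (?fib \<one>)" if w: "w \<in> F" "w \<noteq> \<zero>" for w
  proof -
    obtain u where u: "u \<in> Fix d" "u \<noteq> \<zero>" "Nm d u = w" using Nm_surj[OF w d] by blast
    have uc: "u \<in> carrier R" "u \<in> Units R" using u Fix_carrier by (auto simp: field_Units)
    have "bij_betw (\<lambda>x. u \<otimes> x) (?fib \<one>) (?fib w)"
    proof (rule bij_betw_byWitness[where f' = "\<lambda>x. inv u \<otimes> x"])
      have Nm_inv: "Nm d (inv u) \<otimes> w = \<one>"
        using uc u Nm_mult[of "inv u" u d] by (simp add: Nm_def)
      show "(\<lambda>x. u \<otimes> x) ` ?fib \<one> \<subseteq> ?fib w"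
        using u uc Fix_carrier by (auto simp: Fix_mult Nm_mult Nm_closed integral_iff)
      have "inv u \<noteq> \<zero>" using uc by (metis Units_l_inv l_null zero_not_one)
      then show "(\<lambda>x. inv u \<otimes> x) ` ?fib w \<subseteq> ?fib \<one>"
        using u uc Fix_carrier Nm_inv by (auto simp: Fix_mult Fix_inv Nm_mult integral_iff Units_inv_closed)
      show "\<forall>x\<in>?fib \<one>. inv u \<otimes> (u \<otimes> x) = x" "\<forall>x\<in>?fib w. u \<otimes> (inv u \<otimes> x) = x"
        using uc Fix_carrier by (auto simp: m_assoc[symmetric])
    qed
    then show ?thesis by (simp add: bij_betw_same_card)
  qed
  have fin: "finite (Fix d)" using card_Fix[OF d] by simp
  have "geo d * (Q - 1) = card (Fix d - {\<zero>})"
    using card_Fix[OF d] Fix_zero[of d] geo_eq[of d] by simp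
  also have "Fix d - {\<zero>} = (\<Union>w\<in>F - {\<zero>}. ?fib w)"
    using Nm_in_F Nm_eq_zero_iff[OF Fix_carrier d] by auto
  also have "card \<dots> = (\<Sum>w\<in>F - {\<zero>}. card (?fib w))"
    using finite_F fin by (intro card_UN_disjoint) auto
  also have "\<dots> = (\<Sum>w\<in>F - {\<zero>}. card (?fib \<one>))"
    by (intro sum.cong refl eq) auto
  also have "\<dots> = card (?fib \<one>) * (Q - 1)"
    using card_F F_closed(2) finite_F by simp
  finally have "geo d = card (?fib \<one>)" using Q_gt_1 by simp
  then show ?thesis using eq[OF z] by simp
qed

lemma Tr_zero: "Tr d \<zero> = \<zero>"
  by (induction d) (simp_all add: zero_pow_Q)

lemma Nm_minus:
  assumes "x \<in> carrier R"
  shows "\<exists>s\<in>{\<one>, \<ominus> \<one>}. Nm d (\<ominus> x) = s \<otimes> Nm d x"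
proof -
  have "(\<ominus> \<one>) [^] n \<in> {\<one>, \<ominus> \<one>}" for n :: nat
    by (induction n) (auto simp: l_minus)
  moreover have "Nm d (\<ominus> x) = (\<ominus> \<one>) [^] geo d \<otimes> Nm d x"
    using assms nat_pow_distrib[of "\<ominus> \<one>" x "geo d"] by (simp add: Nm_def l_minus)
  ultimately show ?thesis by blast
qed

section \<open>The additive groups of the fields, written as multiplicative monoids, and their
  product\<close>

definition addg :: "'a set \<Rightarrow> 'a monoid" where
  "addg H = \<lparr>carrier = H, monoid.mult = (\<oplus>), one = \<zero>\<rparr>"

lemma addg_simps:
  "carrier (addg H) = H" "monoid.mult (addg H) = (\<oplus>)" "one (addg H) = \<zero>"
  by (simp_all add: addg_def)

lemma comm_group_addg: "comm_group (addg (Fix d))"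
  by (rule comm_groupI) (auto simp: addg_simps Fix_closed a_assoc intro!: a_comm l_neg Fix_minus bexI
      dest: Fix_carrier)

lemma inv_addg: "x \<in> Fix d \<Longrightarrow> inv\<^bsub>addg (Fix d)\<^esub> x = \<ominus> x"
  using comm_group.axioms(2)[OF comm_group_addg] Fix_carrier[of x d]
  by (intro group.inv_equality) (auto simp: addg_simps l_neg Fix_minus)

lemma pow_addg:
  assumes "x \<in> Fix d"
  shows "x [^]\<^bsub>addg (Fix d)\<^esub> (n::nat) = [n] \<cdot> x"
proof -
  interpret A: comm_group "addg (Fix d)" by (rule comm_group_addg)
  show ?thesis by (induction n) (simp_all add: addg_simps)
qed

text \<open>The ambient group. Its order is \<open>Q ^ (2 * l + 1)\<close>, the odd exponent being
  the sum of the consecutive degrees \<open>l\<close> and \<open>Suc l\<close>.\<close>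

definition V :: "nat \<Rightarrow> ('a \<times> 'a) monoid" where
  "V l = addg (Fix l) \<times>\<times> addg (Fix (Suc l))"

lemma carrier_V: "carrier (V l) = Fix l \<times> Fix (Suc l)"
  and one_V: "\<one>\<^bsub>V l\<^esub> = (\<zero>, \<zero>)"
  and mult_V: "(x, y) \<otimes>\<^bsub>V l\<^esub> (x', y') = (x \<oplus> x', y \<oplus> y')"
  by (simp_all add: V_def addg_simps DirProd_def)

lemma comm_group_V: "comm_group (V l)"
proof -
  interpret A: comm_group "addg (Fix l)" by (rule comm_group_addg)
  interpret B: comm_group "addg (Fix (Suc l))" by (rule comm_group_addg)
  interpret V: group "V l" unfolding V_def by (rule DirProd_group[OF A.is_group B.is_group])
  show ?thesis
    by (rule V.group_comm_groupI) (auto simp: carrier_V mult_V intro!: a_comm dest: Fix_carrier)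
qed

lemma inv_V: "x \<in> Fix l \<Longrightarrow> y \<in> Fix (Suc l) \<Longrightarrow> inv\<^bsub>V l\<^esub> (x, y) = (\<ominus> x, \<ominus> y)"
  using inv_DirProd[of "addg (Fix l)" "addg (Fix (Suc l))" x y] comm_group_addg
  by (simp add: V_def addg_simps inv_addg comm_group.axioms(2))

lemma order_V: "l > 0 \<Longrightarrow> order (V l) = Q ^ (l + Suc l)"
  using card_Fix(1)[of l] card_Fix(1)[of "Suc l"]
  by (simp add: order_def carrier_V card_cartesian_product power_add)

lemma pow_V:
  assumes "z \<in> carrier (V l)"
  shows "z [^]\<^bsub>V l\<^esub> p = \<one>\<^bsub>V l\<^esub>"
proof -
  interpret V: comm_group "V l" by (rule comm_group_V)
  obtain x y where z: "z = (x, y)" "x \<in> carrier R" "y \<in> carrier R"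
    using assms Fix_carrier by (auto simp: carrier_V)
  have "z [^]\<^bsub>V l\<^esub> n = ([n] \<cdot> x, [n] \<cdot> y)" for n :: nat
    by (induction n) (simp_all add: one_V mult_V z)
  then show ?thesis using add_pow_eq_zero[OF char_p dvd_refl] z by (simp add: one_V)
qed

end

section \<open>The Davenport--Hasse relation\<close>

context frobenius_field
begin

lemma eq_mult_inv_iff:
  assumes u: "u \<in> Units R" and a: "a \<in> carrier R" and b: "b \<in> carrier R"
  shows "a = b \<otimes> inv u \<longleftrightarrow> a \<otimes> u = b"
proof
  assume "a = b \<otimes> inv u"
  then show "a \<otimes> u = b" using u b by (simp add: m_assoc Units_closed)
next
  assume e: "a \<otimes> u = b"
  have "b \<otimes> inv u = a \<otimes> u \<otimes> inv u" by (simp add: e)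
  also have "\<dots> = a" using u a by (simp add: m_assoc Units_closed)
  finally show "a = b \<otimes> inv u" by simp
qed

subsection \<open>Monic polynomials and their root multisets\<close>

abbreviation PR where "PR \<equiv> poly_ring R"

definition monic :: "'a list set" where
  "monic = {f \<in> carrier PR. f \<noteq> [] \<and> hd f = \<one>}"

text \<open>The inverse of \<open>roots\<close>: over an algebraically closed field, monic
  polynomials and finite multisets of elements determine each other.\<close>

definition mpoly :: "'a multiset \<Rightarrow> 'a list" where
  "mpoly M = (THE f. f \<in> monic \<and> roots f = M)"

lemma monic_set: "f \<in> monic \<Longrightarrow> set f \<subseteq> carrier R"
  by (auto simp: monic_def univ_poly_carrier[symmetric] polynomial_def)

lemma monicI: "set f \<subseteq> carrier R \<Longrightarrow> f \<noteq> [] \<Longrightarrow> hd f = \<one> \<Longrightarrow> f \<in> monic"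
  by (auto simp: monic_def univ_poly_carrier[symmetric] polynomial_def)

text \<open>Algebraic closedness enters here: a monic polynomial splits, so its degree is the number
  of its roots with multiplicity.\<close>

lemma monic_length: "f \<in> monic \<Longrightarrow> length f = Suc (size (roots f))"
  using roots_over_carrier[of f] by (cases f) (auto simp: monic_def splitted_def)

lemma linear_in_monic: "a \<in> carrier R \<Longrightarrow> [\<one>, \<ominus> a] \<in> monic"
  by (rule monicI) auto

lemma linear_mult_monic:
  assumes "a \<in> carrier R" "f \<in> monic"
  shows "[\<one>, \<ominus> a] \<otimes>\<^bsub>PR\<^esub> f \<in> monic" and "roots ([\<one>, \<ominus> a] \<otimes>\<^bsub>PR\<^esub> f) = add_mset a (roots f)"
proof -
  interpret UP: "domain" PR by (rule univ_poly_is_domain[OF carrier_is_subring])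
  have l: "[\<one>, \<ominus> a] \<in> carrier PR" and f: "f \<in> carrier PR" "f \<noteq> []" "hd f = \<one>"
    using linear_in_monic[OF assms(1)] assms(2) by (auto simp: monic_def)
  have "[\<one>, \<ominus> a] \<otimes>\<^bsub>PR\<^esub> f \<noteq> []"
    using l f UP.integral_iff[OF l f(1)] by (simp add: univ_poly_zero)
  moreover have "hd ([\<one>, \<ominus> a] \<otimes>\<^bsub>PR\<^esub> f) = \<one>"
    using poly_mult_lead_coeff[OF carrier_is_subring, of "[\<one>, \<ominus> a]" f] l f
    by (simp add: univ_poly_mult univ_poly_carrier)
  ultimately show "[\<one>, \<ominus> a] \<otimes>\<^bsub>PR\<^esub> f \<in> monic" using l f by (simp add: monic_def)
  show "roots ([\<one>, \<ominus> a] \<otimes>\<^bsub>PR\<^esub> f) = add_mset a (roots f)"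
    by (rule poly_mult_degree_one_monic_imp_same_roots[OF assms(1) f(1,2)])
qed

lemma monic_factor:
  assumes f: "f \<in> monic" and a: "a \<in># roots f"
  shows "\<exists>g\<in>monic. f = [\<one>, \<ominus> a] \<otimes>\<^bsub>PR\<^esub> g"
proof -
  interpret UP: "domain" PR by (rule univ_poly_is_domain[OF carrier_is_subring])
  have fc: "f \<in> carrier PR" "f \<noteq> []" "hd f = \<one>" using f by (auto simp: monic_def)
  have root: "is_root f a" using a roots_mem_iff_is_root[OF fc(1)] by simp
  then have ac: "a \<in> carrier R" by (simp add: is_root_def)
  have l: "[\<one>, \<ominus> a] \<in> carrier PR" using linear_in_monic[OF ac] by (simp add: monic_def)
  obtain g where g: "g \<in> carrier PR" "f = [\<one>, \<ominus> a] \<otimes>\<^bsub>PR\<^esub> g"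
    using is_root_imp_pdivides[OF fc(1) root] by (auto simp: pdivides_def factor_def)
  have "g \<noteq> []" using fc g UP.r_null[OF l] by (auto simp: univ_poly_zero)
  moreover have "hd g = \<one>"
    using poly_mult_lead_coeff[OF carrier_is_subring, of "[\<one>, \<ominus> a]" g] l g fc \<open>g \<noteq> []\<close>
      lead_coeff_in_carrier[OF carrier_is_subring, of "hd g" "tl g"]
    by (simp add: univ_poly_mult univ_poly_carrier)
  ultimately show ?thesis using g by (auto simp: monic_def)
qed

lemma monic_eqI:
  assumes "f \<in> monic" "g \<in> monic" "roots f = roots g"
  shows "f = g"
  using assms
proof (induction "size (roots f)" arbitrary: f g)
  case 0
  then have "length f = 1" "length g = 1" using monic_length[of f] monic_length[of g] by auto
  then show ?case using 0 by (cases f; cases g) (auto simp: monic_def)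
next
  case (Suc n)
  then obtain a where a: "a \<in># roots f" by (metis multiset_nonemptyE size_empty nat.distinct(1))
  then have ac: "a \<in> carrier R"
    using roots_mem_iff_is_root[of f a] Suc by (auto simp: monic_def is_root_def)
  obtain f' where f': "f' \<in> monic" "f = [\<one>, \<ominus> a] \<otimes>\<^bsub>PR\<^esub> f'"
    using monic_factor[OF Suc(3) a] by blast
  obtain g' where g': "g' \<in> monic" "g = [\<one>, \<ominus> a] \<otimes>\<^bsub>PR\<^esub> g'"
    using monic_factor[OF Suc(4), of a] a Suc(5) by auto
  have "roots f' = roots g'"
    using Suc(5) linear_mult_monic(2)[OF ac f'(1)] linear_mult_monic(2)[OF ac g'(1)] f' g' by simp
  moreover have "n = size (roots f')"
    using Suc(2) linear_mult_monic(2)[OF ac f'(1)] f' by simp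
  ultimately show ?case using Suc(1)[OF _ f'(1) g'(1)] f' g' by simp
qed

lemma exists_monic:
  assumes "set_mset M \<subseteq> carrier R"
  shows "\<exists>f\<in>monic. roots f = M"
  using assms
proof (induction M)
  case empty
  have "[\<one>] \<in> monic" by (rule monicI) auto
  then show ?case using monic_length[of "[\<one>]"] by (intro bexI[of _ "[\<one>]"]) auto
next
  case (add a M)
  then obtain f where "f \<in> monic" "roots f = M" by auto
  then show ?case using linear_mult_monic[of a f] add by (intro bexI[of _ "[\<one>, \<ominus> a] \<otimes>\<^bsub>PR\<^esub> f"]) auto
qed

lemma mpoly_roots: "f \<in> monic \<Longrightarrow> mpoly (roots f) = f"
  unfolding mpoly_def by (rule the_equality) (auto intro: monic_eqI)

lemma
  assumes "set_mset M \<subseteq> carrier R"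
  shows mpoly_monic: "mpoly M \<in> monic" and roots_mpoly: "roots (mpoly M) = M"
  using exists_monic[OF assms] mpoly_roots by auto

lemma length_mpoly: "set_mset M \<subseteq> carrier R \<Longrightarrow> length (mpoly M) = Suc (size M)"
  using monic_length mpoly_monic roots_mpoly by metis

lemma mpoly_add_mset:
  assumes "a \<in> carrier R" "set_mset M \<subseteq> carrier R"
  shows "mpoly (add_mset a M) = [\<one>, \<ominus> a] \<otimes>\<^bsub>PR\<^esub> mpoly M"
  using mpoly_roots[OF linear_mult_monic(1)[OF assms(1) mpoly_monic[OF assms(2)]]]
    linear_mult_monic(2)[OF assms(1) mpoly_monic[OF assms(2)]] roots_mpoly[OF assms(2)] by simp

lemma coeff_linear_mult:
  assumes a: "a \<in> carrier R" and f: "set f \<subseteq> carrier R"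
  shows "coeff ([\<one>, \<ominus> a] \<otimes>\<^bsub>PR\<^esub> f) i = (if i = 0 then \<zero> else coeff f (i - 1)) \<ominus> a \<otimes> coeff f i"
proof -
  have 1: "map (\<lambda>b. \<one> \<otimes> b) f = f" using f by (induction f) auto
  have m: "set (map (\<lambda>b. \<ominus> a \<otimes> b) f) \<subseteq> carrier R" using a f by auto
  have pm: "poly_mult [\<ominus> a] f = poly_add (map (\<lambda>b. \<ominus> a \<otimes> b) f) []"
    by (simp del: poly_add.simps)
  have pmc: "set (poly_mult [\<ominus> a] f) \<subseteq> carrier R"
    using poly_mult_in_carrier[of "[\<ominus> a]" f] a f by simp
  have "[\<one>, \<ominus> a] \<otimes>\<^bsub>PR\<^esub> f = poly_add (f @ [\<zero>]) (poly_mult [\<ominus> a] f)"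
    unfolding univ_poly_mult
    by (subst poly_mult.simps(2)) (simp add: 1 del: poly_add.simps poly_mult.simps)
  then have "coeff ([\<one>, \<ominus> a] \<otimes>\<^bsub>PR\<^esub> f) i = coeff (f @ [\<zero>]) i \<oplus> coeff (poly_mult [\<ominus> a] f) i"
    using poly_add_coeff[of "f @ [\<zero>]" "poly_mult [\<ominus> a] f"] f pmc by simp
  also have "coeff (poly_mult [\<ominus> a] f) i = \<ominus> a \<otimes> coeff f i"
    unfolding pm using poly_add_coeff[OF m, of "[]"] scalar_coeff[of "\<ominus> a" f] a f by simp
  also have "coeff (f @ [\<zero>]) i = (if i = 0 then \<zero> else coeff f (i - 1))"
    by (induction f) auto
  finally show ?thesis using a f by (simp add: a_minus_def l_minus)
qed

text \<open>The sum and the product of a multiset are read off the coefficients of its monic polynomial, so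
  that changing the second coefficient shifts the sum and keeps the product.\<close>

definition msum :: "'a multiset \<Rightarrow> 'a" where
  "msum M = (if M = {#} then \<zero> else \<ominus> coeff (mpoly M) (size M - 1))"

definition mprod :: "'a multiset \<Rightarrow> 'a" where
  "mprod M = (\<ominus> \<one>) [^] size M \<otimes> coeff (mpoly M) 0"

lemma coeff_mpoly_closed: "set_mset M \<subseteq> carrier R \<Longrightarrow> coeff (mpoly M) i \<in> carrier R"
  using mpoly_monic monic_set coeff_in_carrier by blast

lemma coeff_mpoly_size: "set_mset M \<subseteq> carrier R \<Longrightarrow> coeff (mpoly M) (size M) = \<one>"
  using lead_coeff_simp[of "mpoly M"] length_mpoly[of M] mpoly_monic[of M] by (auto simp: monic_def)

lemma msum_closed: "set_mset M \<subseteq> carrier R \<Longrightarrow> msum M \<in> carrier R"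
  by (simp add: msum_def coeff_mpoly_closed)

lemma mprod_closed: "set_mset M \<subseteq> carrier R \<Longrightarrow> mprod M \<in> carrier R"
  by (simp add: mprod_def coeff_mpoly_closed)

lemma msum_empty: "msum {#} = \<zero>"
  by (simp add: msum_def)

lemma mprod_empty: "mprod {#} = \<one>"
  using coeff_mpoly_size[of "{#}"] by (simp add: mprod_def)

lemma msum_add_mset:
  assumes "a \<in> carrier R" "set_mset M \<subseteq> carrier R"
  shows "msum (add_mset a M) = a \<oplus> msum M"
proof -
  have "msum (add_mset a M) = \<ominus> ((if size M = 0 then \<zero> else coeff (mpoly M) (size M - 1)) \<ominus> a)"
    using coeff_linear_mult[OF assms(1) monic_set[OF mpoly_monic[OF assms(2)]], of "size M"]
      coeff_mpoly_size[OF assms(2)] assms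
    by (simp add: msum_def mpoly_add_mset)
  then show ?thesis
    using assms coeff_mpoly_closed[OF assms(2)]
    by (auto simp: msum_def a_minus_def minus_add a_comm)
qed

lemma mprod_add_mset:
  assumes "a \<in> carrier R" "set_mset M \<subseteq> carrier R"
  shows "mprod (add_mset a M) = a \<otimes> mprod M"
proof -
  let ?c = "coeff (mpoly M) 0"
  have c: "?c \<in> carrier R" by (rule coeff_mpoly_closed[OF assms(2)])
  have "coeff (mpoly (add_mset a M)) 0 = \<ominus> (a \<otimes> ?c)"
    using coeff_linear_mult[OF assms(1) monic_set[OF mpoly_monic[OF assms(2)]], of 0] assms c
    by (simp add: mpoly_add_mset a_minus_def)
  then have "mprod (add_mset a M) = (\<ominus> \<one>) [^] size M \<otimes> \<ominus> \<one> \<otimes> \<ominus> (a \<otimes> ?c)"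
    by (simp add: mprod_def)
  also have "\<dots> = (\<ominus> \<one>) [^] size M \<otimes> (a \<otimes> ?c)"
    using assms c by (simp add: m_assoc l_minus r_minus)
  also have "\<dots> = a \<otimes> mprod M" using assms c by (simp add: mprod_def m_lcomm)
  finally show ?thesis .
qed

lemma mprod_eq_zero_iff: "set_mset M \<subseteq> carrier R \<Longrightarrow> mprod M = \<zero> \<longleftrightarrow> \<zero> \<in># M"
  by (induction M) (auto simp: mprod_empty mprod_add_mset mprod_closed integral_iff)

subsection \<open>Frobenius-invariant multisets\<close>

definition frob :: "'a \<Rightarrow> 'a" where "frob x = x [^] Q"

lemma frob_closed: "x \<in> carrier R \<Longrightarrow> frob x \<in> carrier R"
  by (simp add: frob_def)

lemma frob_hom: "ring_hom_ring R R frob"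
proof (rule ring_hom_ringI)
  show "frob (x \<oplus> y) = frob x \<oplus> frob y" if "x \<in> carrier R" "y \<in> carrier R" for x y
    using pow_Q_add[OF that, of 1] by (simp add: frob_def)
qed (auto simp: frob_def nat_pow_distrib ring_axioms)

lemma frob_inj: "x \<in> carrier R \<Longrightarrow> y \<in> carrier R \<Longrightarrow> frob x = frob y \<Longrightarrow> x = y"
  using pow_Q_inj[of x y 1] by (simp add: frob_def)

lemma frob_eq_iff_F: "x \<in> carrier R \<Longrightarrow> frob x = x \<longleftrightarrow> x \<in> F"
  by (simp add: frob_def F_def)

lemma frob_pow: "x \<in> carrier R \<Longrightarrow> frob (x [^] (Q ^ i)) = x [^] (Q ^ Suc i)"
  by (simp add: frob_def nat_pow_pow mult.commute)

text \<open>Frobenius is a ring homomorphism, so it carries a product of factors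
  \<open>X - a\<close> to the product of the \<open>X - frob a\<close>. Therefore a
  Frobenius-invariant multiset has a polynomial with coefficients in \<open>F\<close>.\<close>

lemma map_frob_mpoly:
  assumes "set_mset M \<subseteq> carrier R"
  shows "map frob (mpoly M) = mpoly (image_mset frob M)"
  using assms
proof (induction M)
  interpret h: ring_hom_ring R R frob by (rule frob_hom)
  case empty
  have "mpoly {#} = [\<one>]"
    using length_mpoly[of "{#}"] mpoly_monic[of "{#}"] by (cases "mpoly {#}") (auto simp: monic_def)
  then show ?case by simp
next
  interpret h: ring_hom_ring R R frob by (rule frob_hom)
  case (add a M)
  then have a: "a \<in> carrier R" and M: "set_mset M \<subseteq> carrier R" by auto
  have fM: "set_mset (image_mset frob M) \<subseteq> carrier R" using M frob_closed by auto
  let ?f = "[\<one>, \<ominus> a] \<otimes>\<^bsub>PR\<^esub> mpoly M"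
  have f: "?f \<in> monic" by (rule linear_mult_monic(1)[OF a mpoly_monic[OF M]])
  \<comment> \<open>The homomorphism law for products holds up to stripping leading zeros; a leading
    \<open>\<one>\<close> makes that harmless.\<close>
  have "hd (map frob ?f) = \<one>" "map frob ?f \<noteq> []"
    using f by (auto simp: monic_def hd_map)
  then have "map frob ?f = normalize (map frob ?f)"
    by (cases "map frob ?f") auto
  also have "\<dots> = poly_mult (map frob [\<one>, \<ominus> a]) (map frob (mpoly M))"
    unfolding univ_poly_mult
    using a monic_set[OF mpoly_monic[OF M]] by (intro h.poly_mult_hom') auto
  also have "map frob [\<one>, \<ominus> a] = [\<one>, \<ominus> frob a]" using a by simp
  finally show ?case
    using add a M fM by (simp add: mpoly_add_mset frob_closed univ_poly_mult del: poly_mult.simps)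
qed

text \<open>These stand for the monic polynomials of degree \<open>n\<close> over \<open>F\<close>
  with nonzero constant term. Excluding \<open>\<zero>\<close> puts the product of the roots into
  the multiplicative group of \<open>F\<close>.\<close>

definition inv_msets :: "nat \<Rightarrow> 'a multiset set" where
  "inv_msets n = {M. size M = n \<and> set_mset M \<subseteq> carrier R - {\<zero>} \<and> image_mset frob M = M}"

lemma inv_msets_carrier: "M \<in> inv_msets n \<Longrightarrow> set_mset M \<subseteq> carrier R"
  by (auto simp: inv_msets_def)

lemma set_mpoly_subset_F:
  assumes "M \<in> inv_msets n"
  shows "set (mpoly M) \<subseteq> F"
proof
  fix c assume c: "c \<in> set (mpoly M)"
  have "map frob (mpoly M) = mpoly M"
    using map_frob_mpoly[OF inv_msets_carrier[OF assms]] assms by (simp add: inv_msets_def)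
  then have "map frob (mpoly M) = map (\<lambda>x. x) (mpoly M)" by simp
  then have "frob c = c" using c unfolding map_eq_conv by blast
  moreover have "c \<in> carrier R"
    using c monic_set[OF mpoly_monic[OF inv_msets_carrier[OF assms]]] by blast
  ultimately show "c \<in> F" using frob_eq_iff_F by blast
qed

lemma coeff_in_F: "set f \<subseteq> F \<Longrightarrow> coeff f i \<in> F"
  by (induction f) (auto simp: F_closed)

lemma msum_in_F: "M \<in> inv_msets n \<Longrightarrow> msum M \<in> F"
  using coeff_in_F[OF set_mpoly_subset_F] by (auto simp: msum_def F_closed)

lemma mprod_in_F:
  assumes "M \<in> inv_msets n"
  shows "mprod M \<in> F - {\<zero>}"
proof -
  have "(\<ominus> \<one>) [^] k \<in> F" for k :: nat by (induction k) (auto simp: F_closed)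
  then have "mprod M \<in> F"
    using coeff_in_F[OF set_mpoly_subset_F[OF assms]] by (auto simp: mprod_def F_closed)
  moreover have "mprod M \<noteq> \<zero>"
    using mprod_eq_zero_iff[OF inv_msets_carrier[OF assms]] assms by (auto simp: inv_msets_def)
  ultimately show ?thesis by simp
qed

lemma finite_inv_msets: "finite (inv_msets n)"
proof (rule finite_subset)
  show "inv_msets n \<subseteq> roots ` {f. set f \<subseteq> F \<and> length f = Suc n}"
  proof
    fix M assume M: "M \<in> inv_msets n"
    have "mpoly M \<in> {f. set f \<subseteq> F \<and> length f = Suc n}"
      using set_mpoly_subset_F[OF M] length_mpoly[OF inv_msets_carrier[OF M]] M
      by (auto simp: inv_msets_def)
    then show "M \<in> roots ` {f. set f \<subseteq> F \<and> length f = Suc n}"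
      using roots_mpoly[OF inv_msets_carrier[OF M]] by (metis imageI)
  qed
  show "finite (roots ` {f. set f \<subseteq> F \<and> length f = Suc n})"
    using finite_lists_length_eq[OF finite_F] by blast
qed

definition shift :: "'a \<Rightarrow> 'a multiset \<Rightarrow> 'a multiset" where
  "shift t M = roots (\<one> # (mpoly M ! 1 \<ominus> t) # drop 2 (mpoly M))"

text \<open>\<open>n \<ge> 2\<close> keeps the altered coefficient apart from the constant one, so
  the product survives. The new coefficients are still in \<open>F\<close>, hence the new root
  multiset is invariant, and the unchanged nonzero product keeps \<open>\<zero>\<close> out of
  it.\<close>

lemma shift_props:
  assumes M: "M \<in> inv_msets n" and n: "n \<ge> 2" and t: "t \<in> F"
  shows "shift t M \<in> inv_msets n" and "msum (shift t M) = msum M \<oplus> t"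
    and "mprod (shift t M) = mprod M" and "shift (\<ominus> t) (shift t M) = M"
proof -
  interpret h: ring_hom_ring R R frob by (rule frob_hom)
  have Mc: "set_mset M \<subseteq> carrier R" by (rule inv_msets_carrier[OF M])
  have tc: "t \<in> carrier R" using t F_closed(1) by blast
  have len: "length (mpoly M) = Suc n"
    using length_mpoly[OF Mc] M by (simp add: inv_msets_def)
  have monic: "mpoly M \<in> monic" by (rule mpoly_monic[OF Mc])
  obtain c r where f: "mpoly M = \<one> # c # r" and r: "length r = n - 1"
    using len n monic
    by (cases "mpoly M"; cases "tl (mpoly M)") (auto simp: monic_def)
  have F: "c \<in> F" "set r \<subseteq> F" using set_mpoly_subset_F[OF M] by (auto simp: f)
  have c: "c \<in> carrier R" and rc: "set r \<subseteq> carrier R" using monic_set[OF monic] by (auto simp: f)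
  define g where "g = \<one> # (c \<ominus> t) # r"
  have g: "g \<in> monic" unfolding g_def using c tc rc by (intro monicI) auto
  have sh: "shift t M = roots g" by (simp add: shift_def f g_def)
  have gF: "set g \<subseteq> F" using F t by (auto simp: g_def a_minus_def F_closed)
  have mg: "mpoly (roots g) = g" by (rule mpoly_roots[OF g])
  have size: "size (roots g) = n" using monic_length[OF g] r n by (simp add: g_def)
  have rootsc: "set_mset (roots g) \<subseteq> carrier R"
    using roots_mem_iff_is_root[of g] g by (auto simp: monic_def is_root_def)
  obtain b r' where r': "r = r' @ [b]" using r n by (cases r rule: rev_cases) auto
  have coeff0: "coeff (x # y # r) 0 = coeff r 0" for x y
    by (simp add: r')
  show prod: "mprod (shift t M) = mprod M"
    unfolding sh mprod_def mg size using M by (simp add: f g_def coeff0 inv_msets_def del: coeff.simps)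
  have "M \<noteq> {#}" "roots g \<noteq> {#}" using M size n by (auto simp: inv_msets_def)
  then have "msum (shift t M) = \<ominus> (c \<ominus> t)" "msum M = \<ominus> c"
    unfolding sh msum_def mg size using M r n by (auto simp: f g_def inv_msets_def)
  then show "msum (shift t M) = msum M \<oplus> t"
    using c tc by (simp add: a_minus_def minus_add)
  have "map frob g = g"
    using gF frob_eq_iff_F F_closed(1) by (intro map_idI) auto
  then have "mpoly (image_mset frob (roots g)) = g"
    using map_frob_mpoly[OF rootsc] mg by simp
  moreover have "set_mset (image_mset frob (roots g)) \<subseteq> carrier R"
    using rootsc frob_closed by auto
  ultimately have "image_mset frob (roots g) = roots g"
    using roots_mpoly[of "image_mset frob (roots g)"] by simp
  moreover have "\<zero> \<notin># roots g"
    using mprod_eq_zero_iff[OF rootsc] prod mprod_in_F[OF M] by (auto simp: sh)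
  ultimately show "shift t M \<in> inv_msets n"
    using size rootsc by (auto simp: sh inv_msets_def)
  have "shift (\<ominus> t) (shift t M) = roots (\<one> # (c \<ominus> t \<ominus> \<ominus> t) # r)"
    unfolding sh unfolding shift_def mg by (simp add: g_def)
  also have "c \<ominus> t \<ominus> \<ominus> t = c" using c tc by (simp add: a_minus_def a_assoc l_neg)
  finally show "shift (\<ominus> t) (shift t M) = M" using roots_mpoly[OF Mc] by (simp add: f)
qed

text \<open>For \<open>x\<close> in \<open>Fix j\<close> with \<open>j > 0\<close> this is the root
  multiset of the characteristic polynomial of \<open>x\<close> over \<open>F\<close>: if
  \<open>x\<close> has degree \<open>k\<close>, its orbit is run through \<open>j div k\<close>
  times.\<close>

definition orb :: "nat \<Rightarrow> 'a \<Rightarrow> 'a multiset" where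
  "orb j x = image_mset (\<lambda>i. x [^] (Q ^ i)) (mset_set {..<j})"

lemma orb_0: "orb 0 x = {#}" and orb_Suc: "orb (Suc j) x = add_mset (x [^] (Q ^ j)) (orb j x)"
  by (simp_all add: orb_def lessThan_Suc)

lemma size_orb: "size (orb j x) = j"
  by (simp add: orb_def)

lemma set_orb: "set_mset (orb j x) = (\<lambda>i. x [^] (Q ^ i)) ` {..<j}"
  by (simp add: orb_def)

lemma count_orb: "count (orb j x) y = card {i. i < j \<and> x [^] (Q ^ i) = y}"
proof (induction j)
  case (Suc j)
  have "{i. i < Suc j \<and> x [^] (Q ^ i) = y}
      = (if x [^] (Q ^ j) = y then insert j {i. i < j \<and> x [^] (Q ^ i) = y}
         else {i. i < j \<and> x [^] (Q ^ i) = y})"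
    by (auto simp: less_Suc_eq)
  then show ?case using Suc by (simp add: orb_Suc)
qed (simp add: orb_0)

lemma msum_orb_plus:
  assumes "x \<in> carrier R" "set_mset M \<subseteq> carrier R"
  shows "msum (orb j x + M) = Tr j x \<oplus> msum M"
  using assms
proof (induction j)
  case (Suc j)
  have "set_mset (orb j x + M) \<subseteq> carrier R" using Suc by (auto simp: set_orb)
  then show ?case
    using Suc msum_closed[of M] Tr_closed[of x j] by (simp add: orb_Suc msum_add_mset a_ac)
qed (simp add: orb_0 msum_closed)

lemma mprod_orb_plus:
  assumes "x \<in> carrier R" "set_mset M \<subseteq> carrier R"
  shows "mprod (orb j x + M) = Nm j x \<otimes> mprod M"
  using assms
proof (induction j)
  case (Suc j)
  have "set_mset (orb j x + M) \<subseteq> carrier R" using Suc by (auto simp: set_orb)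
  then have "mprod (orb (Suc j) x + M) = x [^] (Q ^ j) \<otimes> (Nm j x \<otimes> mprod M)"
    using Suc by (simp add: orb_Suc mprod_add_mset)
  also have "\<dots> = Nm j x \<otimes> x [^] (Q ^ j) \<otimes> mprod M"
    using Suc mprod_closed[of M] Nm_closed[of x j] by (simp add: m_ac)
  also have "Nm j x \<otimes> x [^] (Q ^ j) = Nm (Suc j) x"
    using Suc by (simp add: Nm_def geo_Suc' nat_pow_mult)
  finally show ?case .
qed (simp add: orb_0 mprod_closed Nm_def geo_def)

lemma frob_orb:
  assumes "x \<in> Fix j"
  shows "image_mset frob (orb j x) = orb j x"
proof -
  have x: "x \<in> carrier R" "x [^] (Q ^ j) = x" using assms by (auto simp: Fix_def)
  \<comment> \<open>Frobenius moves the window of exponents up by one; at \<open>k = j\<close> the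
    element that enters equals the \<open>x\<close> that leaves.\<close>
  have "add_mset x (image_mset frob (orb k x)) = orb (Suc k) x" for k
    by (induction k) (use x in \<open>simp_all add: orb_0 orb_Suc frob_pow add_mset_commute\<close>)
  from this[of j] show ?thesis using x by (simp add: orb_Suc)
qed

lemma count_frob_invariant:
  assumes "set_mset M \<subseteq> carrier R" "image_mset frob M = M" "x \<in> carrier R"
  shows "count M (x [^] (Q ^ i)) = count M x"
proof (induction i)
  case (Suc i)
  let ?y = "x [^] (Q ^ i)"
  have y: "?y \<in> carrier R" using assms by simp
  have "count M (frob ?y) = count (image_mset frob M) (frob ?y)" using assms by simp
  also have "\<dots> = sum (count M) (frob -` {frob ?y} \<inter> set_mset M)"
    by (simp add: count_image_mset)
  also have "\<dots> = sum (count M) ({?y} \<inter> set_mset M)"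
    using assms y frob_inj by (intro sum.cong) auto
  also have "\<dots> = count M ?y" by (cases "?y \<in># M") (simp_all add: not_in_iff)
  finally show ?case using Suc assms by (simp only: frob_pow)
qed (use assms in simp)

text \<open>The orbit stays in the finite set of elements of \<open>M\<close>, so two iterates
  coincide, and injectivity of Frobenius makes the orbit purely periodic. Its least period
  \<open>k\<close> is the degree of \<open>x\<close> over \<open>F\<close>.\<close>

lemma orbit_period:
  assumes M: "M \<in> inv_msets n" and x: "x \<in># M"
  shows "\<exists>k>0. \<forall>i. x [^] (Q ^ i) = x \<longleftrightarrow> k dvd i"
proof -
  have xc: "x \<in> carrier R" using M x by (auto simp: inv_msets_def)
  have mem: "x [^] (Q ^ i) \<in># M" for i
    using count_frob_invariant[OF inv_msets_carrier[OF M] _ xc, of i] M x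
    by (simp add: inv_msets_def flip: count_greater_zero_iff)
  have add: "x [^] (Q ^ (i + j)) = (x [^] (Q ^ i)) [^] (Q ^ j)" for i j
    using xc by (simp add: nat_pow_pow power_add)
  have "\<not> inj_on (\<lambda>i. x [^] (Q ^ i)) (UNIV :: nat set)"
    using mem finite_subset[of "range (\<lambda>i. x [^] (Q ^ i))" "set_mset M"] finite_imageD by blast
  then obtain i j where ij: "i < j" "x [^] (Q ^ i) = x [^] (Q ^ j)"
    by (metis linorder_injI)
  have "(x [^] (Q ^ (j - i))) [^] (Q ^ i) = x [^] (Q ^ i)"
    using add[of "j - i" i] ij by simp
  then have per: "x [^] (Q ^ (j - i)) = x" "j - i > 0"
    using pow_Q_inj[of "x [^] (Q ^ (j - i))" x i] xc ij by auto
  define k where "k = (LEAST k. k > 0 \<and> x [^] (Q ^ k) = x)"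
  have k: "k > 0" "x [^] (Q ^ k) = x"
    using LeastI[of "\<lambda>k. k > 0 \<and> x [^] (Q ^ k) = x" "j - i"] per by (auto simp: k_def)
  have mult: "x [^] (Q ^ (t * k)) = x" for t
    by (induction t) (use k xc add in \<open>simp_all add: add.commute\<close>)
  have "x [^] (Q ^ i) = x \<longleftrightarrow> k dvd i" for i
  proof
    assume "x [^] (Q ^ i) = x"
    then have "x [^] (Q ^ (i mod k)) = x"
      using add[of "(i div k) * k" "i mod k"] mult[of "i div k"] by simp
    moreover have "i mod k < k" using k by simp
    ultimately have "i mod k = 0"
      using not_less_Least[of "i mod k" "\<lambda>k. k > 0 \<and> x [^] (Q ^ k) = x"] by (auto simp: k_def)
    then show "k dvd i" by auto
  qed (use mult in \<open>auto simp: mult.commute[of k]\<close>)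
  with k show ?thesis by blast
qed

text \<open>Multiplicities in both multisets are constant along the Frobenius orbit of
  \<open>x\<close>, so comparing them at \<open>x\<close> suffices.\<close>

lemma orb_subset_iff:
  assumes M: "M \<in> inv_msets n" and x: "x \<in> Fix j"
  shows "orb j x \<subseteq># M \<longleftrightarrow> count (orb j x) x \<le> count M x"
proof
  assume *: "count (orb j x) x \<le> count M x"
  have xc: "x \<in> carrier R" using x by (simp add: Fix_def)
  show "orb j x \<subseteq># M"
  proof (rule mset_subset_eqI)
    fix y
    show "count (orb j x) y \<le> count M y"
    proof (cases "y \<in># orb j x")
      case True
      then obtain i where y: "y = x [^] (Q ^ i)" by (auto simp: set_orb)
      have "set_mset (orb j x) \<subseteq> carrier R" using xc by (auto simp: set_orb)
      then show ?thesis
        unfolding y using * M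
        by (simp add: count_frob_invariant[OF _ frob_orb[OF x] xc]
            count_frob_invariant[OF inv_msets_carrier[OF M] _ xc] inv_msets_def)
    qed (simp add: not_in_iff)
  qed
qed (simp add: mset_subset_eq_count)

text \<open>The admissible \<open>j\<close> are the multiples \<open>t * k\<close> of the period.
  Since \<open>orb (t * k) x\<close> contains \<open>x\<close> exactly \<open>t\<close> times, it
  fits into \<open>M\<close> for \<open>t\<close> from 1 to \<open>count M x\<close>.\<close>

lemma card_orbit_lengths:
  assumes M: "M \<in> inv_msets n" and x: "x \<in># M"
  shows "card {j. j > 0 \<and> x \<in> Fix j \<and> orb j x \<subseteq># M} = count M x"
proof -
  have xc: "x \<in> carrier R" using M x by (auto simp: inv_msets_def)
  obtain k where k: "k > 0" "\<And>i. x [^] (Q ^ i) = x \<longleftrightarrow> k dvd i" 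
    using orbit_period[OF M x] by blast
  have period: "x \<in> Fix j \<longleftrightarrow> k dvd j" for j using k xc by (simp add: Fix_def)
  have count: "count (orb (t * k) x) x = t" for t
  proof -
    have "{i. i < t * k \<and> k dvd i} = (\<lambda>i. i * k) ` {..<t}"
      using k by (auto simp: image_iff dvd_def mult.commute)
    moreover have "inj_on (\<lambda>i. i * k) {..<t}" using k by (auto simp: inj_on_def)
    ultimately show ?thesis by (simp add: count_orb k card_image)
  qed
  have "{j. j > 0 \<and> x \<in> Fix j \<and> orb j x \<subseteq># M} = (\<lambda>t. t * k) ` {1..count M x}"
  proof (intro equalityI subsetI)
    fix j assume j: "j \<in> {j. j > 0 \<and> x \<in> Fix j \<and> orb j x \<subseteq># M}"
    then obtain t where t: "j = t * k" using period by (auto simp: dvd_def mult.commute)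
    have "t \<le> count M x" using orb_subset_iff[OF M, of x j] j count[of t] by (simp add: t)
    then show "j \<in> (\<lambda>t. t * k) ` {1..count M x}" using j t by auto
  next
    fix j assume "j \<in> (\<lambda>t. t * k) ` {1..count M x}"
    then obtain t where "j = t * k" "t \<in> {1..count M x}" by (elim imageE)
    then have t: "j = t * k" "t \<ge> 1" "t \<le> count M x" by auto
    then show "j \<in> {j. j > 0 \<and> x \<in> Fix j \<and> orb j x \<subseteq># M}"
      using orb_subset_iff[OF M, of x j] count[of t] period[of j] k(1) by simp
  qed
  moreover have "inj_on (\<lambda>t. t * k) {1..count M x}" using k by (auto simp: inj_on_def)
  ultimately show ?thesis by (simp add: card_image)
qed

text \<open>Sorting the pairs \<open>(j, x)\<close> by \<open>x\<close> gives the sum of all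
  multiplicities in \<open>M\<close>. This replaces the logarithmic derivative of an Euler product:
  the degree of a polynomial is the sum of \<open>deg P\<close> over the prime powers
  \<open>P^t\<close> dividing it.\<close>

lemma card_orbits:
  assumes M: "M \<in> inv_msets n"
  shows "card {jx \<in> Sigma {1..n} (\<lambda>j. Fix j - {\<zero>}). orb (fst jx) (snd jx) \<subseteq># M} = n"
proof -
  let ?J = "\<lambda>x. {j. j > 0 \<and> x \<in> Fix j \<and> orb j x \<subseteq># M}"
  have le: "j \<le> n" if "orb j x \<subseteq># M" for j x
    using size_mset_mono[OF that] M by (simp add: size_orb inv_msets_def)
  have mem: "x \<in># M" if "orb j x \<subseteq># M" "j > 0" "x \<in> Fix j" for j x
  proof -
    have "x \<in># orb j x" using that by (auto simp: set_orb Fix_def intro!: image_eqI[of _ _ 0])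
    then show ?thesis using that by (meson mset_subset_eqD)
  qed
  have "{jx \<in> Sigma {1..n} (\<lambda>j. Fix j - {\<zero>}). orb (fst jx) (snd jx) \<subseteq># M}
      = prod.swap ` Sigma (set_mset M) ?J"
    using le mem M by (auto simp: image_iff inv_msets_def Suc_le_eq)
  then have "card {jx \<in> Sigma {1..n} (\<lambda>j. Fix j - {\<zero>}). orb (fst jx) (snd jx) \<subseteq># M}
      = card (Sigma (set_mset M) ?J)"
    by (simp add: card_image)
  also have "\<dots> = (\<Sum>x\<in>set_mset M. card (?J x))"
    using le by (intro card_SigmaI) (auto intro: finite_subset[of _ "{..n}"])
  also have "\<dots> = (\<Sum>x\<in>set_mset M. count M x)"
    using card_orbit_lengths[OF M] by simp
  also have "\<dots> = n" using M by (simp add: inv_msets_def size_multiset_overloaded_eq)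
  finally show ?thesis .
qed

end

subsection \<open>Character sums over norm fibres\<close>

locale frobenius_character = frobenius_field +
  fixes \<psi> :: "'a \<Rightarrow> complex"
  assumes \<psi>_add: "\<And>x y. x \<in> F \<Longrightarrow> y \<in> F \<Longrightarrow> \<psi> (x \<oplus> y) = \<psi> x * \<psi> y"
    and \<psi>_zero: "\<psi> \<zero> = 1"
    and \<psi>_nontrivial: "\<exists>t\<in>F. \<psi> t \<noteq> 1"
begin

definition Fs :: "'a set" where "Fs = F - {\<zero>}"

text \<open>The degree \<open>n\<close> coefficient of Weil's L-function for Gauss sums, read at the
  group element \<open>z\<close>.\<close>

definition wsum :: "nat \<Rightarrow> 'a \<Rightarrow> complex" where
  "wsum n z = (\<Sum>M | M \<in> inv_msets n \<and> mprod M = z. \<psi> (msum M))"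

text \<open>\<open>S d\<close> is the Gauss sum of \<open>Fix d\<close> with values in the group ring of \<open>Fs\<close>: the coefficient
  at \<open>z\<close> collects the elements of norm \<open>z\<close>.\<close>

definition S :: "nat \<Rightarrow> 'a \<Rightarrow> complex" where
  "S d z = (\<Sum>x | x \<in> Fix d - {\<zero>} \<and> Nm d x = z. \<psi> (Tr d x))"

text \<open>Shifting the sum of the roots by \<open>t\<close> permutes the index set and multiplies
  every term by \<open>\<psi> t \<noteq> 1\<close>. So the L-function is linear, which is what makes
  the Davenport--Hasse relation so short.\<close>

lemma wsum_eq_0:
  assumes "n \<ge> 2"
  shows "wsum n z = 0"
proof -
  obtain t where t: "t \<in> F" "\<psi> t \<noteq> 1" using \<psi>_nontrivial by blast
  let ?A = "{M. M \<in> inv_msets n \<and> mprod M = z}"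
  have t': "\<ominus> t \<in> F" "\<ominus> (\<ominus> t) = t" using t F_closed by auto
  have "bij_betw (shift t) ?A ?A"
    by (rule bij_betw_byWitness[where f' = "shift (\<ominus> t)"])
      (use shift_props[OF _ assms t(1)] shift_props[OF _ assms t'(1)] t' in auto)
  then have "wsum n z = (\<Sum>M\<in>?A. \<psi> (msum (shift t M)))"
    unfolding wsum_def by (rule sum.reindex_bij_betw[symmetric])
  also have "\<dots> = (\<Sum>M\<in>?A. \<psi> (msum M) * \<psi> t)"
    using shift_props(2)[OF _ assms t(1)] msum_in_F t by (intro sum.cong refl) (auto simp: \<psi>_add)
  also have "\<dots> = wsum n z * \<psi> t" by (simp add: wsum_def sum_distrib_right)
  finally show ?thesis using t by simp
qed

lemma wsum_0: "wsum 0 z = (if z = \<one> then 1 else 0)"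
proof -
  have "{M. M \<in> inv_msets 0 \<and> mprod M = z} = (if z = \<one> then {{#}} else {})"
    by (auto simp: inv_msets_def mprod_empty)
  then show ?thesis by (simp add: wsum_def msum_empty \<psi>_zero)
qed

lemma wsum_1:
  assumes "z \<in> Fs"
  shows "wsum 1 z = \<psi> z"
proof -
  have z: "z \<in> carrier R" "z \<noteq> \<zero>" "frob z = z"
    using assms F_closed(1) frob_eq_iff_F by (auto simp: Fs_def)
  have single: "msum {#a#} = a" "mprod {#a#} = a" if "a \<in> carrier R" for a
    using that msum_add_mset[of a "{#}"] mprod_add_mset[of a "{#}"]
    by (simp_all add: msum_empty mprod_empty)
  have "{M. M \<in> inv_msets 1 \<and> mprod M = z} = {{#z#}}"
  proof (intro equalityI subsetI)
    fix M assume M: "M \<in> {M. M \<in> inv_msets 1 \<and> mprod M = z}"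
    then obtain a where a: "M = {#a#}" using size_1_singleton_mset[of M] by (auto simp: inv_msets_def)
    then have "a \<in> carrier R" using M by (simp add: inv_msets_def)
    then show "M \<in> {{#z#}}" using M single(2)[of a] by (simp add: a)
  qed (use z single in \<open>auto simp: inv_msets_def\<close>)
  then show ?thesis using z single by (simp add: wsum_def)
qed

text \<open>Weighting each invariant multiset of size \<open>n\<close> by \<open>n\<close>, i.e. by the number of Frobenius
  orbits (with repetition) it contains, gives Newton's identities for the sums \<open>wsum\<close>.\<close>

lemma newton_identity:
  assumes z: "z \<in> Fs"
  shows "of_nat n * wsum n z
    = (\<Sum>j\<in>{1..n}. \<Sum>x\<in>Fix j - {\<zero>}. \<psi> (Tr j x) * wsum (n - j) (z \<otimes> inv (Nm j x)))"
proof -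
  let ?A = "{M. M \<in> inv_msets n \<and> mprod M = z}"
  let ?B = "Sigma {1..n} (\<lambda>j. Fix j - {\<zero>})"
  have finA: "finite ?A" using finite_inv_msets by simp
  have finB: "finite ?B" using card_Fix(2) by auto
  have zc: "z \<in> carrier R" using z F_closed(1) by (auto simp: Fs_def)
  \<comment> \<open>Removing \<open>orb j x\<close> from \<open>M\<close> lowers the size by
    \<open>j\<close>, the sum by \<open>Tr j x\<close>, and divides the product by
    \<open>Nm j x\<close>.\<close>
  have inner: "(\<Sum>M | M \<in> ?A \<and> orb j x \<subseteq># M. \<psi> (msum M))
      = \<psi> (Tr j x) * wsum (n - j) (z \<otimes> inv (Nm j x))" if jx: "(j, x) \<in> ?B" for j x
  proof -
    have x: "x \<in> Fix j" "x \<in> carrier R" "x \<noteq> \<zero>" and j: "j > 0" "j \<le> n" using jx Fix_carrier by auto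
    have N: "Nm j x \<in> Units R" using x j Nm_eq_zero_iff Nm_closed by (simp add: field_Units)
    have orbc: "set_mset (orb j x) \<subseteq> carrier R - {\<zero>}"
      using x Q_pos by (auto simp: set_orb pow_eq_zero_iff')
    let ?A' = "{M. M \<in> inv_msets (n - j) \<and> mprod M = z \<otimes> inv (Nm j x)}"
    have prod: "mprod (orb j x + M) = z \<longleftrightarrow> mprod M = z \<otimes> inv (Nm j x)"
      if M: "set_mset M \<subseteq> carrier R" for M
    proof -
      have "mprod (orb j x + M) = mprod M \<otimes> Nm j x"
        using mprod_orb_plus[OF x(2) M] mprod_closed[OF M] N by (simp add: m_comm Units_closed)
      also have "\<dots> = z \<longleftrightarrow> mprod M = z \<otimes> inv (Nm j x)"
        using eq_mult_inv_iff[OF N mprod_closed[OF M] zc] by simp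
      finally show ?thesis .
    qed
    have "bij_betw (\<lambda>M. orb j x + M) ?A' {M. M \<in> ?A \<and> orb j x \<subseteq># M}"
    proof (rule bij_betw_byWitness[where f' = "\<lambda>M. M - orb j x"])
      show "(\<lambda>M. orb j x + M) ` ?A' \<subseteq> {M. M \<in> ?A \<and> orb j x \<subseteq># M}"
      proof (rule image_subsetI)
        fix M assume "M \<in> ?A'"
        then have M: "M \<in> inv_msets (n - j)" "mprod M = z \<otimes> inv (Nm j x)" by auto
        have "mprod (orb j x + M) = z" using prod[OF inv_msets_carrier[OF M(1)]] M by simp
        then show "orb j x + M \<in> {M. M \<in> ?A \<and> orb j x \<subseteq># M}"
          using M orbc j frob_orb[OF x(1)] by (auto simp: inv_msets_def size_orb)
      qed
      show "(\<lambda>M. M - orb j x) ` {M. M \<in> ?A \<and> orb j x \<subseteq># M} \<subseteq> ?A'"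
      proof (rule image_subsetI)
        fix M assume "M \<in> {M. M \<in> ?A \<and> orb j x \<subseteq># M}"
        then have M: "M \<in> inv_msets n" "mprod M = z" "orb j x \<subseteq># M" by auto
        then obtain M' where M': "M = orb j x + M'" by (auto simp: subset_mset.le_iff_add)
        have M'c: "set_mset M' \<subseteq> carrier R" using inv_msets_carrier[OF M(1)] by (simp add: M')
        have "M' \<in> inv_msets (n - j)"
          using M(1) frob_orb[OF x(1)] by (auto simp: M' inv_msets_def size_orb)
        moreover have "mprod M' = z \<otimes> inv (Nm j x)" using prod[OF M'c] M by (simp add: M')
        ultimately show "M - orb j x \<in> ?A'" by (simp add: M')
      qed
    qed auto
    then have "(\<Sum>M | M \<in> ?A \<and> orb j x \<subseteq># M. \<psi> (msum M)) = (\<Sum>M\<in>?A'. \<psi> (msum (orb j x + M)))"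
      by (rule sum.reindex_bij_betw[symmetric])
    also have "\<dots> = (\<Sum>M\<in>?A'. \<psi> (Tr j x) * \<psi> (msum M))"
      using msum_orb_plus[OF x(2) inv_msets_carrier] Tr_in_F[OF x(1)] msum_in_F
      by (intro sum.cong refl) (auto simp: \<psi>_add)
    finally show ?thesis by (simp add: wsum_def sum_distrib_left)
  qed
  have "of_nat n * wsum n z = (\<Sum>M\<in>?A. \<Sum>jx | jx \<in> ?B \<and> orb (fst jx) (snd jx) \<subseteq># M. \<psi> (msum M))"
    unfolding wsum_def sum_distrib_left
  proof (intro sum.cong refl)
    fix M assume "M \<in> ?A"
    then have "card {jx \<in> ?B. orb (fst jx) (snd jx) \<subseteq># M} = n"
      using card_orbits[of M n] by blast
    then show "of_nat n * \<psi> (msum M) = (\<Sum>jx | jx \<in> ?B \<and> orb (fst jx) (snd jx) \<subseteq># M. \<psi> (msum M))"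
      by simp
  qed
  also have "\<dots> = (\<Sum>jx\<in>?B. \<Sum>M | M \<in> ?A \<and> orb (fst jx) (snd jx) \<subseteq># M. \<psi> (msum M))"
    by (rule sum.swap_restrict[OF finA finB])
  also have "\<dots> = (\<Sum>jx\<in>?B. \<psi> (Tr (fst jx) (snd jx)) * wsum (n - fst jx) (z \<otimes> inv (Nm (fst jx) (snd jx))))"
  proof (intro sum.cong refl)
    fix jx assume "jx \<in> ?B"
    then show "(\<Sum>M | M \<in> ?A \<and> orb (fst jx) (snd jx) \<subseteq># M. \<psi> (msum M))
        = \<psi> (Tr (fst jx) (snd jx)) * wsum (n - fst jx) (z \<otimes> inv (Nm (fst jx) (snd jx)))"
      using inner[of "fst jx" "snd jx"] unfolding prod.collapse by blast
  qed
  also have "\<dots> = (\<Sum>j\<in>{1..n}. \<Sum>x\<in>Fix j - {\<zero>}. \<psi> (Tr j x) * wsum (n - j) (z \<otimes> inv (Nm j x)))"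
    using card_Fix(2) by (subst sum.Sigma) (auto simp: case_prod_unfold)
  finally show ?thesis .
qed

lemma Fs_closed:
  shows Fs_carrier: "x \<in> Fs \<Longrightarrow> x \<in> carrier R" and Fs_Units: "x \<in> Fs \<Longrightarrow> x \<in> Units R"
    and Fs_mult: "x \<in> Fs \<Longrightarrow> y \<in> Fs \<Longrightarrow> x \<otimes> y \<in> Fs" and Fs_inv: "x \<in> Fs \<Longrightarrow> inv x \<in> Fs"
    and Fs_minus: "x \<in> Fs \<Longrightarrow> \<ominus> x \<in> Fs" and Fs_one: "\<one> \<in> Fs" and Fs_F: "x \<in> Fs \<Longrightarrow> x \<in> F"
    and Fs_finite: "finite Fs" and Fs_nonzero: "x \<in> Fs \<Longrightarrow> x \<noteq> \<zero>"
proof -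
  show c: "x \<in> carrier R" if "x \<in> Fs" for x using that F_closed(1) by (simp add: Fs_def)
  show u: "x \<in> Units R" if "x \<in> Fs" for x using that c by (simp add: Fs_def field_Units)
  show "x \<otimes> y \<in> Fs" if "x \<in> Fs" "y \<in> Fs" for x y
    using that c F_closed by (simp add: Fs_def integral_iff)
  show "inv x \<in> Fs" if "x \<in> Fs" for x
    using that u[OF that] F_closed(7)[of x] Units_inv_Units[OF u[OF that]] by (simp add: Fs_def field_Units)
  show "\<ominus> x \<in> Fs" if "x \<in> Fs" for x
    using that c F_closed by (simp add: Fs_def)
  show "x \<in> F" if "x \<in> Fs" for x using that by (simp add: Fs_def)
  show "x \<noteq> \<zero>" if "x \<in> Fs" for x using that by (simp add: Fs_def)
qed (use F_closed finite_F in \<open>auto simp: Fs_def\<close>)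

lemma Nm_in_Fs: "x \<in> Fix d - {\<zero>} \<Longrightarrow> d > 0 \<Longrightarrow> Nm d x \<in> Fs"
  using Nm_in_F Nm_eq_zero_iff Fix_carrier by (auto simp: Fs_def)

lemma sum_over_norm_fibres:
  assumes "d > 0"
  shows "(\<Sum>x\<in>Fix d - {\<zero>}. f x) = (\<Sum>w\<in>Fs. \<Sum>x | x \<in> Fix d - {\<zero>} \<and> Nm d x = w. f x)"
proof -
  have "Nm d ` (Fix d - {\<zero>}) \<subseteq> Fs" using Nm_in_Fs[OF _ assms] by blast
  then show ?thesis
    using sum.group[of "Fix d - {\<zero>}" Fs "Nm d" f] card_Fix(2)[OF assms] Fs_finite by simp
qed

text \<open>The left side of Newton's identity vanishes for \<open>n \<ge> 2\<close>, and linearity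
  of the L-function leaves only \<open>j = n\<close> and \<open>j = n - 1\<close> on the right:
  \<open>wsum 0\<close> selects norm \<open>z\<close>, and \<open>wsum 1\<close> is
  \<open>\<psi>\<close>. The outcome is a convolution recursion; applying a multiplicative character
  and iterating yields the classical relation.\<close>

theorem davenport_hasse:
  assumes z: "z \<in> Fs" and n: "n \<ge> 2"
  shows "S n z = - (\<Sum>w\<in>Fs. S (n - 1) w * \<psi> (z \<otimes> inv w))"
proof -
  let ?T = "\<lambda>j. \<Sum>x\<in>Fix j - {\<zero>}. \<psi> (Tr j x) * wsum (n - j) (z \<otimes> inv (Nm j x))"
  have "0 = (\<Sum>j\<in>{1..n}. ?T j)"
    using newton_identity[OF z, of n] wsum_eq_0[OF n] by simp
  also have "\<dots> = (\<Sum>j\<in>{n - 1, n}. ?T j)"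
  proof (intro sum.mono_neutral_right ballI)
    fix j assume "j \<in> {1..n} - {n - 1, n}"
    then have "n - j \<ge> 2" by auto
    then show "?T j = 0" by (simp add: wsum_eq_0)
  qed (use n in auto)
  also have "\<dots> = ?T (n - 1) + ?T n" using n by simp
  also have "?T n = S n z"
  proof -
    have iff: "z \<otimes> inv (Nm n x) = \<one> \<longleftrightarrow> Nm n x = z" if x: "x \<in> Fix n - {\<zero>}" for x
    proof -
      have N: "Nm n x \<in> Fs" using Nm_in_Fs[OF x] n by simp
      show ?thesis
        using eq_mult_inv_iff[OF Fs_Units[OF N], of \<one> z] Fs_carrier[OF z] Fs_carrier[OF N] by auto
    qed
    have "?T n = (\<Sum>x\<in>Fix n - {\<zero>}. if Nm n x = z then \<psi> (Tr n x) else 0)"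
      using iff by (intro sum.cong refl) (simp add: wsum_0)
    also have "\<dots> = S n z"
      unfolding S_def using card_Fix(2)[of n] n by (intro sum.mono_neutral_cong_right) auto
    finally show ?thesis .
  qed
  also have "?T (n - 1) = (\<Sum>w\<in>Fs. S (n - 1) w * \<psi> (z \<otimes> inv w))"
  proof -
    have "?T (n - 1) = (\<Sum>x\<in>Fix (n - 1) - {\<zero>}. \<psi> (Tr (n - 1) x) * \<psi> (z \<otimes> inv (Nm (n - 1) x)))"
      using n z Nm_in_Fs[of _ "n - 1"] wsum_1 Fs_mult Fs_inv by (intro sum.cong refl) auto
    also have "\<dots> = (\<Sum>w\<in>Fs. \<Sum>x | x \<in> Fix (n - 1) - {\<zero>} \<and> Nm (n - 1) x = w.
        \<psi> (Tr (n - 1) x) * \<psi> (z \<otimes> inv (Nm (n - 1) x)))"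
      using n by (intro sum_over_norm_fibres) simp
    also have "\<dots> = (\<Sum>w\<in>Fs. S (n - 1) w * \<psi> (z \<otimes> inv w))"
      unfolding S_def sum_distrib_right by (intro sum.cong refl) auto
    finally show ?thesis .
  qed
  finally show ?thesis by (simp add: eq_neg_iff_add_eq_0 add.commute)
qed

end

context frobenius_character
begin

section \<open>Evaluation of the character sums\<close>

lemma Nm_1: "x \<in> carrier R \<Longrightarrow> Nm (Suc 0) x = x" and Tr_1: "x \<in> carrier R \<Longrightarrow> Tr (Suc 0) x = x"
  by (simp_all add: Nm_def geo_def)

lemma sum_\<psi>_Tr:
  assumes a: "a \<in> Fix d" and d: "d > 0"
  shows "(\<Sum>x\<in>Fix d. \<psi> (Tr d (a \<otimes> x))) = (if a = \<zero> then of_nat (Q ^ d) else 0)"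
proof (cases "a = \<zero>")
  case True
  then have "(\<Sum>x\<in>Fix d. \<psi> (Tr d (a \<otimes> x))) = (\<Sum>x\<in>Fix d. 1)"
    using Fix_carrier Tr_smult[OF F_closed(2) zero_closed, of d] Tr_closed[of \<zero> d]
    by (intro sum.cong refl) (auto simp: \<psi>_zero)
  then show ?thesis using True card_Fix[OF d] by simp
next
  case False
  obtain t where t: "t \<in> F" "\<psi> t \<noteq> 1" using \<psi>_nontrivial by blast
  obtain y where y: "y \<in> Fix d" "Tr d y = \<one>" using Tr_eq_one[OF d] by blast
  have ac: "a \<in> carrier R" "a \<in> Units R" using a False Fix_carrier by (auto simp: field_Units)
  have tF: "t \<in> Fix d" "t \<in> carrier R" using t F_subset_Fix F_closed(1) by auto
  have yc: "y \<in> carrier R" using y Fix_carrier by blast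
  \<comment> \<open>Chosen so that \<open>Tr d (a \<otimes> u) = t\<close>; translating the
    summation variable by \<open>u\<close> then multiplies the sum by
    \<open>\<psi> t \<noteq> 1\<close>.\<close>
  define u where "u = inv a \<otimes> (t \<otimes> y)"
  have u: "u \<in> Fix d" using a False tF y by (simp add: u_def Fix_closed)
  have "a \<otimes> u = t \<otimes> y" using ac tF yc by (simp add: u_def m_assoc[symmetric])
  then have Tru: "Tr d (a \<otimes> u) = t" using t tF y yc by (simp add: Tr_smult)
  have "bij_betw (\<lambda>x. x \<oplus> u) (Fix d) (Fix d)"
    by (rule bij_betw_byWitness[where f' = "\<lambda>x. x \<oplus> \<ominus> u"])
      (use u Fix_carrier in \<open>auto simp: Fix_closed a_assoc l_neg r_neg\<close>)
  then have "(\<Sum>x\<in>Fix d. \<psi> (Tr d (a \<otimes> x))) = (\<Sum>x\<in>Fix d. \<psi> (Tr d (a \<otimes> (x \<oplus> u))))"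
    by (rule sum.reindex_bij_betw[symmetric])
  also have "\<dots> = (\<Sum>x\<in>Fix d. \<psi> (Tr d (a \<otimes> x)) * \<psi> t)"
  proof (intro sum.cong refl)
    fix x assume x: "x \<in> Fix d"
    have "Tr d (a \<otimes> (x \<oplus> u)) = Tr d (a \<otimes> x) \<oplus> t"
      using x u ac Fix_carrier by (simp add: r_distr Tr_add Tru)
    then show "\<psi> (Tr d (a \<otimes> (x \<oplus> u))) = \<psi> (Tr d (a \<otimes> x)) * \<psi> t"
      using Tr_in_F[OF Fix_mult[OF a x]] t by (simp add: \<psi>_add)
  qed
  also have "\<dots> = (\<Sum>x\<in>Fix d. \<psi> (Tr d (a \<otimes> x))) * \<psi> t" by (simp add: sum_distrib_right)
  finally show ?thesis using t False by simp
qed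

lemma sum_\<psi>_Tr_nonzero:
  assumes a: "a \<in> Fix d" and d: "d > 0"
  shows "(\<Sum>x\<in>Fix d - {\<zero>}. \<psi> (Tr d (a \<otimes> x))) = (if a = \<zero> then of_nat (Q ^ d) else 0) - 1"
proof -
  have "Tr d (a \<otimes> \<zero>) = \<zero>"
    using a Fix_carrier Tr_smult[OF F_closed(2) zero_closed, of d] Tr_closed[of \<zero> d] by simp
  then show ?thesis
    using sum_\<psi>_Tr[OF assms] card_Fix(2)[OF d] Fix_zero[of d]
    by (simp add: sum_diff1 \<psi>_zero)
qed

lemma sum_\<psi>_Fs:
  assumes "c \<in> F"
  shows "(\<Sum>v\<in>Fs. \<psi> (c \<otimes> v)) = (if c = \<zero> then of_nat Q else 0) - 1"
proof -
  have "(\<Sum>v\<in>Fs. \<psi> (c \<otimes> v)) = (\<Sum>v\<in>Fix 1 - {\<zero>}. \<psi> (Tr 1 (c \<otimes> v)))"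
    using assms F_closed(1) unfolding Fs_def F_eq_Fix
    by (intro sum.cong refl) (auto simp: Tr_1 Fix_carrier)
  then show ?thesis using sum_\<psi>_Tr_nonzero[of c 1] assms by (simp add: F_eq_Fix)
qed

lemma sum_S:
  assumes "d > 0"
  shows "(\<Sum>v\<in>Fs. S d v) = - 1"
proof -
  have "(\<Sum>v\<in>Fs. S d v) = (\<Sum>x\<in>Fix d - {\<zero>}. \<psi> (Tr d x))"
    unfolding S_def by (rule sum_over_norm_fibres[OF assms, symmetric])
  also have "\<dots> = (\<Sum>x\<in>Fix d - {\<zero>}. \<psi> (Tr d (\<one> \<otimes> x)))"
    using Fix_carrier by (intro sum.cong refl) auto
  finally show ?thesis using sum_\<psi>_Tr_nonzero[OF Fix_one assms] by simp
qed

lemma S_1: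
  assumes "v \<in> Fs"
  shows "S (Suc 0) v = \<psi> v"
proof -
  have "{x. x \<in> Fix (Suc 0) - {\<zero>} \<and> Nm (Suc 0) x = v} = {v}"
    using assms Fix_carrier Nm_1 unfolding Fs_def F_eq_Fix by auto
  then show ?thesis using assms Fs_carrier by (simp add: S_def Tr_1)
qed

text \<open>The product is an additive character in \<open>v\<close> with coefficient
  \<open>inv a \<oplus> w \<otimes> inv b\<close>, which vanishes exactly at
  \<open>b = \<ominus> w \<otimes> a\<close>. This is the group-ring form of the absolute value
  formula for Gauss sums.\<close>

lemma \<psi>_mult_sum:
  assumes a: "a \<in> Fs" and b: "b \<in> Fs" and w: "w \<in> Fs"
  shows "(\<Sum>v\<in>Fs. \<psi> (v \<otimes> inv a) * \<psi> (w \<otimes> v \<otimes> inv b))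
    = (if b = \<ominus> w \<otimes> a then of_nat Q else 0) - 1"
proof -
  let ?c = "inv a \<oplus> w \<otimes> inv b"
  have ia: "inv a \<in> Fs" "inv a \<in> carrier R" and ib: "inv b \<in> Fs" "inv b \<in> carrier R"
    using a b Fs_inv Fs_carrier by auto
  note c = Fs_carrier[OF a] Fs_carrier[OF b] Fs_carrier[OF w]
  have F: "?c \<in> F" using ia ib w Fs_F Fs_mult F_closed(4) by auto
  have "(\<Sum>v\<in>Fs. \<psi> (v \<otimes> inv a) * \<psi> (w \<otimes> v \<otimes> inv b)) = (\<Sum>v\<in>Fs. \<psi> (?c \<otimes> v))"
  proof (intro sum.cong refl)
    fix v assume v: "v \<in> Fs"
    have "?c \<otimes> v = v \<otimes> inv a \<oplus> w \<otimes> v \<otimes> inv b"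
      using ia ib c Fs_carrier[OF v] by (simp add: l_distr r_distr m_ac)
    then show "\<psi> (v \<otimes> inv a) * \<psi> (w \<otimes> v \<otimes> inv b) = \<psi> (?c \<otimes> v)"
      using v w ia ib Fs_mult Fs_F by (simp add: \<psi>_add)
  qed
  moreover have "?c = \<zero> \<longleftrightarrow> b = \<ominus> w \<otimes> a"
  proof -
    have "?c = \<zero> \<longleftrightarrow> inv a = \<ominus> w \<otimes> inv b"
      using ia ib c by (metis add.inv_equality add.r_inv l_minus m_closed minus_minus a_inv_closed a_comm)
    also have "\<dots> \<longleftrightarrow> inv a \<otimes> b = \<ominus> w"
      using eq_mult_inv_iff[OF Fs_Units[OF b] ia(2)] c by simp
    also have "\<dots> \<longleftrightarrow> \<ominus> w = b \<otimes> inv a" using c ia by (auto simp: m_comm)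
    also have "\<dots> \<longleftrightarrow> \<ominus> w \<otimes> a = b"
      using eq_mult_inv_iff[OF Fs_Units[OF a], of "\<ominus> w" b] c by simp
    finally show ?thesis by auto
  qed
  ultimately show ?thesis using sum_\<psi>_Fs[OF F] by simp
qed

text \<open>The coefficient at \<open>w\<close> of the Gauss sum of degree \<open>Suc l\<close>
  times the inverted Gauss sum of degree \<open>l\<close>.\<close>

definition T :: "nat \<Rightarrow> 'a \<Rightarrow> complex" where
  "T l w = (\<Sum>v\<in>Fs. S l v * S (Suc l) (w \<otimes> v))"

lemma T_1:
  assumes w: "w \<in> Fs"
  shows "T (Suc 0) w = - of_nat Q * \<psi> (\<ominus> w) - 1"
proof -
  have "T (Suc 0) w = (\<Sum>v\<in>Fs. \<psi> v * - (\<Sum>b\<in>Fs. \<psi> b * \<psi> (w \<otimes> v \<otimes> inv b)))"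
    unfolding T_def
    using davenport_hasse[OF Fs_mult[OF w], of _ 2] S_1 by (intro sum.cong refl) (simp add: numeral_2_eq_2)
  \<comment> \<open>Writing \<open>v\<close> as \<open>v \<otimes> inv \<one>\<close> lets
    \<open>\<psi>_mult_sum\<close> apply with \<open>a = \<one>\<close>.\<close>
  also have "\<dots> = - (\<Sum>b\<in>Fs. \<psi> b * (\<Sum>v\<in>Fs. \<psi> (v \<otimes> inv \<one>) * \<psi> (w \<otimes> v \<otimes> inv b)))"
    unfolding sum_distrib_left sum_negf[symmetric]
    by (subst sum.swap) (intro sum.cong refl, simp add: Fs_carrier sum_distrib_left)
  also have "\<dots> = - (\<Sum>b\<in>Fs. \<psi> b * ((if b = \<ominus> w then of_nat Q else 0) - 1))"
    using \<psi>_mult_sum[OF Fs_one _ w] Fs_carrier[OF w] by (intro arg_cong[where f = uminus] sum.cong refl) simp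
  also have "\<dots> = - (\<Sum>b\<in>Fs. (if b = \<ominus> w then \<psi> b * of_nat Q else 0) - \<psi> b)"
    by (intro arg_cong[where f = uminus] sum.cong refl) (simp add: algebra_simps)
  also have "\<dots> = - (\<psi> (\<ominus> w) * of_nat Q) + (\<Sum>b\<in>Fs. \<psi> b)"
    using Fs_finite Fs_minus[OF w] by (simp add: sum_subtractf sum.delta)
  also have "(\<Sum>b\<in>Fs. \<psi> b) = (\<Sum>b\<in>Fs. \<psi> (\<one> \<otimes> b))" using Fs_carrier by (intro sum.cong refl) simp
  also have "\<dots> = - 1" using sum_\<psi>_Fs[OF F_closed(3)] by simp
  finally show ?thesis by (simp add: mult.commute)
qed

text \<open>By Davenport--Hasse both factors split off one \<open>\<psi>\<close>, and the two signs
  cancel. The pair of \<open>\<psi>\<close> collapses by \<open>\<psi>_mult_sum\<close>: the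
  diagonal \<open>b = \<ominus> w \<otimes> a\<close> yields \<open>Q\<close> times the previous
  level, and the constant \<open>- 1\<close> multiplies two total sums that are both
  \<open>- 1\<close>.\<close>

lemma T_Suc:
  assumes w: "w \<in> Fs" and l: "l > 0"
  shows "T (Suc l) w = of_nat Q * T l (\<ominus> w) - 1"
proof -
  have "T (Suc l) w = (\<Sum>v\<in>Fs. (\<Sum>a\<in>Fs. S l a * \<psi> (v \<otimes> inv a)) *
      (\<Sum>b\<in>Fs. S (Suc l) b * \<psi> (w \<otimes> v \<otimes> inv b)))"
    unfolding T_def
  proof (intro sum.cong refl)
    fix v assume v: "v \<in> Fs"
    show "S (Suc l) v * S (Suc (Suc l)) (w \<otimes> v) = (\<Sum>a\<in>Fs. S l a * \<psi> (v \<otimes> inv a)) *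
      (\<Sum>b\<in>Fs. S (Suc l) b * \<psi> (w \<otimes> v \<otimes> inv b))"
      using davenport_hasse[OF v, of "Suc l"] davenport_hasse[OF Fs_mult[OF w v], of "Suc (Suc l)"] l
      by simp
  qed
  also have "\<dots> = (\<Sum>v\<in>Fs. \<Sum>a\<in>Fs. \<Sum>b\<in>Fs. S l a * S (Suc l) b * (\<psi> (v \<otimes> inv a) * \<psi> (w \<otimes> v \<otimes> inv b)))"
    unfolding sum_product by (intro sum.cong refl) (simp add: algebra_simps)
  also have "\<dots> = (\<Sum>a\<in>Fs. \<Sum>v\<in>Fs. \<Sum>b\<in>Fs. S l a * S (Suc l) b * (\<psi> (v \<otimes> inv a) * \<psi> (w \<otimes> v \<otimes> inv b)))"
    by (rule sum.swap)
  also have "\<dots> = (\<Sum>a\<in>Fs. \<Sum>b\<in>Fs. \<Sum>v\<in>Fs. S l a * S (Suc l) b * (\<psi> (v \<otimes> inv a) * \<psi> (w \<otimes> v \<otimes> inv b)))"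
    by (intro sum.cong refl sum.swap)
  also have "\<dots> = (\<Sum>a\<in>Fs. \<Sum>b\<in>Fs. S l a * S (Suc l) b * ((if b = \<ominus> w \<otimes> a then of_nat Q else 0) - 1))"
    unfolding sum_distrib_left[symmetric] using \<psi>_mult_sum[OF _ _ w] by (intro sum.cong refl) simp
  also have "\<dots> = (\<Sum>a\<in>Fs. \<Sum>b\<in>Fs. (if b = \<ominus> w \<otimes> a then of_nat Q * (S l a * S (Suc l) b) else 0)
      - S l a * S (Suc l) b)"
    by (intro sum.cong refl) (simp add: algebra_simps)
  also have "\<dots> = (\<Sum>a\<in>Fs. of_nat Q * (S l a * S (Suc l) (\<ominus> w \<otimes> a)) - S l a * (\<Sum>b\<in>Fs. S (Suc l) b))"
    using Fs_finite Fs_mult[OF Fs_minus[OF w]]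
    by (intro sum.cong refl) (simp add: sum_subtractf sum.delta sum_distrib_left)
  also have "\<dots> = of_nat Q * T l (\<ominus> w) - (\<Sum>a\<in>Fs. S l a) * (\<Sum>b\<in>Fs. S (Suc l) b)"
    by (simp add: T_def sum_subtractf sum_distrib_left[symmetric] sum_distrib_right[symmetric])
  finally show ?thesis using sum_S[OF l] sum_S[of "Suc l"] by simp
qed

lemma neg_one_pow_Fs: "(\<ominus> \<one>) [^] (l::nat) \<in> Fs"
  by (induction l) (auto simp: Fs_closed)

text \<open>The constant obeys \<open>c (Suc l) = Q * c l + 1\<close>, hence is
  \<open>geo l\<close>; every step negates \<open>w\<close>, hence the power of
  \<open>\<ominus> \<one>\<close>.\<close>

lemma T_eq:
  assumes "w \<in> Fs" "l > 0"
  shows "T l w = - of_nat (geo l) - of_nat (Q ^ l) * \<psi> ((\<ominus> \<one>) [^] l \<otimes> w)"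
  using assms(2,1)
proof (induction l arbitrary: w rule: nat_induct_non_zero)
  case 1
  then show ?case using Fs_carrier by (simp add: T_1 l_minus geo_def)
next
  case (Suc l)
  have "(\<ominus> \<one>) [^] l \<otimes> \<ominus> w = (\<ominus> \<one>) [^] Suc l \<otimes> w"
    using Fs_carrier[OF Suc.prems] by (simp add: m_assoc l_minus)
  then have eq: "T (Suc l) w = of_nat Q * (- of_nat (geo l) - of_nat (Q ^ l) * \<psi> ((\<ominus> \<one>) [^] Suc l \<otimes> w)) - 1"
    using T_Suc[OF Suc.prems] Suc Fs_minus by simp
  show ?case unfolding eq by (simp add: geo_Suc algebra_simps)
qed

text \<open>Substituting \<open>a \<otimes> x\<close> for \<open>x\<close> shows that a character
  restricted to norm fibres depends on \<open>a\<close> only through the norm of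
  \<open>a\<close>.\<close>

lemma S_scaled:
  assumes a: "a \<in> Fix d - {\<zero>}" and v: "v \<in> Fs" and d: "d > 0"
  shows "(\<Sum>x | x \<in> Fix d - {\<zero>} \<and> Nm d x = v. \<psi> (Tr d (a \<otimes> x))) = S d (Nm d a \<otimes> v)"
proof -
  have ac: "a \<in> carrier R" "a \<in> Units R" using a Fix_carrier by (auto simp: field_Units)
  have N: "Nm d a \<in> Fs" using Nm_in_Fs[OF a d] .
  have ia: "inv a \<in> Fix d" "inv a \<in> carrier R" "inv a \<noteq> \<zero>"
    using a ac Fix_inv Units_inv_Units[OF ac(2)] by (auto simp: field_Units)
  have Nia: "Nm d (inv a) \<otimes> Nm d a = \<one>"
    using ac ia Nm_mult[of "inv a" a d] by (simp add: Nm_def)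
  have "bij_betw (\<lambda>x. a \<otimes> x) {x. x \<in> Fix d - {\<zero>} \<and> Nm d x = v}
      {x. x \<in> Fix d - {\<zero>} \<and> Nm d x = Nm d a \<otimes> v}"
  proof (rule bij_betw_byWitness[where f' = "\<lambda>x. inv a \<otimes> x"])
    show "(\<lambda>x. inv a \<otimes> x) ` {x. x \<in> Fix d - {\<zero>} \<and> Nm d x = Nm d a \<otimes> v}
        \<subseteq> {x. x \<in> Fix d - {\<zero>} \<and> Nm d x = v}"
      using ia Nia N v Fix_carrier Fs_carrier Nm_closed[OF ia(2), of d]
      by (auto simp: Fix_mult Nm_mult integral_iff m_assoc[symmetric])
  qed (use a ac ia Fix_carrier in \<open>auto simp: Fix_mult Nm_mult integral_iff m_assoc[symmetric]\<close>)
  then show ?thesis unfolding S_def by (rule sum.reindex_bij_betw)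
qed

section \<open>The partial difference set\<close>

text \<open>If \<open>\<zero> \<in> U\<close>, all points with \<open>y = \<zero>\<close> belong to
  it; for \<open>U = {\<zero>}\<close> there are no others, which is the case
  \<open>r = 0\<close>.\<close>

definition Dset :: "nat \<Rightarrow> 'a set \<Rightarrow> ('a \<times> 'a) set" where
  "Dset l U = {(x, y). x \<in> Fix l - {\<zero>} \<and> y \<in> Fix (Suc l) \<and> Nm (Suc l) y \<otimes> inv (Nm l x) \<in> U}"

text \<open>Points are sorted by the ratio \<open>c\<close> of the two norms:
  \<open>c = \<zero>\<close> forces \<open>y = \<zero>\<close>, any other \<open>c\<close> gives a
  norm fibre. The summand is a product because every character of the ambient group splits this
  way.\<close>

lemma sum_Dset:
  fixes f g :: "'a \<Rightarrow> complex"
  assumes l: "l > 0" and U: "U \<subseteq> F" "\<zero> \<in> U"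
  shows "(\<Sum>(x, y)\<in>Dset l U. f x * g y) = (\<Sum>x\<in>Fix l - {\<zero>}. f x) * g \<zero>
    + (\<Sum>c\<in>U - {\<zero>}. \<Sum>x\<in>Fix l - {\<zero>}. f x *
        (\<Sum>y | y \<in> Fix (Suc l) - {\<zero>} \<and> Nm (Suc l) y = c \<otimes> Nm l x. g y))"
proof -
  let ?K = "Fix l - {\<zero>}" and ?L = "Fix (Suc l) - {\<zero>}"
  have fin: "finite ?K" "finite ?L" "finite (Fix (Suc l))" using card_Fix(2) l by auto
  have finU: "finite (U - {\<zero>})" using U finite_F finite_subset by auto
  have iff: "Nm (Suc l) y = c \<otimes> Nm l x \<longleftrightarrow> Nm (Suc l) y \<otimes> inv (Nm l x) = c"
    if "x \<in> ?K" "y \<in> Fix (Suc l)" "c \<in> U" for x y c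
    using eq_mult_inv_iff[OF Fs_Units[OF Nm_in_Fs[OF that(1) l]], of c "Nm (Suc l) y"]
      that U F_closed(1) Nm_closed[OF Fix_carrier[OF that(2)]] by auto
  have row: "(\<Sum>y | y \<in> Fix (Suc l) \<and> Nm (Suc l) y \<otimes> inv (Nm l x) \<in> U. g y)
      = g \<zero> + (\<Sum>c\<in>U - {\<zero>}. \<Sum>y | y \<in> ?L \<and> Nm (Suc l) y = c \<otimes> Nm l x. g y)"
    if x: "x \<in> ?K" for x
  proof -
    have Nx: "Nm l x \<in> Fs" using Nm_in_Fs[OF x l] .
    let ?Y = "{y \<in> ?L. Nm (Suc l) y \<otimes> inv (Nm l x) \<in> U}"
    have "Nm (Suc l) \<zero> = \<zero>" using Nm_eq_zero_iff[of \<zero> "Suc l"] by simp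
    then have "{y. y \<in> Fix (Suc l) \<and> Nm (Suc l) y \<otimes> inv (Nm l x) \<in> U} = insert \<zero> ?Y"
      using U Fix_zero Fs_carrier[OF Fs_inv[OF Nx]] by auto
    then have "(\<Sum>y | y \<in> Fix (Suc l) \<and> Nm (Suc l) y \<otimes> inv (Nm l x) \<in> U. g y) = g \<zero> + sum g ?Y"
      using fin by simp
    also have "sum g ?Y = (\<Sum>c\<in>U - {\<zero>}. \<Sum>y | y \<in> ?Y \<and> Nm (Suc l) y \<otimes> inv (Nm l x) = c. g y)"
    proof (rule sum.group[symmetric])
      show "(\<lambda>y. Nm (Suc l) y \<otimes> inv (Nm l x)) ` ?Y \<subseteq> U - {\<zero>}"
      proof (rule image_subsetI)
        fix y assume y: "y \<in> ?Y"
        have "Nm (Suc l) y \<in> Fs" using Nm_in_Fs[of y "Suc l"] y by simp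
        then show "Nm (Suc l) y \<otimes> inv (Nm l x) \<in> U - {\<zero>}"
          using y Fs_nonzero[OF Fs_mult[OF _ Fs_inv[OF Nx]]] by auto
      qed
    qed (use fin finU in auto)
    also have "\<dots> = (\<Sum>c\<in>U - {\<zero>}. \<Sum>y | y \<in> ?L \<and> Nm (Suc l) y = c \<otimes> Nm l x. g y)"
      using iff[OF x] by (intro sum.cong refl) auto
    finally show ?thesis .
  qed
  have "Dset l U = Sigma ?K (\<lambda>x. {y. y \<in> Fix (Suc l) \<and> Nm (Suc l) y \<otimes> inv (Nm l x) \<in> U})"
    by (auto simp: Dset_def)
  then have "(\<Sum>(x, y)\<in>Dset l U. f x * g y)
      = (\<Sum>x\<in>?K. \<Sum>y | y \<in> Fix (Suc l) \<and> Nm (Suc l) y \<otimes> inv (Nm l x) \<in> U. f x * g y)"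
    using fin by (simp add: sum.Sigma)
  also have "\<dots> = (\<Sum>x\<in>?K. f x * (\<Sum>y | y \<in> Fix (Suc l) \<and> Nm (Suc l) y \<otimes> inv (Nm l x) \<in> U. g y))"
    by (simp add: sum_distrib_left)
  also have "\<dots> = (\<Sum>x\<in>?K. f x * g \<zero> + (\<Sum>c\<in>U - {\<zero>}. f x *
        (\<Sum>y | y \<in> ?L \<and> Nm (Suc l) y = c \<otimes> Nm l x. g y)))"
    using row by (intro sum.cong refl) (simp add: distrib_left sum_distrib_left)
  also have "\<dots> = (\<Sum>x\<in>?K. f x) * g \<zero> + (\<Sum>x\<in>?K. \<Sum>c\<in>U - {\<zero>}. f x *
        (\<Sum>y | y \<in> ?L \<and> Nm (Suc l) y = c \<otimes> Nm l x. g y))"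
    by (simp add: sum.distrib sum_distrib_right)
  also have "(\<Sum>x\<in>?K. \<Sum>c\<in>U - {\<zero>}. f x * (\<Sum>y | y \<in> ?L \<and> Nm (Suc l) y = c \<otimes> Nm l x. g y))
      = (\<Sum>c\<in>U - {\<zero>}. \<Sum>x\<in>?K. f x * (\<Sum>y | y \<in> ?L \<and> Nm (Suc l) y = c \<otimes> Nm l x. g y))"
    by (rule sum.swap)
  finally show ?thesis .
qed

text \<open>Orthogonality on \<open>U\<close> of the character \<open>\<psi> (c \<otimes> k)\<close>
  of \<open>c\<close>: this dichotomy is where the two eigenvalues come from.\<close>

lemma sum_subgroup:
  assumes U: "U \<subseteq> F" "\<zero> \<in> U" "\<And>x y. x \<in> U \<Longrightarrow> y \<in> U \<Longrightarrow> x \<oplus> y \<in> U" "\<And>x. x \<in> U \<Longrightarrow> \<ominus> x \<in> U"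
    and k: "k \<in> F"
  shows "(\<Sum>c\<in>U. \<psi> (c \<otimes> k)) \<in> {0, of_nat (card U)}"
proof (cases "\<forall>c\<in>U. \<psi> (c \<otimes> k) = 1")
  case True
  then show ?thesis by simp
next
  case False
  then obtain t where t: "t \<in> U" "\<psi> (t \<otimes> k) \<noteq> 1" by blast
  have c: "x \<in> carrier R" if "x \<in> U" for x using that U F_closed(1) by blast
  have kc: "k \<in> carrier R" using k F_closed(1) by blast
  have "bij_betw (\<lambda>x. x \<oplus> t) U U"
    by (rule bij_betw_byWitness[where f' = "\<lambda>x. x \<oplus> \<ominus> t"])
      (use U t c in \<open>auto simp: a_assoc l_neg r_neg\<close>)
  then have "(\<Sum>x\<in>U. \<psi> (x \<otimes> k)) = (\<Sum>x\<in>U. \<psi> ((x \<oplus> t) \<otimes> k))"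
    by (rule sum.reindex_bij_betw[symmetric])
  also have "\<dots> = (\<Sum>x\<in>U. \<psi> (x \<otimes> k) * \<psi> (t \<otimes> k))"
  proof (intro sum.cong refl)
    fix x assume x: "x \<in> U"
    then have "x \<in> F" "t \<in> F" using U t by auto
    then show "\<psi> ((x \<oplus> t) \<otimes> k) = \<psi> (x \<otimes> k) * \<psi> (t \<otimes> k)"
      using c[OF x] c[OF t(1)] kc k by (simp add: l_distr \<psi>_add F_closed(6))
  qed
  also have "\<dots> = (\<Sum>x\<in>U. \<psi> (x \<otimes> k)) * \<psi> (t \<otimes> k)" by (simp add: sum_distrib_right)
  finally show ?thesis using t by simp
qed

section \<open>Eigenvalues and parameters of \<open>Dset l U\<close>\<close>

context
  fixes l :: nat and U :: "'a set" and A B :: nat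
  assumes l: "l > 0"
    and U: "U \<subseteq> F" "\<zero> \<in> U" "\<And>x y. x \<in> U \<Longrightarrow> y \<in> U \<Longrightarrow> x \<oplus> y \<in> U" "\<And>x. x \<in> U \<Longrightarrow> \<ominus> x \<in> U"
  defines "A \<equiv> (card U - 1) * geo l" and "B \<equiv> (card U - 1) * geo (Suc l)"
begin

lemma finite_U: "finite U"
  using U(1) finite_F by (rule finite_subset)

lemma card_U_pos: "card U > 0"
  using U(2) finite_U by (auto simp: card_gt_0_iff)

lemma card_U_minus: "card (U - {\<zero>}) = card U - 1"
  using U(2) finite_U by simp

lemma U_nonzero_Fs: "c \<in> U - {\<zero>} \<Longrightarrow> c \<in> Fs"
  using U(1) by (auto simp: Fs_def)

text \<open>Every nonzero \<open>x\<close> has the partner \<open>y = \<zero>\<close> and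
  \<open>B\<close> nonzero partners. A nontrivial character of the first factor thus gives
  \<open>- (1 + B)\<close>, and the constant function 1 gives the cardinality.\<close>

lemma sum_Dset_left:
  fixes f :: "'a \<Rightarrow> complex"
  shows "(\<Sum>(x, y)\<in>Dset l U. f x * 1) = (\<Sum>x\<in>Fix l - {\<zero>}. f x) * (1 + of_nat B)"
proof -
  have "(\<Sum>(x, y)\<in>Dset l U. f x * 1) = (\<Sum>x\<in>Fix l - {\<zero>}. f x)
    + (\<Sum>c\<in>U - {\<zero>}. \<Sum>x\<in>Fix l - {\<zero>}. f x * of_nat (geo (Suc l)))"
    using card_norm_fibre[of _ "Suc l"] Fs_mult[OF U_nonzero_Fs Nm_in_Fs[OF _ l]]
    unfolding sum_Dset[OF l U(1,2), of f "\<lambda>_. 1"]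
    by (intro arg_cong2[where f = "(+)"] sum.cong refl) (auto simp: Fs_def)
  moreover have "(of_nat B :: complex) = of_nat (card U - Suc 0) * of_nat (geo (Suc l))"
    unfolding B_def by (simp only: of_nat_mult One_nat_def)
  ultimately show ?thesis
    by (simp add: card_U_minus algebra_simps sum_distrib_right[symmetric])
qed

text \<open>Dually, every nonzero \<open>y\<close> has \<open>A\<close> partners \<open>x\<close>
  and these \<open>y\<close> contribute \<open>- A\<close> in total, while
  \<open>y = \<zero>\<close> is paired with all \<open>Q ^ l - 1\<close> nonzero
  \<open>x\<close>.\<close>

lemma sum_Dset_right:
  assumes b: "b \<in> Fix (Suc l)" "b \<noteq> \<zero>"
  shows "(\<Sum>(x, y)\<in>Dset l U. 1 * \<psi> (Tr (Suc l) (b \<otimes> y))) = of_nat (Q ^ l) - 1 - of_nat A"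
proof -
  let ?K = "Fix l - {\<zero>}" and ?L = "Fix (Suc l) - {\<zero>}" and ?g = "\<lambda>y. \<psi> (Tr (Suc l) (b \<otimes> y))"
  have fin: "finite ?K" "finite ?L" using card_Fix(2) l by auto
  have g0: "?g \<zero> = 1"
    using b Fix_carrier Tr_smult[OF F_closed(2) zero_closed, of "Suc l"] Tr_closed[of \<zero> "Suc l"] \<psi>_zero
    by simp
  have "(\<Sum>x\<in>?K. 1 * (\<Sum>y | y \<in> ?L \<and> Nm (Suc l) y = c \<otimes> Nm l x. ?g y)) = - of_nat (geo l)"
    if c: "c \<in> U - {\<zero>}" for c
  proof -
    have cF: "c \<in> Fs" using U_nonzero_Fs[OF c] .
    have "(\<Sum>x\<in>?K. 1 * (\<Sum>y | y \<in> ?L \<and> Nm (Suc l) y = c \<otimes> Nm l x. ?g y))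
        = (\<Sum>y\<in>?L. \<Sum>x | x \<in> ?K \<and> Nm (Suc l) y = c \<otimes> Nm l x. ?g y)"
      unfolding mult_1 by (rule sum.swap_restrict[OF fin])
    also have "\<dots> = (\<Sum>y\<in>?L. of_nat (geo l) * ?g y)"
    proof (intro sum.cong refl)
      fix y assume y: "y \<in> ?L"
      have Ny: "Nm (Suc l) y \<in> Fs" using Nm_in_Fs[OF y] by simp
      have "{x. x \<in> ?K \<and> Nm (Suc l) y = c \<otimes> Nm l x} = {x \<in> ?K. Nm l x = Nm (Suc l) y \<otimes> inv c}"
      proof -
        have "Nm (Suc l) y = c \<otimes> Nm l x \<longleftrightarrow> Nm l x = Nm (Suc l) y \<otimes> inv c" if "x \<in> ?K" for x
          using eq_mult_inv_iff[OF Fs_Units[OF cF], of "Nm l x" "Nm (Suc l) y"]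
            Fs_carrier[OF Nm_in_Fs[OF that l]] Fs_carrier[OF Ny] Fs_carrier[OF cF]
          by (auto simp: m_comm)
        then show ?thesis by auto
      qed
      moreover have "card {x \<in> ?K. Nm l x = Nm (Suc l) y \<otimes> inv c} = geo l"
        using card_norm_fibre[OF _ _ l] Fs_mult[OF Ny Fs_inv[OF cF]] by (simp add: Fs_def)
      ultimately show "(\<Sum>x | x \<in> ?K \<and> Nm (Suc l) y = c \<otimes> Nm l x. ?g y) = of_nat (geo l) * ?g y"
        by simp
    qed
    also have "\<dots> = - of_nat (geo l)"
      using sum_\<psi>_Tr_nonzero[OF b(1)] b(2) by (simp add: sum_distrib_left[symmetric] del: Tr.simps)
    finally show ?thesis .
  qed
  then have "(\<Sum>(x, y)\<in>Dset l U. 1 * ?g y) = of_nat (card ?K) + (\<Sum>c\<in>U - {\<zero>}. - of_nat (geo l))"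
    unfolding sum_Dset[OF l U(1,2), of "\<lambda>_. 1" ?g] by (simp add: g0 del: Tr.simps)
  also have "card ?K = Q ^ l - 1" using card_Fix[OF l] Fix_zero by simp
  finally show ?thesis
    using Q_pos by (simp add: card_U_minus A_def of_nat_diff Suc_le_eq del: Tr.simps)
qed

text \<open>For each nonzero \<open>c\<close> the sum over one ratio becomes
  \<open>T l (c \<otimes> k)\<close>, where \<open>k\<close> is the ratio of the norms of
  \<open>b\<close> and \<open>a\<close>. By \<open>T_eq\<close> it is affine in
  \<open>\<psi> (c \<otimes> k')\<close>, so only the sum of that character over \<open>U\<close>
  remains.\<close>

lemma sum_Dset_both:
  assumes a: "a \<in> Fix l" "a \<noteq> \<zero>" and b: "b \<in> Fix (Suc l)" "b \<noteq> \<zero>"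
  shows "(\<Sum>(x, y)\<in>Dset l U. \<psi> (Tr l (a \<otimes> x)) * \<psi> (Tr (Suc l) (b \<otimes> y)))
    \<in> {- 1 - of_nat B, of_nat (Q ^ l) - 1 - of_nat A}"
proof -
  let ?K = "Fix l - {\<zero>}" and ?L = "Fix (Suc l) - {\<zero>}"
  let ?f = "\<lambda>x. \<psi> (Tr l (a \<otimes> x))" and ?g = "\<lambda>y. \<psi> (Tr (Suc l) (b \<otimes> y))"
  have g0: "?g \<zero> = 1"
    using b Fix_carrier Tr_smult[OF F_closed(2) zero_closed, of "Suc l"] Tr_closed[of \<zero> "Suc l"] \<psi>_zero
    by simp
  have aK: "a \<in> ?K" and bL: "b \<in> ?L" using a b by auto
  have Na: "Nm l a \<in> Fs" and Nb: "Nm (Suc l) b \<in> Fs" using Nm_in_Fs[OF aK l] Nm_in_Fs[OF bL] by auto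
  define k where "k = Nm (Suc l) b \<otimes> inv (Nm l a)"
  have k: "k \<in> Fs" using Na Nb by (simp add: k_def Fs_closed)
  define k' where "k' = (\<ominus> \<one>) [^] l \<otimes> k"
  have k': "k' \<in> Fs" using k neg_one_pow_Fs by (simp add: k'_def Fs_mult)
  have inner: "(\<Sum>x\<in>?K. ?f x * (\<Sum>y | y \<in> ?L \<and> Nm (Suc l) y = c \<otimes> Nm l x. ?g y))
      = - of_nat (geo l) - of_nat (Q ^ l) * \<psi> (c \<otimes> k')" if c: "c \<in> U - {\<zero>}" for c
  proof -
    have cF: "c \<in> Fs" using U_nonzero_Fs[OF c] .
    note cc = Fs_carrier[OF cF] Fs_carrier[OF Na] Fs_carrier[OF Nb] Fs_carrier[OF Fs_inv[OF Na]]
    have "(\<Sum>x\<in>?K. ?f x * (\<Sum>y | y \<in> ?L \<and> Nm (Suc l) y = c \<otimes> Nm l x. ?g y))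
        = (\<Sum>v\<in>Fs. \<Sum>x | x \<in> ?K \<and> Nm l x = v. ?f x * (\<Sum>y | y \<in> ?L \<and> Nm (Suc l) y = c \<otimes> Nm l x. ?g y))"
      by (rule sum_over_norm_fibres[OF l])
    also have "\<dots> = (\<Sum>v\<in>Fs. (\<Sum>x | x \<in> ?K \<and> Nm l x = v. ?f x)
        * (\<Sum>y | y \<in> ?L \<and> Nm (Suc l) y = c \<otimes> v. ?g y))"
      unfolding sum_distrib_right by (intro sum.cong refl) (auto simp del: Tr.simps)
    also have "\<dots> = (\<Sum>v\<in>Fs. S l (Nm l a \<otimes> v) * S (Suc l) (Nm (Suc l) b \<otimes> (c \<otimes> v)))"
      by (intro sum.cong refl arg_cong2[where f = "(*)"] S_scaled aK bL l Fs_mult cF) auto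
    also have "\<dots> = (\<Sum>v\<in>Fs. S l (Nm l a \<otimes> v) * S (Suc l) ((c \<otimes> k) \<otimes> (Nm l a \<otimes> v)))"
    proof (intro sum.cong refl)
      fix v assume v: "v \<in> Fs"
      have "(c \<otimes> k) \<otimes> (Nm l a \<otimes> v) = Nm (Suc l) b \<otimes> (c \<otimes> v) \<otimes> (inv (Nm l a) \<otimes> Nm l a)"
        unfolding k_def using cc Fs_carrier[OF v] by (simp add: m_ac)
      also have "\<dots> = Nm (Suc l) b \<otimes> (c \<otimes> v)"
        using cc Fs_carrier[OF v] Fs_Units[OF Na] by simp
      finally show "S l (Nm l a \<otimes> v) * S (Suc l) (Nm (Suc l) b \<otimes> (c \<otimes> v))
          = S l (Nm l a \<otimes> v) * S (Suc l) ((c \<otimes> k) \<otimes> (Nm l a \<otimes> v))" by simp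
    qed
    also have "\<dots> = T l (c \<otimes> k)"
    proof -
      have "bij_betw (\<lambda>v. Nm l a \<otimes> v) Fs Fs"
        by (rule bij_betw_byWitness[where f' = "\<lambda>v. inv (Nm l a) \<otimes> v"])
          (use Na Fs_closed cc in \<open>auto simp: m_assoc[symmetric]\<close>)
      then show ?thesis unfolding T_def by (rule sum.reindex_bij_betw)
    qed
    also have "\<dots> = - of_nat (geo l) - of_nat (Q ^ l) * \<psi> ((\<ominus> \<one>) [^] l \<otimes> (c \<otimes> k))"
      by (rule T_eq[OF Fs_mult[OF cF k] l])
    also have "(\<ominus> \<one>) [^] l \<otimes> (c \<otimes> k) = c \<otimes> k'"
      unfolding k'_def using cc Fs_carrier[OF k] by (simp add: m_lcomm)
    finally show ?thesis .
  qed
  have "(\<Sum>(x, y)\<in>Dset l U. ?f x * ?g y)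
      = - 1 + (\<Sum>c\<in>U - {\<zero>}. - of_nat (geo l) - of_nat (Q ^ l) * \<psi> (c \<otimes> k'))"
    unfolding sum_Dset[OF l U(1,2), of ?f ?g] using inner sum_\<psi>_Tr_nonzero[OF a(1) l] a(2)
    by (simp add: g0 del: Tr.simps)
  also have "\<dots> = - 1 - of_nat A - of_nat (Q ^ l) * (\<Sum>c\<in>U - {\<zero>}. \<psi> (c \<otimes> k'))"
    by (simp add: sum_subtractf sum_distrib_left card_U_minus A_def)
  also have "(\<Sum>c\<in>U - {\<zero>}. \<psi> (c \<otimes> k')) = (\<Sum>c\<in>U. \<psi> (c \<otimes> k')) - 1"
    using U(2) finite_U Fs_carrier[OF k'] by (simp add: sum_diff1 \<psi>_zero)
  finally have eq: "(\<Sum>(x, y)\<in>Dset l U. ?f x * ?g y)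
      = - 1 - of_nat A - of_nat (Q ^ l) * ((\<Sum>c\<in>U. \<psi> (c \<otimes> k')) - 1)" .
  \<comment> \<open>The gap between the two eigenvalues; it identifies the case of a trivial
    character on \<open>U\<close> with \<open>- 1 - B\<close>.\<close>
  have BA: "B + Q ^ l = A + card U * Q ^ l"
  proof -
    have "B + Q ^ l = A + (card U - 1 + 1) * Q ^ l" by (simp add: A_def B_def geo_Suc' algebra_simps)
    then show ?thesis using card_U_pos by simp
  qed
  then have BA': "of_nat B + of_nat (Q ^ l) = (of_nat A + of_nat (card U) * of_nat (Q ^ l) :: complex)"
    by (metis of_nat_add of_nat_mult)
  have "(\<Sum>c\<in>U. \<psi> (c \<otimes> k')) \<in> {0, of_nat (card U)}"
    by (rule sum_subgroup[OF U Fs_F[OF k']])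
  then show ?thesis
  proof
    assume "(\<Sum>c\<in>U. \<psi> (c \<otimes> k')) = 0"
    then show ?thesis unfolding eq by (simp add: algebra_simps)
  next
    assume "(\<Sum>c\<in>U. \<psi> (c \<otimes> k')) \<in> {of_nat (card U)}"
    then have "- 1 - of_nat A - of_nat (Q ^ l) * ((\<Sum>c\<in>U. \<psi> (c \<otimes> k')) - 1) = - 1 - of_nat B"
      using BA' by (simp add: algebra_simps)
    then show ?thesis unfolding eq by simp
  qed
qed

text \<open>The trace forms make the group self-dual, so characters are indexed by the points of the
  group.\<close>

definition ch :: "'a \<times> 'a \<Rightarrow> 'a \<times> 'a \<Rightarrow> complex" where
  "ch = (\<lambda>(a, b) (x, y). \<psi> (Tr l (a \<otimes> x)) * \<psi> (Tr (Suc l) (b \<otimes> y)))"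

lemma ch_eigenvalue:
  assumes "a \<in> Fix l" "b \<in> Fix (Suc l)" "(a, b) \<noteq> (\<zero>, \<zero>)"
  shows "(\<Sum>d\<in>Dset l U. ch (a, b) d) \<in> {- 1 - of_nat B, of_nat (Q ^ l) - 1 - of_nat A}"
proof -
  have eq: "(\<Sum>d\<in>Dset l U. ch (a, b) d)
      = (\<Sum>(x, y)\<in>Dset l U. \<psi> (Tr l (a \<otimes> x)) * \<psi> (Tr (Suc l) (b \<otimes> y)))"
    by (simp add: ch_def case_prod_unfold del: Tr.simps)
  have triv: "\<psi> (Tr d (\<zero> \<otimes> x)) = 1" if "x \<in> Fix d'" for x d d'
    using Fix_carrier[OF that] by (simp add: Tr_zero \<psi>_zero)
  show ?thesis
  proof (cases "a = \<zero>")
    case True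
    have "(\<Sum>d\<in>Dset l U. ch (a, b) d) = (\<Sum>(x, y)\<in>Dset l U. 1 * \<psi> (Tr (Suc l) (b \<otimes> y)))"
      unfolding eq unfolding True by (intro sum.cong refl) (auto simp: Dset_def triv simp del: Tr.simps)
    then show ?thesis using sum_Dset_right[OF assms(2)] True assms(3) by simp
  next
    case False
    show ?thesis
    proof (cases "b = \<zero>")
      case True
      have "(\<Sum>d\<in>Dset l U. ch (a, b) d) = (\<Sum>(x, y)\<in>Dset l U. \<psi> (Tr l (a \<otimes> x)) * 1)"
        unfolding eq unfolding True by (intro sum.cong refl) (auto simp: Dset_def triv simp del: Tr.simps)
      then show ?thesis
        using sum_Dset_left[of "\<lambda>x. \<psi> (Tr l (a \<otimes> x))"] sum_\<psi>_Tr_nonzero[OF assms(1) l] False by simp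
    qed (use sum_Dset_both[OF assms(1) _ assms(2)] False eq in simp)
  qed
qed

lemma ch_mult:
  assumes "i \<in> Fix l \<times> Fix (Suc l)" "x \<in> carrier (V l)" "y \<in> carrier (V l)"
  shows "ch i (x \<otimes>\<^bsub>V l\<^esub> y) = ch i x * ch i y"
proof -
  obtain a b where i: "i = (a, b)" "a \<in> Fix l" "b \<in> Fix (Suc l)" using assms by auto
  obtain x1 x2 where x: "x = (x1, x2)" "x1 \<in> Fix l" "x2 \<in> Fix (Suc l)" using assms by (auto simp: carrier_V)
  obtain y1 y2 where y: "y = (y1, y2)" "y1 \<in> Fix l" "y2 \<in> Fix (Suc l)" using assms by (auto simp: carrier_V)
  have "\<psi> (Tr d (c \<otimes> (u \<oplus> v))) = \<psi> (Tr d (c \<otimes> u)) * \<psi> (Tr d (c \<otimes> v))"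
    if "c \<in> Fix d" "u \<in> Fix d" "v \<in> Fix d" for c u v d
    using that Fix_carrier by (simp add: r_distr Tr_add \<psi>_add Tr_in_F Fix_mult)
  then show ?thesis using i x y by (simp add: ch_def mult_V del: Tr.simps)
qed

text \<open>The trace pairing is symmetric, so a sum over the characters is a sum over points, where
  \<open>sum_\<psi>_Tr\<close> applies in each factor.\<close>

lemma ch_orthogonal:
  assumes "x \<in> carrier (V l)"
  shows "(\<Sum>i\<in>Fix l \<times> Fix (Suc l). ch i x)
    = (if x = \<one>\<^bsub>V l\<^esub> then of_nat (order (V l)) else 0)"
proof -
  obtain x1 x2 where x: "x = (x1, x2)" "x1 \<in> Fix l" "x2 \<in> Fix (Suc l)" using assms by (auto simp: carrier_V)
  have "(\<Sum>i\<in>Fix l \<times> Fix (Suc l). ch i x)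
      = (\<Sum>a\<in>Fix l. \<psi> (Tr l (a \<otimes> x1))) * (\<Sum>b\<in>Fix (Suc l). \<psi> (Tr (Suc l) (b \<otimes> x2)))"
    unfolding sum_product sum.cartesian_product by (simp add: ch_def x case_prod_unfold del: Tr.simps)
  also have "(\<Sum>a\<in>Fix l. \<psi> (Tr l (a \<otimes> x1))) = (\<Sum>a\<in>Fix l. \<psi> (Tr l (x1 \<otimes> a)))"
    using x Fix_carrier by (intro sum.cong refl) (simp add: m_comm)
  also have "(\<Sum>b\<in>Fix (Suc l). \<psi> (Tr (Suc l) (b \<otimes> x2))) = (\<Sum>b\<in>Fix (Suc l). \<psi> (Tr (Suc l) (x2 \<otimes> b)))"
    using x Fix_carrier by (intro sum.cong refl) (simp add: m_comm)
  finally show ?thesis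
    using sum_\<psi>_Tr[OF x(2) l] sum_\<psi>_Tr[OF x(3)] order_V[OF l]
    by (simp add: x one_V power_add[symmetric] del: Tr.simps)
qed

lemma card_Dset: "card (Dset l U) = (Q ^ l - 1) * (1 + B)"
proof -
  have "(of_nat (card (Dset l U)) :: complex) = of_nat (card (Fix l - {\<zero>})) * (1 + of_nat B)"
    using sum_Dset_left[of "\<lambda>_. 1"] by (simp add: case_prod_unfold)
  also have "\<dots> = of_nat ((Q ^ l - 1) * (1 + B))"
    using card_Fix[OF l] Fix_zero[of l] by (simp add: distrib_left)
  finally show ?thesis by (simp only: of_nat_eq_iff)
qed

text \<open>Negation changes either norm at most by a sign, and \<open>U\<close> is closed under
  negation.\<close>

lemma Dset_inv:
  assumes "d \<in> Dset l U"
  shows "inv\<^bsub>V l\<^esub> d \<in> Dset l U"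
proof -
  obtain x y where d: "d = (x, y)" and x: "x \<in> Fix l - {\<zero>}" and y: "y \<in> Fix (Suc l)"
    and r: "Nm (Suc l) y \<otimes> inv (Nm l x) \<in> U" (is "?r \<in> U")
    using assms by (auto simp: Dset_def)
  have xc: "x \<in> carrier R" and yc: "y \<in> carrier R" using x y Fix_carrier by auto
  have Nx: "Nm l x \<in> Fs" using Nm_in_Fs[OF x l] .
  note c = Fs_carrier[OF Nx] Fs_carrier[OF Fs_inv[OF Nx]] Nm_closed[OF yc, of "Suc l"]
  obtain s where s: "s \<in> {\<one>, \<ominus> \<one>}" "Nm l (\<ominus> x) = s \<otimes> Nm l x" using Nm_minus[OF xc] by blast
  obtain t where t: "t \<in> {\<one>, \<ominus> \<one>}" "Nm (Suc l) (\<ominus> y) = t \<otimes> Nm (Suc l) y" using Nm_minus[OF yc] by blast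
  have sc: "s \<in> carrier R" "t \<in> carrier R" "s \<otimes> s = \<one>" using s t by (auto simp: l_minus)
  have "(s \<otimes> Nm l x) \<otimes> (s \<otimes> inv (Nm l x)) = (s \<otimes> s) \<otimes> (Nm l x \<otimes> inv (Nm l x))"
    using sc(1) c by (simp add: m_ac)
  then have "inv (s \<otimes> Nm l x) = s \<otimes> inv (Nm l x)"
    using sc c Fs_Units[OF Nx] by (intro comm_inv_char) auto
  then have "Nm (Suc l) (\<ominus> y) \<otimes> inv (Nm l (\<ominus> x)) = (t \<otimes> s) \<otimes> ?r"
    unfolding s t using sc c by (simp add: m_ac)
  moreover have "t \<otimes> s \<in> {\<one>, \<ominus> \<one>}" using s t by (auto simp: l_minus)
  moreover have "(\<ominus> \<one>) \<otimes> ?r = \<ominus> ?r" "\<one> \<otimes> ?r = ?r" using c by (auto simp: l_minus)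
  ultimately have "Nm (Suc l) (\<ominus> y) \<otimes> inv (Nm l (\<ominus> x)) \<in> U"
    using r U(4) by auto
  then show ?thesis
    using x y xc Fix_minus by (auto simp: d inv_V Dset_def)
qed

text \<open>With valency \<open>k\<close>, \<open>k - \<theta>1 = Q ^ l * (B + 1)\<close> and
  \<open>k - \<theta>2 = A * Q ^ Suc l\<close>. Their product is \<open>A * (B + 1)\<close> times
  the group order, so mu is \<open>A * (B + 1)\<close>, and lambda is mu plus
  \<open>\<theta>1 + \<theta>2\<close>.\<close>

theorem Dset_partial_difference_set:
  "partial_difference_set (V l) (Q ^ (2 * l + 1)) ((Q ^ l - 1) * (1 + B))
     (B * (A - 1) + (Q ^ l - 2)) (A * (B + 1)) (Dset l U)"
proof -
  interpret V: comm_group "V l" by (rule comm_group_V)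
  define \<theta>1 \<theta>2 :: complex where "\<theta>1 = - 1 - of_nat B" and "\<theta>2 = of_nat (Q ^ l) - 1 - of_nat A"
  have fin: "finite (carrier (V l))" using card_Fix(2) l by (simp add: carrier_V)
  have D: "Dset l U \<subseteq> carrier (V l)" by (auto simp: Dset_def carrier_V)
  have one: "\<one>\<^bsub>V l\<^esub> \<notin> Dset l U" by (auto simp: Dset_def one_V)
  have v: "order (V l) = Q ^ (2 * l + 1)" using order_V[OF l] by (simp add: mult_2)
  have v0: "(of_nat (order (V l)) :: complex) \<noteq> 0" using v Q_pos by simp
  have Ql: "Q ^ l \<ge> 2" using l by (rule two_le_pow_Q)
  have k: "of_nat (card (Dset l U)) = (of_nat (Q ^ l) - 1) * (1 + of_nat B :: complex)"
    unfolding card_Dset of_nat_mult using Ql by (simp add: of_nat_diff)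
  have prod: "(of_nat (card (Dset l U)) - \<theta>1) * (of_nat (card (Dset l U)) - \<theta>2)
      = of_nat (A * (B + 1)) * of_nat (order (V l))"
  proof -
    have "(Q ^ l - 1) * B + A = A * Q ^ Suc l"
    proof -
      have "Q ^ l - 1 = geo l * (Q - 1)" using geo_eq[of l] by simp
      then have "(Q ^ l - 1) * B + A = A * (geo (Suc l) * (Q - 1) + 1)"
        by (simp only: A_def B_def distrib_left mult_1_right mult_ac)
      then show ?thesis by (simp only: geo_eq)
    qed
    then have "of_nat ((Q ^ l - 1) * B + A) = (of_nat (A * Q ^ Suc l) :: complex)" by (simp only:)
    then have e: "(of_nat (Q ^ l) - 1) * of_nat B + of_nat A = (of_nat A * of_nat (Q ^ Suc l) :: complex)"
      using Ql by (simp only: of_nat_add of_nat_mult of_nat_diff[of 1 "Q ^ l"] of_nat_1)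
    have "of_nat (card (Dset l U)) - \<theta>2 = of_nat A * of_nat (Q ^ Suc l)"
      unfolding k \<theta>2_def e[symmetric] by (simp add: algebra_simps)
    moreover have "of_nat (card (Dset l U)) - \<theta>1 = of_nat (Q ^ l) * of_nat (B + 1)"
      unfolding k \<theta>1_def by (simp add: algebra_simps)
    moreover have "(of_nat (order (V l)) :: complex) = of_nat (Q ^ l) * of_nat (Q ^ Suc l)"
      unfolding v by (simp add: power_add mult_2)
    ultimately show ?thesis by (simp only: of_nat_mult) (simp only: mult_ac)
  qed
  have reps: "of_nat (card (difference_reps (V l) (Dset l U) x))
      = (if x \<in> Dset l U then \<theta>1 + \<theta>2 else 0) + of_nat (A * (B + 1))"
    if x: "x \<in> carrier (V l)" "x \<noteq> \<one>\<^bsub>V l\<^esub>" for x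
  proof -
    have "of_nat (card (difference_reps (V l) (Dset l U) x)) * of_nat (order (V l)) =
      (if x \<in> Dset l U then (\<theta>1 + \<theta>2) * of_nat (order (V l)) else 0)
      + (of_nat (card (Dset l U)) - \<theta>1) * (of_nat (card (Dset l U)) - \<theta>2)"
    proof (rule V.card_difference_reps_two_eigenvalues[where I = "Fix l \<times> Fix (Suc l)"
          and ?i0.0 = "(\<zero>, \<zero>)" and ch = ch])
      show "finite (Fix l \<times> Fix (Suc l))" using card_Fix(2) l by simp
      show "ch (\<zero>, \<zero>) y = 1" if "y \<in> carrier (V l)" for y
        using that Fix_carrier by (auto simp: ch_def carrier_V Tr_zero \<psi>_zero simp del: Tr.simps)
      show "(\<Sum>d\<in>Dset l U. ch i d) \<in> {\<theta>1, \<theta>2}"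
        if "i \<in> Fix l \<times> Fix (Suc l)" "i \<noteq> (\<zero>, \<zero>)" for i
        using that ch_eigenvalue by (auto simp: \<theta>1_def \<theta>2_def)
    qed (use fin D Dset_inv ch_mult ch_orthogonal x Fix_zero in auto)
    also have "\<dots> = ((if x \<in> Dset l U then \<theta>1 + \<theta>2 else 0) + of_nat (A * (B + 1))) * of_nat (order (V l))"
      unfolding prod by (simp add: distrib_right)
    finally show ?thesis using v0 by (simp only: mult_cancel_right) simp
  qed
  \<comment> \<open>\<open>A - 1\<close> is truncated when \<open>A = 0\<close>, that is for trivial
    \<open>U\<close>; then \<open>B = 0\<close> as well and the product is unaffected.\<close>
  have lam: "\<theta>1 + \<theta>2 + of_nat (A * (B + 1)) = of_nat (B * (A - 1) + (Q ^ l - 2))"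
  proof (cases "A = 0")
    case True
    then have "B = 0" using geo_pos[OF l] by (auto simp: A_def B_def)
    then show ?thesis using True Ql by (simp add: \<theta>1_def \<theta>2_def of_nat_diff)
  next
    case False
    then have "of_nat (B * (A - 1) + (Q ^ l - 2))
        = (of_nat B * (of_nat A - 1) + (of_nat (Q ^ l) - 2) :: complex)"
      unfolding of_nat_add of_nat_mult using Ql by (simp add: of_nat_diff Suc_le_eq)
    then show ?thesis unfolding \<theta>1_def \<theta>2_def by (simp only: of_nat_add of_nat_mult of_nat_1) (simp add: algebra_simps)
  qed
  have "card (difference_reps (V l) (Dset l U) x) = B * (A - 1) + (Q ^ l - 2)" if "x \<in> Dset l U" for x
  proof -
    have "(of_nat (card (difference_reps (V l) (Dset l U) x)) :: complex) = of_nat (B * (A - 1) + (Q ^ l - 2))"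
      using reps[of x] that D one lam by auto
    then show ?thesis by (simp only: of_nat_eq_iff)
  qed
  moreover have "card (difference_reps (V l) (Dset l U) x) = A * (B + 1)"
    if "x \<in> carrier (V l) - Dset l U" "x \<noteq> \<one>\<^bsub>V l\<^esub>" for x
  proof -
    have "(of_nat (card (difference_reps (V l) (Dset l U) x)) :: complex) = of_nat (A * (B + 1))"
      using reps[of x] that by simp
    then show ?thesis by (simp only: of_nat_eq_iff)
  qed
  ultimately show ?thesis
    using V.is_group fin v D card_Dset one unfolding partial_difference_set_def by simp
qed

end

end

section \<open>Existence of the field, the character and the subgroup\<close>

text \<open>The witness is the algebraic closure of \<open>residue_ring (int p)\<close>. Its type is
  that of polynomials whose variables are indexed by a polynomial and a number.\<close>

lemma exists_algebraically_closed_char: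
  fixes p :: nat
  assumes "prime p"
  shows "\<exists>R :: ((int list \<times> nat) multiset \<Rightarrow> int) ring.
    algebraically_closed R \<and> [p] \<cdot>\<^bsub>R\<^esub> \<one>\<^bsub>R\<^esub> = \<zero>\<^bsub>R\<^esub>"
proof -
  interpret P: residues_prime p "residue_ring (int p)"
    using assms by (simp add: residues_prime_def)
  let ?Z = "residue_ring (int p)" and ?C = "field.alg_closure (residue_ring (int p))"
  interpret C: algebraic_closure ?C "ring.indexed_const ?Z ` carrier ?Z"
    by (rule P.alg_closureE)
  interpret h: ring_hom_ring ?Z ?C "ring.indexed_const ?Z"
    by (rule ring_hom_ringI2[OF P.is_ring C.is_ring P.alg_closureE(2)])
  have Z: "[n] \<cdot>\<^bsub>?Z\<^esub> \<one>\<^bsub>?Z\<^esub> = int n mod int p" for n :: nat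
    by (induction n) (simp_all add: P.res_zero_eq P.res_one_eq P.res_add_eq mod_simps add.commute)
  have "[n] \<cdot>\<^bsub>?C\<^esub> \<one>\<^bsub>?C\<^esub> = ring.indexed_const ?Z ([n] \<cdot>\<^bsub>?Z\<^esub> \<one>\<^bsub>?Z\<^esub>)" for n :: nat
    by (induction n) simp_all
  then have "[p] \<cdot>\<^bsub>?C\<^esub> \<one>\<^bsub>?C\<^esub> = ring.indexed_const ?Z \<zero>\<^bsub>?Z\<^esub>"
    by (simp add: Z P.res_zero_eq)
  then show ?thesis using C.algebraically_closed_axioms by auto
qed

context frobenius_field
begin

text \<open>Identify \<open>F\<close> with vectors modulo \<open>p\<close> and exponentiate
  coordinate 0, which exists because \<open>e > 0\<close>.\<close>

lemma exists_character: "\<exists>\<psi>. frobenius_character R p e \<psi>"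
proof -
  interpret A: comm_group "addg (Fix 1)" by (rule comm_group_addg)
  let ?E = "elementary_abelian_group p e"
  have p0: "p > 0" and p1: "p > 1" using prime_p prime_gt_0_nat prime_gt_1_nat by blast+
  have "x [^]\<^bsub>addg (Fix 1)\<^esub> p = \<one>\<^bsub>addg (Fix 1)\<^esub>" if "x \<in> carrier (addg (Fix 1))" for x
    using that pow_addg[of x 1 p] add_pow_eq_zero[OF char_p dvd_refl] Fix_carrier
    by (simp add: addg_simps)
  moreover have "order (addg (Fix 1)) = p ^ e" "finite (carrier (addg (Fix 1)))"
    using card_Fix[of 1] by (simp_all add: order_def addg_simps Q_def)
  ultimately obtain f where f: "f \<in> iso (addg (Fix 1)) ?E"
    using A.iso_elementary_abelian_group[OF _ prime_p] by blast
  interpret f: group_hom "addg (Fix 1)" ?E f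
    using f A.is_group group_elementary_abelian_group
    by (simp add: group_hom_def group_hom_axioms_def iso_def)
  define \<psi> where "\<psi> x = cis (2 * pi * of_int (f x 0) / of_nat p)" for x
  have cis_int: "cis (2 * pi * of_int k) = 1" for k :: int
    by (simp add: complex_eq_iff cos_int_2pin sin_int_2pin)
  have cis_mod: "cis (2 * pi * of_int (k mod int p) / of_nat p) = cis (2 * pi * of_int k / of_nat p)" for k :: int
  proof -
    have "2 * pi * of_int k / of_nat p
        = 2 * pi * of_int (k mod int p) / of_nat p + 2 * pi * of_int (k div int p)"
    proof -
      have "real_of_int k = of_int (k mod int p) + of_int (k div int p) * of_nat p"
        by (metis mod_div_mult_eq of_int_add of_int_mult of_int_of_nat_eq)
      then show ?thesis using p0 by (simp add: field_simps)
    qed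
    then show ?thesis by (simp add: cis_mult[symmetric] cis_int)
  qed
  have add: "\<psi> (x \<oplus> y) = \<psi> x * \<psi> y" if "x \<in> F" "y \<in> F" for x y
  proof -
    have "f (x \<oplus> y) = f x \<otimes>\<^bsub>?E\<^esub> f y"
      using f.hom_mult[of x y] that by (simp add: addg_simps F_eq_Fix)
    then have "f (x \<oplus> y) 0 = (f x 0 + f y 0) mod int p"
      using e_pos by (simp add: elementary_abelian_group_def)
    then show ?thesis
      by (simp add: \<psi>_def cis_mod cis_mult add_divide_distrib distrib_left)
  qed
  have zero: "\<psi> \<zero> = 1"
    using f.hom_one e_pos by (simp add: \<psi>_def addg_simps elementary_abelian_group_def)
  \<comment> \<open>A vector with coordinate 0 equal to 1; its character value has argument
    \<open>2 * pi / p\<close> and so differs from 1.\<close>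
  have "(\<lambda>i\<in>{..<e}. 1) \<in> carrier ?E"
    using p1 by (auto simp: carrier_elementary_abelian_group p0)
  moreover have "f ` carrier (addg (Fix 1)) = carrier ?E"
    using f by (simp add: iso_def bij_betw_def)
  ultimately have "(\<lambda>i\<in>{..<e}. 1) \<in> f ` F" by (simp add: addg_simps F_eq_Fix)
  then obtain t where t: "t \<in> F" "f t = (\<lambda>i\<in>{..<e}. 1)" by (elim imageE) auto
  have "\<psi> t \<noteq> 1"
  proof
    assume "\<psi> t = 1"
    then have "cos (2 * pi / p) = 1"
      using t e_pos by (simp add: \<psi>_def complex_eq_iff)
    moreover have "cos (2 * pi / p) < cos 0"
    proof (cases "p = 2")
      case False
      then have "2 * pi / p \<le> pi" "2 * pi / p > 0" using p1 by (simp_all add: field_simps)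
      then show ?thesis by (intro cos_monotone_0_pi) auto
    qed simp
    ultimately show False by simp
  qed
  then have "frobenius_character R p e \<psi>"
    by unfold_locales (use add zero t in auto)
  then show ?thesis by blast
qed

text \<open>\<open>sylow_thm\<close> allows \<open>p\<close> to divide the cofactor, so it provides
  subgroups of every order \<open>p ^ k\<close>, not only the maximal one.\<close>

lemma exists_additive_subgroup:
  assumes "k \<le> e"
  shows "\<exists>U\<subseteq>F. \<zero> \<in> U \<and> (\<forall>x\<in>U. \<forall>y\<in>U. x \<oplus> y \<in> U) \<and> (\<forall>x\<in>U. \<ominus> x \<in> U) \<and> card U = p ^ k"
proof -
  interpret A: comm_group "addg (Fix 1)" by (rule comm_group_addg)
  have "order (addg (Fix 1)) = p ^ k * p ^ (e - k)"
    using card_Fix[of 1] assms by (simp add: order_def addg_simps Q_def power_add[symmetric])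
  moreover have "finite (carrier (addg (Fix 1)))" using card_Fix[of 1] by (simp add: addg_simps)
  ultimately obtain U where U: "subgroup U (addg (Fix 1))" "card U = p ^ k"
    using sylow_thm[OF prime_p A.is_group] by blast
  interpret U: subgroup U "addg (Fix 1)" by (rule U(1))
  have sub: "U \<subseteq> Fix 1" using U.subset by (simp add: addg_simps)
  show ?thesis
  proof (intro exI[of _ U] conjI ballI U(2))
    show "U \<subseteq> F" using sub by (simp add: F_eq_Fix)
    show "\<zero> \<in> U" using U.one_closed by (simp add: addg_simps)
    show "x \<oplus> y \<in> U" if "x \<in> U" "y \<in> U" for x y using U.m_closed[OF that] by (simp add: addg_simps)
    show "\<ominus> x \<in> U" if "x \<in> U" for x using U.m_inv_closed[OF that] inv_addg[of x 1] sub that by auto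
  qed
qed

lemma exists_partial_difference_set:
  assumes l: "l > 0" and k: "k \<le> e"
  defines "A \<equiv> (p ^ k - 1) * geo l" and "B \<equiv> (p ^ k - 1) * geo (Suc l)"
  shows "\<exists>D. partial_difference_set (V l) (Q ^ (2 * l + 1)) ((Q ^ l - 1) * (1 + B))
      (B * (A - 1) + (Q ^ l - 2)) (A * (B + 1)) D \<and> D = set_inv\<^bsub>V l\<^esub> D"
proof -
  obtain \<psi> where "frobenius_character R p e \<psi>" using exists_character by blast
  then interpret C: frobenius_character R p e \<psi> .
  obtain U where U: "U \<subseteq> F" "\<zero> \<in> U" "\<And>x y. x \<in> U \<Longrightarrow> y \<in> U \<Longrightarrow> x \<oplus> y \<in> U"
    "\<And>x. x \<in> U \<Longrightarrow> \<ominus> x \<in> U" "card U = p ^ k"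
    using exists_additive_subgroup[OF k] by blast
  let ?D = "C.Dset l U"
  have pds: "partial_difference_set (V l) (Q ^ (2 * l + 1)) ((Q ^ l - 1) * (1 + B))
      (B * (A - 1) + (Q ^ l - 2)) (A * (B + 1)) ?D"
    using C.Dset_partial_difference_set[OF l U(1-4)] by (simp add: U(5) A_def B_def)
  interpret V: comm_group "V l" by (rule comm_group_V)
  have inv: "inv\<^bsub>V l\<^esub> d \<in> ?D" if "d \<in> ?D" for d by (rule C.Dset_inv[OF l U(1-4) that])
  have D: "?D \<subseteq> carrier (V l)" using pds by (simp add: partial_difference_set_def)
  have "?D = set_inv\<^bsub>V l\<^esub> ?D"
  proof (intro equalityI subsetI)
    fix d assume d: "d \<in> ?D"
    then have "d = inv\<^bsub>V l\<^esub> (inv\<^bsub>V l\<^esub> d)" using D by auto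
    then show "d \<in> set_inv\<^bsub>V l\<^esub> ?D" using inv[OF d] unfolding SET_INV_def by blast
  qed (use inv in \<open>auto simp: SET_INV_def\<close>)
  with pds show ?thesis by blast
qed

lemma exists_partial_difference_set_elementary_abelian:
  assumes l: "l > 0" and k: "k \<le> e"
  defines "A \<equiv> (p ^ k - 1) * geo l" and "B \<equiv> (p ^ k - 1) * geo (Suc l)"
    and "E \<equiv> elementary_abelian_group p (e * (2 * l + 1))"
  shows "\<exists>D. partial_difference_set E (Q ^ (2 * l + 1)) ((Q ^ l - 1) * (1 + B))
      (B * (A - 1) + (Q ^ l - 2)) (A * (B + 1)) D \<and> D = set_inv\<^bsub>E\<^esub> D"
proof -
  interpret V: comm_group "V l" by (rule comm_group_V)
  obtain D where D: "partial_difference_set (V l) (Q ^ (2 * l + 1)) ((Q ^ l - 1) * (1 + B))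
      (B * (A - 1) + (Q ^ l - 2)) (A * (B + 1)) D" "D = set_inv\<^bsub>V l\<^esub> D"
    using exists_partial_difference_set[OF l k] unfolding A_def B_def by blast
  have v: "Q ^ (2 * l + 1) = p ^ (e * (2 * l + 1))"
    unfolding Q_def by (rule power_mult[symmetric])
  have fin: "finite (carrier (V l))" "order (V l) = p ^ (e * (2 * l + 1))" "D \<subseteq> carrier (V l)"
    using D(1) unfolding partial_difference_set_def v by simp_all
  obtain f where f: "f \<in> iso (V l) E"
    using V.iso_elementary_abelian_group[OF fin(1) prime_p fin(2) pow_V] unfolding E_def by blast
  have E: "group E" unfolding E_def by (rule group_elementary_abelian_group)
  show ?thesis
    using partial_difference_set_iso[OF D(1) E f] set_inv_iso[OF V.is_group E f fin(3) D(2)] by blast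
qed

end

theorem theorem1p10:
  fixes p s q m l r :: nat
  assumes "prime p" and "s \<ge> 1" and "q = p ^ s" and "m \<ge> 1" and "l \<ge> 1" and "r \<le> m"
  shows "\<exists>(k::nat) (lam::nat) (mu::nat) (D :: (nat \<Rightarrow> int) set).
    real k = (real q ^ r - 1) * (real q ^ (m * l) - 1) * (real q ^ (m * (l + 1)) - 1)
               / (real q ^ m - 1) + real q ^ (m * l) - 1 \<and>
    real lam = (real q ^ r - 1) * (real q ^ (m * (l + 1)) - 1) / (real q ^ m - 1)
               * ((real q ^ r - 1) * (real q ^ (m * l) - 1) / (real q ^ m - 1) - 1)
               + real q ^ (m * l) - 2 \<and>
    real mu = (real q ^ r - 1) * (real q ^ (m * l) - 1) / (real q ^ m - 1)
               * ((real q ^ r - 1) * (real q ^ (m * (l + 1)) - 1) / (real q ^ m - 1) + 1) \<and>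
    partial_difference_set (elementary_abelian_group p (s * m * (2 * l + 1)))
      (q ^ (m * (2 * l + 1))) k lam mu D \<and>
    D = set_inv\<^bsub>elementary_abelian_group p (s * m * (2 * l + 1))\<^esub> D \<and>
    strongly_regular_graph (q ^ (m * (2 * l + 1))) k lam mu
      (cayley_graph (elementary_abelian_group p (s * m * (2 * l + 1))) D)"
proof -
  obtain R :: "((int list \<times> nat) multiset \<Rightarrow> int) ring"
    where R: "algebraically_closed R" "[p] \<cdot>\<^bsub>R\<^esub> \<one>\<^bsub>R\<^esub> = \<zero>\<^bsub>R\<^esub>"
    using exists_algebraically_closed_char[OF assms(1)] by blast
  interpret frobenius_field R p "s * m"
    using R assms by (simp add: frobenius_field_def frobenius_field_axioms_def)
  \<comment> \<open>The subgroup has order \<open>p ^ (s * r) = q ^ r\<close>;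
    \<open>r \<le> m\<close> lets it fit into \<open>F\<close>, which has order
    \<open>p ^ (s * m)\<close>.\<close>
  define A where "A = (p ^ (s * r) - 1) * geo l"
  define B where "B = (p ^ (s * r) - 1) * geo (Suc l)"
  define k where "k = (Q ^ l - 1) * (1 + B)"
  define lam where "lam = B * (A - 1) + (Q ^ l - 2)"
  define mu where "mu = A * (B + 1)"
  let ?E = "elementary_abelian_group p (s * m * (2 * l + 1))"
  have Q: "Q = q ^ m" by (simp add: Q_def assms(3) power_mult)
  have v: "Q ^ (2 * l + 1) = q ^ (m * (2 * l + 1))" unfolding Q by (rule power_mult[symmetric])
  have l: "l > 0" using assms(5) by simp
  obtain D where pds: "partial_difference_set ?E (q ^ (m * (2 * l + 1))) k lam mu D"
    and sym: "D = set_inv\<^bsub>?E\<^esub> D"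
    using exists_partial_difference_set_elementary_abelian[OF l, of "s * r"] assms(6)
    unfolding v k_def lam_def mu_def A_def B_def by auto
  have srg: "strongly_regular_graph (q ^ (m * (2 * l + 1))) k lam mu (cayley_graph ?E D)"
    by (rule cayley_graph_strongly_regular[OF pds sym])
  have Ql: "Q ^ l \<ge> 2" using l by (rule two_le_pow_Q)
  have geo: "real (geo d) = (real Q ^ d - 1) / (real Q - 1)" for d
  proof -
    have "real (geo d) * (real Q - 1) + 1 = real Q ^ d"
      using arg_cong[OF geo_eq[of d], of real] Q_pos by (simp add: of_nat_diff Suc_le_eq)
    moreover have "real Q - 1 \<noteq> 0" using Q_gt_1 by simp
    ultimately show ?thesis by (simp add: field_simps)
  qed
  have u: "real (p ^ (s * r) - 1) = real q ^ r - 1"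
    using prime_gt_0_nat[OF assms(1)] by (simp add: of_nat_diff assms(3) power_mult Suc_le_eq)
  have A: "real A = (real q ^ r - 1) * (real q ^ (m * l) - 1) / (real q ^ m - 1)"
    unfolding A_def of_nat_mult u geo by (simp add: Q power_mult)
  have B: "real B = (real q ^ r - 1) * (real q ^ (m * (l + 1)) - 1) / (real q ^ m - 1)"
    unfolding B_def of_nat_mult u geo by (simp add: Q power_mult[symmetric] power_add[symmetric])
  have Qr: "real (Q ^ l) = real q ^ (m * l)" by (simp add: Q power_mult)
  have "real k = (real q ^ (m * l) - 1) * (1 + real B)"
    unfolding k_def of_nat_mult Qr[symmetric] using Ql by (simp add: of_nat_diff)
  then have k: "real k = (real q ^ r - 1) * (real q ^ (m * l) - 1) * (real q ^ (m * (l + 1)) - 1)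
               / (real q ^ m - 1) + real q ^ (m * l) - 1"
    unfolding B by (simp add: algebra_simps)
  \<comment> \<open>For \<open>r = 0\<close> the natural number \<open>A - 1\<close> is truncated,
    but then \<open>B = 0\<close> too, so the real formula still agrees.\<close>
  have lam: "real lam = real B * (real A - 1) + real q ^ (m * l) - 2"
  proof (cases "A = 0")
    case True
    then have "B = 0" using geo_pos[OF l] by (auto simp: A_def B_def)
    then show ?thesis unfolding lam_def Qr[symmetric] using Ql by (simp add: of_nat_diff)
  next
    case False
    then show ?thesis unfolding lam_def Qr[symmetric] using Ql by (simp add: of_nat_diff Suc_le_eq)
  qed
  have mu: "real mu = real A * (real B + 1)" by (simp add: mu_def distrib_left)
  show ?thesis
    using k lam mu pds sym srg unfolding A B by blast
qed

end
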